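(* There is a polynomial-time algorithm that, given any SMC instance $\mathcal I=\langle M,W,U,V\rangle$ and any rational $\varepsilon\in[0,1]$, computes a fractional matching $\mu$ that is $\varepsilon$-stable for $\mathcal I$ and satisfies $\mathcal W(\mu)\ge\varepsilon\,\mathcal W(\mu^{\mathrm{opt}})$, where $\mu^{\mathrm{opt}}$ is an optimal matching for $\mathcal I$.
   Context: An SMC instance is a tuple $\langle M,W,U,V\rangle$ with $n$ men $M$, $n$ women $W$, and $n\times n$ matrices $U,V$ of non-negative rational numbers; $U(m,w)$ is the value of man $m$ for woman $w$ and $V(m,w)$ is the value of woman $w$ for man $m$. A fractional matching is $\mu:M\times W\to\mathbb R_{\ge0}$ with $\sum_w\mu(m,w)\le1$ for all $m$ and $\sum_m\mu(m,w)\le1$ for all $w$; it is complete if all these hold with equality. Unless stated otherwise, matchings are assumed complete. Utilities: $u_m(\mu)=\sum_w U(m,w)\mu(m,w)$, $v_w(\mu)=\sum_m V(m,w)\mu(m,w)$. The matching $\mu$ is $\varepsilon$-stable if for every $(m,w)\in M\times W$, $u_m(\mu)\ge(1-\varepsilon)U(m,w)$ or $v_w(\mu)\ge(1-\varepsilon)V(m,w)$. Social welfare: $\mathcal W(\mu)=\sum_m u_m(\mu)+\sum_w v_w(\mu)$. An optimal matching is one maximizing $\mathcal W$ among all (not necessarily stable) fractional matchings. *)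

theory Defs
  imports Complex_Main "HOL-Computational_Algebra.Polynomial" "HOL-Library.Log_Nat"
begin

section \<open>Stable matching with cardinal preferences\<close>

text \<open>
  The men and the women of an instance are both numbered \<open>0, \<dots>, n - 1\<close>. Only the entries of
  the matrices (and of a matching) with both indices below \<open>n\<close> are meaningful.
\<close>

record smc =
  agents :: nat                       \<comment> \<open>\<open>n\<close>, the number of men and also of women\<close>
  U :: "nat \<Rightarrow> nat \<Rightarrow> rat"            \<comment> \<open>\<open>U m w\<close>: value of man \<open>m\<close> for woman \<open>w\<close>\<close>
  V :: "nat \<Rightarrow> nat \<Rightarrow> rat"            \<comment> \<open>\<open>V m w\<close>: value of woman \<open>w\<close> for man \<open>m\<close>\<close>

definition smc_instance :: "smc \<Rightarrow> bool" where
  "smc_instance I \<longleftrightarrow> (\<forall>m<agents I. \<forall>w<agents I. 0 \<le> U I m w \<and> 0 \<le> V I m w)"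

type_synonym matching = "nat \<Rightarrow> nat \<Rightarrow> real"

definition fractional_matching :: "smc \<Rightarrow> matching \<Rightarrow> bool" where
  "fractional_matching I \<mu> \<longleftrightarrow>
     (\<forall>m<agents I. \<forall>w<agents I. 0 \<le> \<mu> m w) \<and>
     (\<forall>m<agents I. (\<Sum>w<agents I. \<mu> m w) \<le> 1) \<and>
     (\<forall>w<agents I. (\<Sum>m<agents I. \<mu> m w) \<le> 1)"

definition complete_matching :: "smc \<Rightarrow> matching \<Rightarrow> bool" where
  "complete_matching I \<mu> \<longleftrightarrow>
     fractional_matching I \<mu> \<and>
     (\<forall>m<agents I. (\<Sum>w<agents I. \<mu> m w) = 1) \<and>
     (\<forall>w<agents I. (\<Sum>m<agents I. \<mu> m w) = 1)"

definition man_utility :: "smc \<Rightarrow> matching \<Rightarrow> nat \<Rightarrow> real" where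
  "man_utility I \<mu> m = (\<Sum>w<agents I. of_rat (U I m w) * \<mu> m w)"

definition woman_utility :: "smc \<Rightarrow> matching \<Rightarrow> nat \<Rightarrow> real" where
  "woman_utility I \<mu> w = (\<Sum>m<agents I. of_rat (V I m w) * \<mu> m w)"

definition welfare :: "smc \<Rightarrow> matching \<Rightarrow> real" where
  "welfare I \<mu> = (\<Sum>m<agents I. man_utility I \<mu> m) + (\<Sum>w<agents I. woman_utility I \<mu> w)"

definition eps_stable :: "smc \<Rightarrow> real \<Rightarrow> matching \<Rightarrow> bool" where
  "eps_stable I \<epsilon> \<mu> \<longleftrightarrow>
     (\<forall>m<agents I. \<forall>w<agents I.
        man_utility I \<mu> m \<ge> (1 - \<epsilon>) * of_rat (U I m w) \<or>
        woman_utility I \<mu> w \<ge> (1 - \<epsilon>) * of_rat (V I m w))"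

text \<open>
  Matchings are complete unless stated otherwise, so the maximum ranges over the complete ones.
  As all values are non-negative, incomplete matchings would not increase it.
\<close>

definition optimal_matching :: "smc \<Rightarrow> matching \<Rightarrow> bool" where
  "optimal_matching I \<mu> \<longleftrightarrow>
     complete_matching I \<mu> \<and> (\<forall>\<nu>. complete_matching I \<nu> \<longrightarrow> welfare I \<nu> \<le> welfare I \<mu>)"


section \<open>Random access programs with logarithmic (bit) cost\<close>

text \<open>
  The machine model is a random access machine over the integers with the logarithmic cost
  measure, presented as a while language. The memory consists of unbounded integer arrays, of
  which a program can mention only finitely many; a scalar variable is cell \<open>0\<close> of an array.
  Every arithmetic operation and memory access is charged at least the number of bits of its operands, and multiplication the
  product of their lengths, so that polynomial time in this model coincides with polynomial time
  on Turing machines.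
\<close>

type_synonym vname = string
type_synonym store = "vname \<Rightarrow> int \<Rightarrow> int"

datatype aexp =
    Num int
  | Read vname aexp
  | Add aexp aexp
  | Sub aexp aexp
  | Mul aexp aexp

datatype bexp =
    Less aexp aexp
  | Neg bexp
  | Conj bexp bexp

datatype com =
    Skip
  | Write vname aexp aexp             \<comment> \<open>\<open>Write x i a\<close> is the assignment \<open>x[i] := a\<close>\<close>
  | Seq com com
  | Cond bexp com com
  | Loop bexp com

text \<open>Number of binary digits, plus one for the sign.\<close>

definition len :: "int \<Rightarrow> nat" where
  "len z = Suc (floorlog 2 (nat \<bar>z\<bar>))"

fun aval :: "aexp \<Rightarrow> store \<Rightarrow> int" where
  "aval (Num z) s = z"
| "aval (Read x i) s = s x (aval i s)"
| "aval (Add a b) s = aval a s + aval b s"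
| "aval (Sub a b) s = aval a s - aval b s"
| "aval (Mul a b) s = aval a s * aval b s"

fun bval :: "bexp \<Rightarrow> store \<Rightarrow> bool" where
  "bval (Less a b) s \<longleftrightarrow> aval a s < aval b s"
| "bval (Neg b) s \<longleftrightarrow> \<not> bval b s"
| "bval (Conj b c) s \<longleftrightarrow> bval b s \<and> bval c s"

fun acost :: "aexp \<Rightarrow> store \<Rightarrow> nat" where
  "acost (Num z) s = len z"
| "acost (Read x i) s = acost i s + len (aval i s) + len (s x (aval i s))"
| "acost (Add a b) s = acost a s + acost b s + len (aval a s) + len (aval b s)"
| "acost (Sub a b) s = acost a s + acost b s + len (aval a s) + len (aval b s)"
| "acost (Mul a b) s = acost a s + acost b s + len (aval a s) * len (aval b s)"

fun bcost :: "bexp \<Rightarrow> store \<Rightarrow> nat" where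
  "bcost (Less a b) s = acost a s + acost b s + len (aval a s) + len (aval b s)"
| "bcost (Neg b) s = Suc (bcost b s)"
| "bcost (Conj b c) s = Suc (bcost b s + bcost c s)"

text \<open>\<open>exec c s t s'\<close>: started in \<open>s\<close>, the program \<open>c\<close> halts in \<open>s'\<close> after time \<open>t\<close>.\<close>

inductive exec :: "com \<Rightarrow> store \<Rightarrow> nat \<Rightarrow> store \<Rightarrow> bool" where
  Skip: "exec Skip s 1 s"
| Write: "exec (Write x i a) s
     (acost i s + acost a s + len (aval i s) + len (aval a s))
     (s(x := (s x)(aval i s := aval a s)))"
| Seq: "exec c s t s' \<Longrightarrow> exec d s' t' s'' \<Longrightarrow> exec (Seq c d) s (t + t') s''"
| CondTrue: "bval b s \<Longrightarrow> exec c s t s' \<Longrightarrow> exec (Cond b c d) s (Suc (bcost b s + t)) s'"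
| CondFalse: "\<not> bval b s \<Longrightarrow> exec d s t s' \<Longrightarrow> exec (Cond b c d) s (Suc (bcost b s + t)) s'"
| LoopFalse: "\<not> bval b s \<Longrightarrow> exec (Loop b c) s (Suc (bcost b s)) s"
| LoopTrue: "bval b s \<Longrightarrow> exec c s t s' \<Longrightarrow> exec (Loop b c) s' t' s'' \<Longrightarrow>
     exec (Loop b c) s (Suc (bcost b s + t + t')) s''"

inductive_cases exec_SkipE: "exec Skip s t s'"
inductive_cases exec_WriteE: "exec (Write x i a) s t s'"
inductive_cases exec_SeqE: "exec (Seq c d) s t s'"
inductive_cases exec_CondE: "exec (Cond b c d) s t s'"
inductive_cases exec_LoopE: "exec (Loop b c) s t s'"

lemma exec_deterministic:
  "exec c s t s' \<Longrightarrow> exec c s u s'' \<Longrightarrow> u = t \<and> s'' = s'"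
proof (induction arbitrary: u s'' rule: exec.induct)
  case (Skip s)
  then show ?case by (auto elim: exec_SkipE)
next
  case (Write x i a s)
  then show ?case by (auto elim: exec_WriteE)
next
  case (Seq c s t s' d t' s1)
  from Seq.prems show ?case by (rule exec_SeqE) (use Seq.IH in blast)
next
  case (CondTrue b s c t s' d)
  from CondTrue.prems show ?case by (rule exec_CondE) (use CondTrue in blast)+
next
  case (CondFalse b s d t s' c)
  from CondFalse.prems show ?case by (rule exec_CondE) (use CondFalse in blast)+
next
  case (LoopFalse b s c)
  from LoopFalse.prems show ?case by (rule exec_LoopE) (use LoopFalse in blast)+
next
  case (LoopTrue b s c t s' t' s1)
  from LoopTrue.prems show ?case by (rule exec_LoopE) (use LoopTrue in blast)+
qed

text \<open>Inputs and outputs are finite lists of integers; all memory not used by the input is \<open>0\<close>.\<close>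

definition load :: "int list \<Rightarrow> store" where
  "load xs = (\<lambda>x k.
     if x = ''inlen'' \<and> k = 0 then int (length xs)
     else if x = ''input'' \<and> 0 \<le> k \<and> k < int (length xs) then xs ! nat k
     else 0)"

definition result :: "store \<Rightarrow> int list" where
  "result s = map (\<lambda>k. s ''output'' (int k)) [0..<nat (s ''outlen'' 0)]"

definition bits :: "int list \<Rightarrow> nat" where
  "bits xs = sum_list (map len xs)"

text \<open>
  The time includes the number of bits of the output, because merely setting \<open>outlen\<close> to a large
  number would otherwise produce a long output cheaply.
\<close>

definition computes_within :: "com \<Rightarrow> int list \<Rightarrow> nat \<Rightarrow> int list \<Rightarrow> bool" where
  "computes_within c xs T ys \<longleftrightarrow>
     (\<exists>t s. exec c (load xs) t s \<and> result s = ys \<and> t + bits ys \<le> T)"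


section \<open>Encoding of instances and matchings\<close>

text \<open>Numerator and denominator in lowest terms, the denominator being positive.\<close>

definition encode_rat :: "rat \<Rightarrow> int list" where
  "encode_rat q = [fst (quotient_of q), snd (quotient_of q)]"

definition encode_matrix :: "nat \<Rightarrow> (nat \<Rightarrow> nat \<Rightarrow> rat) \<Rightarrow> int list" where
  "encode_matrix n A = concat (map (\<lambda>i. concat (map (\<lambda>j. encode_rat (A i j)) [0..<n])) [0..<n])"

definition encode_input :: "smc \<Rightarrow> rat \<Rightarrow> int list" where
  "encode_input I \<epsilon> =
     int (agents I) # encode_rat \<epsilon> @ encode_matrix (agents I) (U I) @ encode_matrix (agents I) (V I)"

text \<open>
  A matching is output row by row like the input matrices, each entry as a numerator and a
  positive denominator, which need not be coprime.
\<close>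

definition represents_matching :: "nat \<Rightarrow> int list \<Rightarrow> matching \<Rightarrow> bool" where
  "represents_matching n ys \<mu> \<longleftrightarrow>
     length ys = 2 * n * n \<and>
     (\<forall>m<n. \<forall>w<n. ys ! (2 * (m * n + w) + 1) > 0 \<and>
        \<mu> m w = of_int (ys ! (2 * (m * n + w))) / of_int (ys ! (2 * (m * n + w) + 1)))"

end

theory Submission
  imports Defs
begin

text \<open>
  The matching is \<open>\<mu> = (1 - \<epsilon>) \<cdot> \<mu>\<^sub>s + \<epsilon> \<cdot> \<mu>\<^sub>o\<close>, where \<open>\<mu>\<^sub>s\<close> is an ordinary stable matching for the
  preferences induced by the values and \<open>\<mu>\<^sub>o\<close> is an optimal perfect matching. As all values are
  non-negative, every man and woman keeps a fraction \<open>1 - \<epsilon>\<close> of the utility under \<open>\<mu>\<^sub>s\<close>, and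
  \<open>\<W>(\<mu>) \<ge> \<epsilon> \<cdot> \<W>(\<mu>\<^sub>o)\<close> by linearity.

  Both matchings come from one bidding loop: a free man takes the column maximising his row of a
  matrix \<open>Q\<close>, displaces its holder, and that column of \<open>Q\<close> is lowered. If the entries of those
  whom the woman likes no better than her new partner become \<open>-1\<close>, this is deferred acceptance;
  if the whole column drops by \<open>e\<close>, it is Bertsekas' auction. The auction runs with
  \<open>e = 2^L, \<dots>, 2, 1\<close>, which makes it polynomial, on integer weights multiplied by \<open>n + 1\<close>. Its
  final prices are rounded to exact dual prices, and weak duality then gives optimality among all
  fractional matchings, without the Birkhoff--von Neumann theorem.
\<close>

section \<open>Cost of expressions over bounded stores\<close>

text \<open>Time is counted in bits, so every value that is ever stored needs a bound fixed in
  advance. A single \<open>B\<close>, with a number of digits linear in the input length, serves for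
  the entire run, and timing reduces to counting steps. The delicate quantities are the prices. A
  phase with increment \<open>e\<close> restarts with nobody assigned but keeps the lowered matrix,
  for which the matching that ended the previous phase is near optimal with error
  \<open>2 * e\<close>. That old matching survives only in the proof, where it shows that no column
  falls by more than \<open>(3 * n + 3) * e\<close>. Hence the number of bids in a phase does not
  depend on the size of the values, and the falls of all phases sum to a geometric series. The
  familiar end of the argument, that an error below the spacing of the weights excludes a better
  perfect matching, does not speak of fractional matchings; exact dual prices do. The factor
  \<open>n + 1\<close> is what makes the rounding possible: \<open>n\<close> prices cannot meet all
  \<open>n + 1\<close> residue classes.\<close>

lemma len_pos: "1 \<le> len z"
  by (simp add: len_def)

lemma len_mono: "\<bar>x\<bar> \<le> \<bar>y\<bar> \<Longrightarrow> len x \<le> len y"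
  by (auto simp: len_def intro!: floorlog_mono)

lemma len_le: "\<bar>z\<bar> < 2 ^ k \<Longrightarrow> len z \<le> Suc k"
proof -
  assume "\<bar>z\<bar> < 2 ^ k"
  then have "nat \<bar>z\<bar> < 2 ^ k" by (simp add: nat_less_iff)
  then have "floorlog 2 (nat \<bar>z\<bar>) \<le> k"
    by (cases "nat \<bar>z\<bar> = 0") (simp_all add: floorlog_eq_zero_iff floorlog_le_iff)
  then show ?thesis by (simp add: len_def)
qed

lemma abs_less_len: "\<bar>z\<bar> < 2 ^ (len z - 1)"
proof (cases "z = 0")
  case False
  then have "nat \<bar>z\<bar> < 2 ^ floorlog 2 (nat \<bar>z\<bar>)"
    using floorlog_bounds[of "nat \<bar>z\<bar>" 2] by simp
  then show ?thesis by (simp add: len_def nat_less_iff)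
qed (simp add: len_def)

text \<open>A carry costs one digit, which is paid for by the sign digit of the shorter summand.
  This crude additive form lets the width of an expression be computed from its syntax
  alone.\<close>

lemma len_add: "len (x + y) \<le> len x + len y"
proof -
  define m where "m = max (len x - 1) (len y - 1)"
  have "\<bar>x\<bar> < 2 ^ m" "\<bar>y\<bar> < 2 ^ m"
    using abs_less_len[of x] abs_less_len[of y]
    by (auto simp: m_def intro: less_le_trans power_increasing)
  then have "\<bar>x + y\<bar> < 2 ^ Suc m" by simp
  then have "len (x + y) \<le> Suc (Suc m)" by (rule len_le)
  also have "\<dots> \<le> len x + len y" using len_pos[of x] len_pos[of y] by (simp add: m_def)
  finally show ?thesis .
qed

lemma len_diff: "len (x - y) \<le> len x + len y"
  using len_add[of x "- y"] by (simp add: len_def)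

lemma len_mult: "len (x * y) \<le> len x + len y"
proof -
  have "\<bar>x * y\<bar> < 2 ^ (len x - 1) * 2 ^ (len y - 1)"
    unfolding abs_mult by (intro mult_strict_mono' abs_less_len) auto
  then have "len (x * y) \<le> Suc (len x - 1 + (len y - 1))"
    by (intro len_le) (simp add: power_add)
  then show ?thesis using len_pos[of x] len_pos[of y] by simp
qed

text \<open>All cells of all arrays are covered, negative indices included, so a read is bounded
  without any reasoning about its address.\<close>

definition bounded_by :: "int \<Rightarrow> store \<Rightarrow> bool" where
  "bounded_by B s \<longleftrightarrow> (\<forall>x k. \<bar>s x k\<bar> \<le> B)"

text \<open>Length of the value of an expression, in units of \<open>len B\<close>. It is
  independent of the store, since a read yields one word whatever the address.\<close>

primrec awidth :: "aexp \<Rightarrow> nat" where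
  "awidth (Num z) = len z"
| "awidth (Read x i) = 1"
| "awidth (Add a b) = awidth a + awidth b"
| "awidth (Sub a b) = awidth a + awidth b"
| "awidth (Mul a b) = awidth a + awidth b"

text \<open>Cost of an evaluation in units of the square of \<open>len B\<close>; the square comes
  from multiplication, which is charged the product of two lengths.\<close>

primrec aweight :: "aexp \<Rightarrow> nat" where
  "aweight (Num z) = len z"
| "aweight (Read x i) = aweight i + awidth i + 1"
| "aweight (Add a b) = aweight a + aweight b + awidth a + awidth b"
| "aweight (Sub a b) = aweight a + aweight b + awidth a + awidth b"
| "aweight (Mul a b) = aweight a + aweight b + awidth a * awidth b"

primrec bweight :: "bexp \<Rightarrow> nat" where
  "bweight (Less a b) = aweight a + aweight b + awidth a + awidth b"
| "bweight (Neg b) = Suc (bweight b)"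
| "bweight (Conj b c) = Suc (bweight b + bweight c)"

text \<open>Maxima instead of sums: this is the price of the dearest single step, while the number
  of steps is accounted for separately.\<close>

primrec weight :: "com \<Rightarrow> nat" where
  "weight Skip = 1"
| "weight (Write x i a) = aweight i + aweight a + awidth i + awidth a"
| "weight (Seq c d) = max (weight c) (weight d)"
| "weight (Cond b c d) = max (Suc (bweight b)) (max (weight c) (weight d))"
| "weight (Loop b c) = max (Suc (bweight b)) (weight c)"

lemma len_aval_le:
  assumes "bounded_by B s"
  shows "len (aval a s) \<le> awidth a * len B"
proof (induction a)
  case (Num z)
  then show ?case using len_pos[of B] by simp
next
  case (Read x i)
  have "\<bar>s x (aval i s)\<bar> \<le> \<bar>B\<bar>" using assms unfolding bounded_by_def by (meson abs_ge_self order_trans)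
  then show ?case by (simp add: len_mono)
next
  case (Add a b)
  then show ?case using len_add[of "aval a s" "aval b s"] by (simp add: algebra_simps)
next
  case (Sub a b)
  then show ?case using len_diff[of "aval a s" "aval b s"] by (simp add: algebra_simps)
next
  case (Mul a b)
  then show ?case using len_mult[of "aval a s" "aval b s"] by (simp add: algebra_simps)
qed

lemma len_aval_le2:
  assumes "bounded_by B s"
  shows "len (aval a s) \<le> awidth a * (len B)\<^sup>2"
  by (rule order_trans[OF len_aval_le[OF assms]])
     (use len_pos[of B] in \<open>simp add: power2_eq_square\<close>)

lemma acost_le:
  assumes "bounded_by B s"
  shows "acost a s \<le> aweight a * (len B)\<^sup>2"
proof (induction a)
  case (Num z)
  then show ?case using len_pos[of B] by simp
next
  case (Read x i)
  then show ?case
    using len_aval_le2[OF assms, of i] len_aval_le2[OF assms, of "Read x i"]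
    by (simp add: algebra_simps)
next
  case (Add a b)
  then show ?case
    using len_aval_le2[OF assms, of a] len_aval_le2[OF assms, of b] by (simp add: algebra_simps)
next
  case (Sub a b)
  then show ?case
    using len_aval_le2[OF assms, of a] len_aval_le2[OF assms, of b] by (simp add: algebra_simps)
next
  case (Mul a b)
  have "len (aval a s) * len (aval b s) \<le> (awidth a * len B) * (awidth b * len B)"
    by (intro mult_mono len_aval_le assms) auto
  then show ?case using Mul by (simp add: algebra_simps power2_eq_square)
qed

lemma bcost_le:
  assumes "bounded_by B s"
  shows "bcost b s \<le> bweight b * (len B)\<^sup>2"
proof (induction b)
  case (Less a b)
  then show ?case
    using len_aval_le2[OF assms, of a] len_aval_le2[OF assms, of b]
      acost_le[OF assms, of a] acost_le[OF assms, of b] by (simp add: algebra_simps)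
next
  case (Neg b)
  moreover have "1 \<le> (len B)\<^sup>2" using len_pos[of B] by simp
  ultimately show ?case by simp
next
  case (Conj b c)
  moreover have "1 \<le> (len B)\<^sup>2" using len_pos[of B] by simp
  ultimately show ?case by (simp add: algebra_simps)
qed

lemma Suc_bcost_le:
  assumes "bounded_by B s"
  shows "Suc (bcost b s) \<le> Suc (bweight b) * (len B)\<^sup>2"
  using bcost_le[OF assms, of "Neg b"] by simp

section \<open>A total correctness calculus with running time\<close>

text \<open>
  Time is counted in units of the most expensive elementary step of \<open>c\<close> over a store bounded
  by \<open>B\<close>, so that sequential composition simply adds up numbers of steps.
\<close>

definition wp :: "int \<Rightarrow> com \<Rightarrow> nat \<Rightarrow> (store \<Rightarrow> bool) \<Rightarrow> store \<Rightarrow> bool" where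
  "wp B c T Q s \<longleftrightarrow>
     (\<exists>t s'. exec c s t s' \<and> t \<le> T * (weight c * (len B)\<^sup>2) \<and> bounded_by B s' \<and> Q s')"

primrec mods :: "com \<Rightarrow> vname set" where
  "mods Skip = {}"
| "mods (Write x i a) = {x}"
| "mods (Seq c d) = mods c \<union> mods d"
| "mods (Cond b c d) = mods c \<union> mods d"
| "mods (Loop b c) = mods c"

lemma exec_mods: "exec c s t s' \<Longrightarrow> x \<notin> mods c \<Longrightarrow> s' x = s x"
  by (induction rule: exec.induct) auto

text \<open>Besides weakening the postcondition, the rule hands over the frame: arrays outside
  \<open>mods c\<close> are unchanged. Specifications can therefore be confined to the arrays that a
  program writes.\<close>

lemma wp_conseq:
  assumes "wp B c T Q s" "T \<le> T'"
    and "\<And>s'. Q s' \<Longrightarrow> bounded_by B s' \<Longrightarrow> (\<And>x. x \<notin> mods c \<Longrightarrow> s' x = s x) \<Longrightarrow> Q' s'"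
  shows "wp B c T' Q' s"
  using assms exec_mods unfolding wp_def by (meson mult_le_mono1 order_trans)

lemma wp_Skip: "bounded_by B s \<Longrightarrow> Q s \<Longrightarrow> wp B Skip 1 Q s"
  unfolding wp_def using len_pos[of B] exec.Skip[of s] by (intro exI[of _ 1] exI[of _ s]) auto

lemma wp_Write:
  assumes "bounded_by B s" "\<bar>aval a s\<bar> \<le> B"
    and "bounded_by B (s(x := (s x)(aval i s := aval a s))) \<Longrightarrow> Q (s(x := (s x)(aval i s := aval a s)))"
  shows "wp B (Write x i a) 1 Q s"
proof -
  have "bounded_by B (s(x := (s x)(aval i s := aval a s)))"
    using assms(1,2) by (auto simp: bounded_by_def)
  moreover have "acost i s + acost a s + len (aval i s) + len (aval a s)
      \<le> weight (Write x i a) * (len B)\<^sup>2"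
    using acost_le[OF assms(1), of i] acost_le[OF assms(1), of a]
      len_aval_le2[OF assms(1), of i] len_aval_le2[OF assms(1), of a]
    by (simp add: algebra_simps)
  ultimately show ?thesis
    unfolding wp_def using assms(3) by (metis exec.Write mult_1)
qed

lemma wp_Seq:
  assumes "wp B c T (\<lambda>s'. bounded_by B s' \<longrightarrow> wp B d T' Q s') s"
  shows "wp B (Seq c d) (T + T') Q s"
proof -
  obtain t s' where 1: "exec c s t s'" "t \<le> T * (weight c * (len B)\<^sup>2)" "bounded_by B s'"
    "wp B d T' Q s'" using assms unfolding wp_def by blast
  then obtain t' s'' where 2: "exec d s' t' s''" "t' \<le> T' * (weight d * (len B)\<^sup>2)"
    "bounded_by B s''" "Q s''" unfolding wp_def by blast
  have "t + t' \<le> T * (weight (Seq c d) * (len B)\<^sup>2) + T' * (weight (Seq c d) * (len B)\<^sup>2)"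
    by (intro add_mono order_trans[OF 1(2)] order_trans[OF 2(2)] mult_mono) auto
  then show ?thesis
    unfolding wp_def using exec.Seq[OF 1(1) 2(1)] 2(3,4) by (metis add_mult_distrib)
qed

lemma wp_Seq_conseq:
  assumes "wp B c T R s"
    and "\<And>s'. R s' \<Longrightarrow> bounded_by B s' \<Longrightarrow> (\<And>x. x \<notin> mods c \<Longrightarrow> s' x = s x) \<Longrightarrow> wp B d T' Q s'"
  shows "wp B (Seq c d) (T + T') Q s"
  by (rule wp_Seq, rule wp_conseq[OF assms(1)]) (use assms(2) in auto)

lemma wp_Seq_Write:
  assumes "bounded_by B s" "\<bar>aval a s\<bar> \<le> B"
    and "bounded_by B (s(x := (s x)(aval i s := aval a s))) \<Longrightarrow>
      wp B d T Q (s(x := (s x)(aval i s := aval a s)))"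
  shows "wp B (Seq (Write x i a) d) (Suc T) Q s"
  using wp_Seq[OF wp_Write, where T' = T and d = d and Q = Q] assms by simp

lemma wp_Cond:
  assumes "bounded_by B s" "bval b s \<Longrightarrow> wp B c T Q s" "\<not> bval b s \<Longrightarrow> wp B d T Q s"
  shows "wp B (Cond b c d) (Suc T) Q s"
proof -
  let ?w = "weight (Cond b c d) * (len B)\<^sup>2"
  have b: "Suc (bcost b s) \<le> ?w"
    by (rule order_trans[OF Suc_bcost_le[OF assms(1)]], rule mult_le_mono1) simp
  obtain t s' where "exec (Cond b c d) s (Suc (bcost b s + t)) s'" "t \<le> T * ?w"
    "bounded_by B s'" "Q s'"
  proof (cases "bval b s")
    case True
    then obtain t s' where 1: "exec c s t s'" "t \<le> T * (weight c * (len B)\<^sup>2)"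
      "bounded_by B s'" "Q s'" using assms(2) unfolding wp_def by blast
    have "t \<le> T * ?w" by (rule order_trans[OF 1(2)]) (simp add: le_max_iff_disj)
    then show ?thesis using that 1 exec.CondTrue[OF True 1(1)] by blast
  next
    case False
    then obtain t s' where 1: "exec d s t s'" "t \<le> T * (weight d * (len B)\<^sup>2)"
      "bounded_by B s'" "Q s'" using assms(3) unfolding wp_def by blast
    have "t \<le> T * ?w" by (rule order_trans[OF 1(2)]) (simp add: le_max_iff_disj)
    then show ?thesis using that 1 exec.CondFalse[OF False 1(1)] by blast
  qed
  moreover from this(2) b have "Suc (bcost b s + t) \<le> Suc T * ?w" by simp
  ultimately show ?thesis unfolding wp_def by blast
qed

text \<open>The invariant carries a natural number that every round makes strictly smaller; its
  initial value bounds the number of rounds, each costing \<open>T\<close> for the body and 1 for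
  the guard.\<close>

lemma wp_Loop:
  fixes Inv :: "nat \<Rightarrow> store \<Rightarrow> bool"
  assumes "bounded_by B s" "Inv k s"
    and body: "\<And>k s'. Inv k s' \<Longrightarrow> bounded_by B s' \<Longrightarrow> bval b s' \<Longrightarrow>
      (\<And>x. x \<notin> mods c \<Longrightarrow> s' x = s x) \<Longrightarrow> wp B c T (\<lambda>s''. \<exists>k'<k. Inv k' s'') s'"
    and exit: "\<And>k s'. Inv k s' \<Longrightarrow> bounded_by B s' \<Longrightarrow> \<not> bval b s' \<Longrightarrow>
      (\<And>x. x \<notin> mods c \<Longrightarrow> s' x = s x) \<Longrightarrow> Q s'"
  shows "wp B (Loop b c) (Suc (k * Suc T)) Q s"
proof -
  let ?w = "weight (Loop b c) * (len B)\<^sup>2"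
  have "\<exists>t s''. exec (Loop b c) s' t s'' \<and> t \<le> Suc (k * Suc T) * ?w \<and> bounded_by B s'' \<and> Q s''"
    if "Inv k s'" "bounded_by B s'" "\<And>x. x \<notin> mods c \<Longrightarrow> s' x = s x" for k s'
    using that
  proof (induction k arbitrary: s' rule: less_induct)
    case (less k)
    have b: "Suc (bcost b s') \<le> ?w"
      by (rule order_trans[OF Suc_bcost_le[OF less.prems(2)]], rule mult_le_mono1) simp
    show ?case
    proof (cases "bval b s'")
      case True
      with body[OF less.prems(1,2) True less.prems(3)]
      obtain t s2 k' where 1: "exec c s' t s2" "t \<le> T * (weight c * (len B)\<^sup>2)"
        "bounded_by B s2" "k' < k" "Inv k' s2" unfolding wp_def by blast
      have t: "t \<le> T * ?w" by (rule order_trans[OF 1(2)]) (simp add: le_max_iff_disj)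
      have "\<And>x. x \<notin> mods c \<Longrightarrow> s2 x = s x" using exec_mods[OF 1(1)] less.prems(3) by auto
      then obtain t' s3 where 2: "exec (Loop b c) s2 t' s3" "t' \<le> Suc (k' * Suc T) * ?w"
        "bounded_by B s3" "Q s3" using less.IH[OF 1(4,5,3)] by blast
      \<comment> \<open>The subtracted \<open>T\<close> pays for the round just executed, and the
        outer \<open>Suc\<close> of the claimed bound pays for its guard. A decrease of the measure
        by more than one only leaves time over.\<close>
      have "t' \<le> (k * Suc T - T) * ?w"
      proof (rule order_trans[OF 2(2)], rule mult_right_mono)
        obtain j where "k = Suc (k' + j)" using less_imp_Suc_add[OF 1(4)] by blast
        then show "Suc (k' * Suc T) \<le> k * Suc T - T" by (simp add: algebra_simps)
      qed simp
      moreover have "T * ?w + (k * Suc T - T) * ?w = (k * Suc T) * ?w"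
        using 1(4) by (cases k) (auto simp flip: add_mult_distrib)
      ultimately have "Suc (bcost b s' + t + t') \<le> Suc (k * Suc T) * ?w"
        using b t by simp
      then show ?thesis using exec.LoopTrue[OF True 1(1) 2(1)] 2(3,4) by blast
    next
      case False
      have "Suc (bcost b s') \<le> Suc (k * Suc T) * ?w" using b by simp
      then show ?thesis using exec.LoopFalse[OF False, of c] exit[OF less.prems(1,2) False less.prems(3)]
        less.prems(2) by blast
    qed
  qed
  from this[OF assms(2,1)] show ?thesis unfolding wp_def by blast
qed

section \<open>Counting loops\<close>

abbreviation Var :: "vname \<Rightarrow> aexp" where
  "Var x \<equiv> Read x (Num 0)"

text \<open>The bound \<open>a\<close> is evaluated anew before each round, which is why the rule
  for this loop asks that the invariant and the frame fix its value.\<close>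

definition For :: "vname \<Rightarrow> aexp \<Rightarrow> com \<Rightarrow> com" where
  "For x a c = Seq (Write x (Num 0) (Num 0))
     (Loop (Less (Var x) a) (Seq c (Write x (Num 0) (Add (Var x) (Num 1)))))"

lemma mods_For [simp]: "mods (For x a c) = insert x (mods c)"
  by (auto simp: For_def)

text \<open>The invariant must not mention the loop variable, as its value is tracked by the rule.\<close>

lemma wp_For:
  fixes Inv :: "nat \<Rightarrow> store \<Rightarrow> bool"
  assumes "bounded_by B s" "int N \<le> B" "Inv 0 s" "x \<notin> mods c"
    and indep: "\<And>i s v. Inv i (s(x := v)) = Inv i s"
    and range: "\<And>i s'. Inv i s' \<Longrightarrow> (\<And>y. y \<notin> insert x (mods c) \<Longrightarrow> s' y = s y) \<Longrightarrow> aval a s' = int N"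
    and body: "\<And>i s'. i < N \<Longrightarrow> Inv i s' \<Longrightarrow> bounded_by B s' \<Longrightarrow> s' x 0 = int i \<Longrightarrow>
      (\<And>y. y \<notin> insert x (mods c) \<Longrightarrow> s' y = s y) \<Longrightarrow> wp B c T (Inv (Suc i)) s'"
    and exit: "\<And>s'. Inv N s' \<Longrightarrow> bounded_by B s' \<Longrightarrow>
      (\<And>y. y \<notin> insert x (mods c) \<Longrightarrow> s' y = s y) \<Longrightarrow> Q s'"
  shows "wp B (For x a c) (N * (T + 2) + 2) Q s"
proof -
  have B: "0 \<le> B" using assms(2) by simp
  define s1 where "s1 = s(x := (s x)(0 := 0))"
  let ?c = "Seq c (Write x (Num 0) (Add (Var x) (Num 1)))"
  \<comment> \<open>\<open>wp_Loop\<close> counts down whereas the invariant counts up: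
    \<open>k\<close> rounds to come correspond to stage \<open>N - k\<close>. The conjunct
    \<open>k \<le> N\<close> keeps the truncated subtraction exact.\<close>
  define J where "J k s' \<longleftrightarrow> k \<le> N \<and> Inv (N - k) s' \<and> s' x 0 = int (N - k)" for k s'
  have loop: "wp B (Loop (Less (Var x) a) ?c) (Suc (N * Suc (T + 1))) Q s1" if b1: "bounded_by B s1"
  proof (rule wp_Loop[where Inv = J])
    show "bounded_by B s1" by fact
    show "J N s1" using assms(3) by (simp add: J_def s1_def indep)
  next
    fix k s'
    assume J: "J k s'" and bd: "bounded_by B s'" and b: "bval (Less (Var x) a) s'"
      and fr: "\<And>y. y \<notin> mods ?c \<Longrightarrow> s' y = s1 y"
    have fr': "s' y = s y" if "y \<notin> insert x (mods c)" for y
      using fr[of y] that by (simp add: s1_def)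
    have k: "k \<noteq> 0" "k \<le> N" using J b range[of "N - k" s'] fr' by (auto simp: J_def)
    then have N: "N - k < N" "Suc (N - k) = N - (k - 1)" by auto
    have "wp B c T (Inv (Suc (N - k))) s'"
      using J by (intro body[OF N(1) _ bd _ fr']) (auto simp: J_def)
    then have "wp B c T (\<lambda>s'. bounded_by B s' \<longrightarrow>
        wp B (Write x (Num 0) (Add (Var x) (Num 1))) 1 (\<lambda>s''. \<exists>k'<k. J k' s'') s') s'"
    proof (rule wp_conseq)
      fix s2
      assume I: "Inv (Suc (N - k)) s2" and fr2: "\<And>y. y \<notin> mods c \<Longrightarrow> s2 y = s' y"
      have x: "s2 x 0 = int (N - k)" using fr2[of x] assms(4) J by (simp add: J_def)
      show "bounded_by B s2 \<longrightarrow>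
        wp B (Write x (Num 0) (Add (Var x) (Num 1))) 1 (\<lambda>s''. \<exists>k'<k. J k' s'') s2"
      proof
        assume bd2: "bounded_by B s2"
        show "wp B (Write x (Num 0) (Add (Var x) (Num 1))) 1 (\<lambda>s''. \<exists>k'<k. J k' s'') s2"
        proof (rule wp_Write[OF bd2])
          show "\<bar>aval (Add (Var x) (Num 1)) s2\<bar> \<le> B" using x N k assms(2) by simp
          have "J (k - 1) (s2(x := (s2 x)(0 := s2 x 0 + 1)))"
            using I x N k by (auto simp: J_def indep)
          then show "\<exists>k'<k. J k' (s2(x := (s2 x)(aval (Num 0) s2 := aval (Add (Var x) (Num 1)) s2)))"
            using k by (intro exI[of _ "k - 1"]) auto
        qed
      qed
    qed simp
    then show "wp B ?c (T + 1) (\<lambda>s''. \<exists>k'<k. J k' s'') s'" by (rule wp_Seq)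
  next
    fix k s'
    assume J: "J k s'" and bd: "bounded_by B s'" and b: "\<not> bval (Less (Var x) a) s'"
      and fr: "\<And>y. y \<notin> mods ?c \<Longrightarrow> s' y = s1 y"
    have fr': "s' y = s y" if "y \<notin> insert x (mods c)" for y
      using fr[of y] that by (simp add: s1_def)
    have "k = 0" using J b range[of "N - k" s'] fr' by (auto simp: J_def)
    then show "Q s'" using J by (intro exit[OF _ bd fr']) (auto simp: J_def)
  qed
  have "wp B (For x a c) (1 + Suc (N * Suc (T + 1))) Q s"
    unfolding For_def
    by (rule wp_Seq, rule wp_Write) (use assms(1) B loop in \<open>auto simp: s1_def\<close>)
  then show ?thesis by simp
qed

section \<open>Bidding\<close>

text \<open>\<open>S\<close> maps men to women and \<open>H\<close> women to men, with \<open>-1\<close> for nobody.\<close>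

definition mutual :: "nat \<Rightarrow> (int \<Rightarrow> int) \<Rightarrow> (int \<Rightarrow> int) \<Rightarrow> bool" where
  "mutual n S H \<longleftrightarrow>
     (\<forall>i<n. S (int i) = -1 \<or> (\<exists>j<n. S (int i) = int j \<and> H (int j) = int i)) \<and>
     (\<forall>j<n. H (int j) = -1 \<or> (\<exists>i<n. H (int j) = int i \<and> S (int i) = int j))"

lemma mutualD:
  assumes "mutual n S H"
  shows "i < n \<Longrightarrow> S (int i) = -1 \<or> (\<exists>j<n. S (int i) = int j \<and> H (int j) = int i)"
    and "j < n \<Longrightarrow> H (int j) = -1 \<or> (\<exists>i<n. H (int j) = int i \<and> S (int i) = int j)"
  using assms unfolding mutual_def by blast+

text \<open>One formula serves both a held and a free \<open>j\<close>: if
  \<open>H (int j) = -1\<close>, the first update touches cell \<open>-1\<close> of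
  \<open>S\<close>, outside the range that \<open>mutual\<close> speaks of. Otherwise it releases
  the former holder.\<close>

lemma mutual_step:
  assumes "mutual n S H" "i < n" "j < n" "S (int i) = -1"
  shows "mutual n (S(H (int j) := -1, int i := int j)) (H(int j := int i))"
  unfolding mutual_def
proof (intro conjI allI impI)
  fix a assume a: "a < n"
  let ?S = "S(H (int j) := -1, int i := int j)" and ?H = "H(int j := int i)"
  consider "a = i" | "a \<noteq> i" "H (int j) = int a" | "a \<noteq> i" "H (int j) \<noteq> int a" by blast
  then show "?S (int a) = -1 \<or> (\<exists>b<n. ?S (int a) = int b \<and> ?H (int b) = int a)"
  proof cases
    case 3
    then have "?S (int a) = S (int a)" by auto
    with 3 mutualD(1)[OF assms(1) a] show ?thesis by auto
  qed (use assms in auto)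
next
  fix b assume b: "b < n"
  let ?S = "S(H (int j) := -1, int i := int j)" and ?H = "H(int j := int i)"
  show "?H (int b) = -1 \<or> (\<exists>a<n. ?H (int b) = int a \<and> ?S (int a) = int b)"
  proof (cases "b = j")
    case False
    then have H: "?H (int b) = H (int b)" by simp
    show ?thesis
    proof (cases "H (int b) = -1")
      case False
      then obtain a where a: "a < n" "H (int b) = int a" "S (int a) = int b"
        using mutualD(2)[OF assms(1) b] by blast
      moreover have "a \<noteq> i" using a assms by auto
      moreover have "H (int j) \<noteq> int a" using mutualD(2)[OF assms(1,3)] a \<open>b \<noteq> j\<close> by auto
      ultimately show ?thesis using H by auto
    qed (use H in simp)
  qed (use assms in auto)
qed

text \<open>If every woman were held, sending her to her holder would inject \<open>n\<close> women
  into \<open>n\<close> men, hence reach the free man \<open>i\<close>.\<close>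

lemma mutual_free_both:
  assumes "mutual n S H" "i < n" "S (int i) = -1"
  obtains j where "j < n" "H (int j) = -1"
proof (rule ccontr)
  assume "\<not> thesis"
  then have full: "\<forall>j<n. \<exists>i<n. H (int j) = int i \<and> S (int i) = int j"
    using that mutualD(2)[OF assms(1)] by blast
  define h where "h j = nat (H (int j))" for j
  have h: "h j < n" "S (int (h j)) = int j" if "j < n" for j
    using full that by (auto simp: h_def)
  have "inj_on h {..<n}" by (rule inj_onI) (metis h(2) lessThan_iff of_nat_eq_iff)
  then have "h ` {..<n} = {..<n}"
    by (intro card_subset_eq) (auto simp: card_image h)
  then obtain j where "j < n" "h j = i" using assms(2) by (metis imageE lessThan_iff)
  then show False using h(2) assms(3) by force
qed

text \<open>\<open>H\<close> is a left inverse of the assignment, so the latter is injective, and an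
  injection of a finite set into itself is onto.\<close>

lemma mutual_full:
  assumes "mutual n S H" "\<forall>i<n. S (int i) \<noteq> -1"
  shows "bij_betw (\<lambda>i. nat (S (int i))) {..<n} {..<n}"
    and "\<forall>j<n. H (int j) \<noteq> -1"
proof -
  let ?f = "\<lambda>i. nat (S (int i))"
  have f: "?f i < n" "H (int (?f i)) = int i" if "i < n" for i
    using mutualD(1)[OF assms(1) that] assms(2) that by auto
  have inj: "inj_on ?f {..<n}" by (rule inj_onI) (metis f(2) lessThan_iff of_nat_eq_iff)
  then have im: "?f ` {..<n} = {..<n}"
    by (intro card_subset_eq) (auto simp: card_image f)
  then show "bij_betw ?f {..<n} {..<n}" using inj by (simp add: bij_betw_def)
  show "\<forall>j<n. H (int j) \<noteq> -1"
  proof (intro allI impI)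
    fix j assume "j < n"
    then have "j \<in> ?f ` {..<n}" using im by simp
    then obtain i where "i < n" "j = ?f i" by blast
    then have "H (int j) = int i" using f(2) by blast
    then show "H (int j) \<noteq> -1" by simp
  qed
qed

section \<open>Deferred acceptance\<close>

text \<open>\<open>Q m w\<close> is man \<open>m\<close>'s value for \<open>w\<close>, or \<open>-1\<close> once \<open>w\<close> would reject him.\<close>

definition gs_inv :: "nat \<Rightarrow> (nat \<Rightarrow> nat \<Rightarrow> int) \<Rightarrow> (nat \<Rightarrow> nat \<Rightarrow> int) \<Rightarrow> nat \<Rightarrow>
    (nat \<Rightarrow> nat \<Rightarrow> int) \<Rightarrow> (int \<Rightarrow> int) \<Rightarrow> (int \<Rightarrow> int) \<Rightarrow> bool" where
  "gs_inv n u v k Q S H \<longleftrightarrow> mutual n S H \<and>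
     (\<forall>m<n. \<forall>w<n. Q m w = (if \<exists>h<n. H (int w) = int h \<and> v m w \<le> v h w then -1 else u m w)) \<and>
     (\<forall>m<n. \<forall>j<n. S (int m) = int j \<longrightarrow> (\<forall>w<n. Q m w \<le> u m j)) \<and>
     k = card {(m, w). m < n \<and> w < n \<and> 0 \<le> Q m w}"

text \<open>The best entry of a free man is non-negative, so the woman he chooses has not rejected
  him and strictly prefers him to her holder. The measure counts non-negative entries of
  \<open>Q\<close>; it drops because his own entry is struck out along with those of the men she
  likes no better.\<close>

lemma gs_step:
  assumes inv: "gs_inv n u v k Q S H" and u: "\<forall>m<n. \<forall>w<n. 0 \<le> u m w"
    and ij: "i < n" "S (int i) = -1" "j < n" "\<forall>w<n. Q i w \<le> Q i j"
    and Q': "\<forall>m<n. \<forall>w<n. Q' m w = (if w = j then if v i j < v m j then Q m j else -1 else Q m w)"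
  shows "\<exists>k'<k. gs_inv n u v k' Q' (S(H (int j) := -1, int i := int j)) (H(int j := int i))"
proof -
  let ?S = "S(H (int j) := -1, int i := int j)" and ?H = "H(int j := int i)"
  have mut: "mutual n S H"
    and Q: "\<And>m w. m < n \<Longrightarrow> w < n \<Longrightarrow>
      Q m w = (if \<exists>h<n. H (int w) = int h \<and> v m w \<le> v h w then -1 else u m w)"
    and S: "\<And>m j w. m < n \<Longrightarrow> j < n \<Longrightarrow> S (int m) = int j \<Longrightarrow> w < n \<Longrightarrow> Q m w \<le> u m j"
    and k: "k = card {(m, w). m < n \<and> w < n \<and> 0 \<le> Q m w}"
    using inv unfolding gs_inv_def by blast+
  \<comment> \<open>A free man implies a free woman, and the column of a free woman still shows the
    original values.\<close>
  have pos: "0 \<le> Q i j"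
  proof -
    obtain w where w: "w < n" "H (int w) = -1" using mutual_free_both[OF mut ij(1,2)] .
    then have "0 \<le> Q i w" using Q[OF ij(1)] u ij(1) by auto
    then show ?thesis using ij(4) w by force
  qed
  have old: "v h j < v i j" if "h < n" "H (int j) = int h" for h
    using pos Q[OF ij(1,3)] that by (auto split: if_splits)
  have uij: "Q i j = u i j" using pos Q[OF ij(1,3)] by (auto split: if_splits)
  have le: "Q' m w \<le> Q m w" if "m < n" "w < n" for m w
  proof -
    have "-1 \<le> u m w" using u that by force
    then show ?thesis using Q' that Q[OF that] by (auto split: if_splits)
  qed
  let ?A = "\<lambda>Q. {(m, w). m < n \<and> w < n \<and> (0::int) \<le> Q m w}"
  have fin: "finite (?A Q)" for Q
    by (rule finite_subset[of _ "{..<n} \<times> {..<n}"]) auto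
  have "?A Q' \<subset> ?A Q"
  proof (rule psubsetI)
    show "?A Q' \<subseteq> ?A Q" using le by force
    have "(i, j) \<in> ?A Q" "(i, j) \<notin> ?A Q'" using ij pos Q' by auto
    then show "?A Q' \<noteq> ?A Q" by blast
  qed
  then have "card (?A Q') < k" unfolding k using fin by (rule psubset_card_mono[rotated])
  moreover have "gs_inv n u v (card (?A Q')) Q' ?S ?H"
    unfolding gs_inv_def
  proof (intro conjI allI impI)
    show "mutual n ?S ?H" by (rule mutual_step[OF mut ij(1,3,2)])
  next
    fix m w assume mw: "m < n" "w < n"
    show "Q' m w = (if \<exists>h<n. ?H (int w) = int h \<and> v m w \<le> v h w then -1 else u m w)"
    proof (cases "w = j")
      case True
      show ?thesis
      proof (cases "v i j < v m j")
        case True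
        \<comment> \<open>A man whom \<open>j\<close> prefers to \<open>i\<close> is also preferred
          to her former holder, who ranks below \<open>i\<close>, so his entry had not been struck
          out earlier.\<close>
        then have "\<not> (\<exists>h<n. H (int j) = int h \<and> v m j \<le> v h j)" using old by fastforce
        then show ?thesis using Q[OF mw] Q' mw \<open>w = j\<close> True ij(1) by auto
      qed (use Q' mw True ij(1) in auto)
    qed (use Q[OF mw] Q' mw in auto)
  next
    fix m b w assume m: "m < n" "b < n" "?S (int m) = int b" "w < n"
    show "Q' m w \<le> u m b"
    proof (cases "m = i")
      case True
      then show ?thesis using m le[of i w] ij uij by force
    next
      case False
      then have "S (int m) = int b" using m(3) by (auto split: if_splits)
      then show ?thesis using S[OF m(1,2) _ m(4)] le[OF m(1,4)] by force
    qed
  qed simp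
  ultimately show ?thesis by blast
qed

lemma gs_init:
  assumes "\<forall>i<n. S (int i) = -1" "\<forall>i<n. H (int i) = -1" "\<forall>m<n. \<forall>w<n. Q m w = u m w"
  shows "\<exists>k\<le>n * n. gs_inv n u v k Q S H"
proof -
  let ?A = "{(m, w). m < n \<and> w < n \<and> 0 \<le> Q m w}"
  have "card ?A \<le> card ({..<n} \<times> {..<n})" by (rule card_mono) auto
  moreover have "gs_inv n u v (card ?A) Q S H"
    using assms by (auto simp: gs_inv_def mutual_def)
  ultimately show ?thesis by auto
qed

text \<open>For each pair, either the entry was struck out, and then the woman's holder is at least
  as good for her, or it still shows the man's value, which the entry of his partner dominates by
  the invariant.\<close>

lemma gs_final:
  assumes inv: "gs_inv n u v k Q S H" and "\<forall>i<n. S (int i) \<noteq> -1"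
  shows "\<exists>\<sigma>. bij_betw \<sigma> {..<n} {..<n} \<and> (\<forall>m<n. S (int m) = int (\<sigma> m)) \<and>
    (\<forall>m<n. \<forall>w<n. u m w \<le> u m (\<sigma> m) \<or> (\<exists>h<n. \<sigma> h = w \<and> v m w \<le> v h w))"
proof (intro exI conjI allI impI)
  have mut: "mutual n S H" using inv by (simp add: gs_inv_def)
  let ?\<sigma> = "\<lambda>i. nat (S (int i))"
  show "bij_betw ?\<sigma> {..<n} {..<n}" by (rule mutual_full[OF mut assms(2)])
  have S: "S (int m) = int (?\<sigma> m)" "?\<sigma> m < n" if "m < n" for m
    using mutualD(1)[OF mut that] assms(2) that by auto
  then show "S (int m) = int (?\<sigma> m)" if "m < n" for m using that by blast
  fix m w assume mw: "m < n" "w < n"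
  show "u m w \<le> u m (?\<sigma> m) \<or> (\<exists>h<n. ?\<sigma> h = w \<and> v m w \<le> v h w)"
  proof (cases "\<exists>h<n. H (int w) = int h \<and> v m w \<le> v h w")
    case True
    then obtain h where h: "h < n" "H (int w) = int h" "v m w \<le> v h w" by blast
    then have "S (int h) = int w" using mutualD(2)[OF mut mw(2)] by auto
    then show ?thesis using h by auto
  next
    case False
    then have "Q m w = u m w" using inv mw unfolding gs_inv_def by auto
    then show ?thesis using inv mw S[OF mw(1)] unfolding gs_inv_def by metis
  qed
qed

section \<open>The auction\<close>

text \<open>
  \<open>d w\<close> counts the bids for \<open>w\<close> in the current phase, which started from \<open>Q0\<close>, and \<open>k\<close> bounds the
  number of bids still to come.
\<close>

definition auction_inv :: "nat \<Rightarrow> int \<Rightarrow> (nat \<Rightarrow> nat \<Rightarrow> int) \<Rightarrow> nat \<Rightarrow>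
    (nat \<Rightarrow> nat \<Rightarrow> int) \<Rightarrow> (int \<Rightarrow> int) \<Rightarrow> (int \<Rightarrow> int) \<Rightarrow> bool" where
  "auction_inv n e Q0 k Q S H \<longleftrightarrow> mutual n S H \<and>
     (\<exists>d :: nat \<Rightarrow> nat.
       (\<forall>m<n. \<forall>w<n. Q m w = Q0 m w - e * int (d w)) \<and>
       (\<forall>w<n. d w \<le> 3 * n + 3) \<and>
       k + (\<Sum>w<n. d w) = n * (3 * n + 3) \<and>
       (\<forall>w<n. H (int w) = -1 \<longrightarrow> d w = 0)) \<and>
     (\<forall>m<n. \<forall>j<n. S (int m) = int j \<longrightarrow> (\<forall>w<n. Q m w \<le> Q m j + e))"

text \<open>With \<open>Q\<close> read as values minus prices, this is complementary slackness up to
  \<open>\<delta>\<close> for the perfect matching \<open>\<sigma>\<close>.\<close>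

definition near_optimal :: "nat \<Rightarrow> int \<Rightarrow> (nat \<Rightarrow> nat \<Rightarrow> int) \<Rightarrow> (nat \<Rightarrow> nat) \<Rightarrow> bool" where
  "near_optimal n \<delta> Q \<sigma> \<longleftrightarrow>
     bij_betw \<sigma> {..<n} {..<n} \<and> (\<forall>m<n. \<forall>w<n. Q m w \<le> Q m (\<sigma> m) + \<delta>)"

text \<open>
  Adding the near optimality of \<open>\<sigma>\<close> for \<open>Q0\<close> and of \<open>S\<close> for \<open>Q\<close> over the assigned men, the price
  rises cancel up to those of the columns \<open>\<sigma> i\<close> of the free men \<open>i\<close>, so the latter are bounded. Hence
  a free man never bids on a column whose price has already risen a lot.
\<close>

lemma auction_free_bound:
  fixes d :: "nat \<Rightarrow> nat"
  assumes mut: "mutual n S H" and opt: "near_optimal n (2 * e) Q0 \<sigma>" and e: "0 < e"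
    and Q: "\<forall>m<n. \<forall>w<n. Q m w = Q0 m w - e * int (d w)"
    and d0: "\<forall>w<n. H (int w) = -1 \<longrightarrow> d w = 0"
    and S: "\<forall>m<n. \<forall>j<n. S (int m) = int j \<longrightarrow> (\<forall>w<n. Q m w \<le> Q m j + e)"
    and i: "i < n" "S (int i) = -1"
  shows "d (\<sigma> i) \<le> 3 * n"
proof -
  let ?A = "{m \<in> {..<n}. S (int m) \<noteq> -1}"
  define f where "f m = nat (S (int m))" for m
  have \<sigma>: "bij_betw \<sigma> {..<n} {..<n}" "\<And>m w. m < n \<Longrightarrow> w < n \<Longrightarrow> Q0 m w \<le> Q0 m (\<sigma> m) + 2 * e"
    using opt by (auto simp: near_optimal_def)
  have \<sigma>n: "\<sigma> m < n" if "m < n" for m using \<sigma>(1) that by (auto simp: bij_betw_def)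
  have f: "f m < n" "S (int m) = int (f m)" "H (int (f m)) = int m" if "m \<in> ?A" for m
    using mutualD(1)[OF mut, of m] that by (auto simp: f_def)
  \<comment> \<open>Origin of the 3: the current assignment tolerates an error \<open>e\<close> and
    the old matching \<open>\<sigma>\<close> an error \<open>2 * e\<close>. Their inequalities add
    up to one in which the values cancel.\<close>
  have le: "d (f m) \<le> d (\<sigma> m) + 3" if m: "m \<in> ?A" for m
  proof -
    have "m < n" using m by simp
    have "Q m (\<sigma> m) \<le> Q m (f m) + e" using S f[OF m] \<sigma>n \<open>m < n\<close> by blast
    moreover have "Q0 m (f m) \<le> Q0 m (\<sigma> m) + 2 * e" using \<sigma>(2) f(1)[OF m] \<open>m < n\<close> by blast
    ultimately have "e * int (d (f m)) \<le> e * (int (d (\<sigma> m)) + 3)"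
      using Q \<sigma>n f(1)[OF m] \<open>m < n\<close> by (simp add: algebra_simps)
    then show ?thesis using e by simp
  qed
  have inj: "inj_on f ?A" by (rule inj_onI) (metis f(3) of_nat_eq_iff)
  \<comment> \<open>A woman held by nobody has received no bid in this phase, so only the columns of
    assigned men contribute.\<close>
  have "(\<Sum>w<n. d w) = (\<Sum>w\<in>f ` ?A. d w)"
  proof (rule sum.mono_neutral_right)
    show "\<forall>w\<in>{..<n} - f ` ?A. d w = 0"
    proof
      fix w assume w: "w \<in> {..<n} - f ` ?A"
      have "H (int w) = -1"
      proof (rule ccontr)
        assume "H (int w) \<noteq> -1"
        then obtain m where "m < n" "H (int w) = int m" "S (int m) = int w"
          using mutualD(2)[OF mut, of w] w by auto
        then have "m \<in> ?A" "f m = w" by (auto simp: f_def)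
        then show False using w by blast
      qed
      then show "d w = 0" using d0 w by simp
    qed
  next
    show "f ` ?A \<subseteq> {..<n}" using f(1) by blast
  qed simp
  also have "\<dots> = (\<Sum>m\<in>?A. d (f m))" using inj by (simp add: sum.reindex)
  also have "\<dots> \<le> (\<Sum>m\<in>?A. d (\<sigma> m) + 3)" by (rule sum_mono) (use le in blast)
  also have "\<dots> \<le> (\<Sum>m\<in>?A. d (\<sigma> m)) + 3 * n"
  proof -
    have "card ?A \<le> n" using card_mono[of "{..<n}" ?A] by auto
    then show ?thesis by (simp only: sum.distrib sum_constant) simp
  qed
  finally have "(\<Sum>w<n. d w) \<le> (\<Sum>m\<in>?A. d (\<sigma> m)) + 3 * n" .
  moreover have "(\<Sum>w<n. d w) = (\<Sum>m<n. d (\<sigma> m))"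
    by (rule sum.reindex_bij_betw[OF \<sigma>(1), symmetric])
  \<comment> \<open>Summed along \<open>\<sigma>\<close>, the total rise contains the terms of all
    assigned men and that of \<open>i\<close>. The former cancel against the upper bound, which
    leaves at most \<open>3 * n\<close> for the latter.\<close>
  moreover have "d (\<sigma> i) + (\<Sum>m\<in>?A. d (\<sigma> m)) \<le> (\<Sum>m<n. d (\<sigma> m))"
  proof -
    have "d (\<sigma> i) + (\<Sum>m\<in>?A. d (\<sigma> m)) = (\<Sum>m\<in>insert i ?A. d (\<sigma> m))" using i by simp
    also have "\<dots> \<le> (\<Sum>m<n. d (\<sigma> m))" by (rule sum_mono2) (use i in auto)
    finally show ?thesis .
  qed
  ultimately show ?thesis by simp
qed

text \<open>A best response \<open>j\<close> of a free man \<open>i\<close> satisfies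
  \<open>d j \<le> d (\<sigma> i) + 2\<close>, by comparison with his old partner, whose rise is at
  most \<open>3 * n\<close>. The bid itself adds one, whence the cap \<open>3 * n + 3\<close>. The
  slack \<open>e\<close> of the invariant absorbs the lowering of the column that \<open>i\<close>
  has just won.\<close>

lemma auction_step:
  assumes inv: "auction_inv n e Q0 k Q S H" and opt: "near_optimal n (2 * e) Q0 \<sigma>" and e: "0 < e"
    and ij: "i < n" "S (int i) = -1" "j < n" "\<forall>w<n. Q i w \<le> Q i j"
    and Q': "\<forall>m<n. \<forall>w<n. Q' m w = (if w = j then Q m j - e else Q m w)"
  shows "\<exists>k'<k. auction_inv n e Q0 k' Q' (S(H (int j) := -1, int i := int j)) (H(int j := int i))"
proof -
  let ?S = "S(H (int j) := -1, int i := int j)" and ?H = "H(int j := int i)"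
  obtain d where mut: "mutual n S H"
    and Q: "\<forall>m<n. \<forall>w<n. Q m w = Q0 m w - e * int (d w)"
    and d: "\<forall>w<n. d w \<le> 3 * n + 3" "k + (\<Sum>w<n. d w) = n * (3 * n + 3)"
      "\<forall>w<n. H (int w) = -1 \<longrightarrow> d w = 0"
    and S: "\<forall>m<n. \<forall>j<n. S (int m) = int j \<longrightarrow> (\<forall>w<n. Q m w \<le> Q m j + e)"
    using inv unfolding auction_inv_def by blast
  have \<sigma>n: "\<sigma> i < n" using opt ij(1) by (auto simp: near_optimal_def bij_betw_def)
  have "Q i (\<sigma> i) \<le> Q i j" "Q0 i j \<le> Q0 i (\<sigma> i) + 2 * e"
    using ij \<sigma>n opt by (auto simp: near_optimal_def)
  then have "e * int (d j) \<le> e * (int (d (\<sigma> i)) + 2)"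
    using Q \<sigma>n ij by (simp add: algebra_simps)
  then have "d j \<le> d (\<sigma> i) + 2" using e by simp
  then have dj: "Suc (d j) \<le> 3 * n + 3"
    using auction_free_bound[OF mut opt e Q d(3) S ij(1,2)] by simp
  define d' where "d' = d(j := Suc (d j))"
  have sum: "(\<Sum>w<n. d' w) = Suc (\<Sum>w<n. d w)"
    using ij(3) by (simp add: d'_def sum.remove[of "{..<n}" j])
  have d'b: "\<forall>w<n. d' w \<le> 3 * n + 3" using d(1) dj by (simp add: d'_def)
  have "(\<Sum>w<n. d' w) \<le> (\<Sum>w<n. 3 * n + 3)" by (rule sum_mono) (use d'b in auto)
  then have k: "k - 1 + (\<Sum>w<n. d' w) = n * (3 * n + 3)" "k - 1 < k" using sum d(2) by auto
  have le: "Q' m w \<le> Q m w" if "m < n" "w < n" for m w using Q' that e by auto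
  have "auction_inv n e Q0 (k - 1) Q' ?S ?H"
    unfolding auction_inv_def
  proof (intro conjI exI[of _ d'] allI impI)
    show "mutual n ?S ?H" by (rule mutual_step[OF mut ij(1,3,2)])
  next
    fix m b w assume m: "m < n" "b < n" "?S (int m) = int b" "w < n"
    show "Q' m w \<le> Q' m b + e"
    proof (cases "m = i")
      case True
      then show ?thesis using m le[of i w] ij Q' by force
    next
      case False
      then have Sm: "S (int m) = int b" "H (int j) \<noteq> int m" using m(3) by (auto split: if_splits)
      \<comment> \<open>The only man who could hold \<open>j\<close> has been displaced; all others
        sit in columns whose price is unchanged.\<close>
      then have "b \<noteq> j" using mutualD(1)[OF mut m(1)] by auto
      then show ?thesis using S m(1,2,4) Sm le[OF m(1,4)] Q' by force
    qed
  next
    fix m w assume "m < n" "w < n"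
    then show "Q' m w = Q0 m w - e * int (d' w)" using Q Q' by (simp add: d'_def algebra_simps)
  next
    fix w assume "w < n" "?H (int w) = -1"
    then show "d' w = 0" using d(3) by (auto simp: d'_def split: if_splits)
  qed (use d'b k in auto)
  then show ?thesis using k by blast
qed

lemma auction_init:
  assumes "\<forall>i<n. S (int i) = -1" "\<forall>i<n. H (int i) = -1"
  shows "auction_inv n e Q (n * (3 * n + 3)) Q S H"
  unfolding auction_inv_def
  by (intro conjI exI[of _ "\<lambda>_. 0"]) (use assms in \<open>auto simp: mutual_def\<close>)

lemma auction_final:
  assumes inv: "auction_inv n e Q0 k Q S H" and full: "\<forall>i<n. S (int i) \<noteq> -1"
  shows "near_optimal n e Q (\<lambda>i. nat (S (int i)))"
proof -
  have mut: "mutual n S H" using inv by (simp add: auction_inv_def)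
  have S: "S (int m) = int (nat (S (int m)))" "nat (S (int m)) < n" if "m < n" for m
    using mutualD(1)[OF mut that] full that by auto
  have "\<forall>m<n. \<forall>j<n. S (int m) = int j \<longrightarrow> (\<forall>w<n. Q m w \<le> Q m j + e)"
    using inv by (simp add: auction_inv_def)
  then have "Q m w \<le> Q m (nat (S (int m))) + e" if "m < n" "w < n" for m w
    using S[OF that(1)] that by blast
  then show ?thesis using mutual_full(1)[OF mut full] by (simp add: near_optimal_def)
qed

section \<open>Rounding the prices\<close>

text \<open>
  With weights \<open>(n + 1) * c\<close> the prices leave one residue class modulo \<open>n + 1\<close> unused.
  Rounding there keeps \<open>p w + 1\<close> and \<open>p w\<close> together, which turns near optimality with error
  \<open>1\<close> into exact dual feasibility for \<open>c\<close>.
\<close>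

lemma unused_residue:
  fixes p :: "nat \<Rightarrow> int"
  obtains r where "\<And>w. w < n \<Longrightarrow> (p w + 1 - r) mod (int n + 1) \<noteq> 0"
proof -
  have "card ((\<lambda>w. (p w + 1) mod (int n + 1)) ` {..<n}) \<le> card {..<n}" by (rule card_image_le) simp
  also have "\<dots> < card {0..int n}" by simp
  finally have "\<not> {0..int n} \<subseteq> (\<lambda>w. (p w + 1) mod (int n + 1)) ` {..<n}"
    by (meson card_mono finite_imageI finite_lessThan not_less)
  then obtain r where "r \<in> {0..int n}" "r \<notin> (\<lambda>w. (p w + 1) mod (int n + 1)) ` {..<n}"
    by blast
  then have r: "0 \<le> r" "r \<le> int n" "\<And>w. w < n \<Longrightarrow> r \<noteq> (p w + 1) mod (int n + 1)" by auto
  have "(p w + 1 - r) mod (int n + 1) \<noteq> 0" if "w < n" for w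
  proof
    assume "(p w + 1 - r) mod (int n + 1) = 0"
    then have "(p w + 1) mod (int n + 1) = r mod (int n + 1)"
      by (simp add: mod_eq_dvd_iff dvd_eq_mod_eq_0)
    then show False using r(1,2) r(3)[OF that] by simp
  qed
  then show ?thesis by (rule that)
qed

lemma div_add_one:
  fixes x N :: int
  assumes "0 < N" "(x + 1) mod N \<noteq> 0"
  shows "(x + 1) div N = x div N"
proof -
  have "0 \<le> x mod N" "x mod N + 1 \<noteq> N" "x mod N < N"
    using assms mod_add_left_eq[of x N 1] by auto
  then have "(x mod N + 1) div N = 0" by (intro div_pos_pos_trivial) auto
  moreover have "x + 1 = x mod N + 1 + N * (x div N)" by simp
  ultimately show ?thesis
    using assms(1) div_mult_self2[of N "x mod N + 1" "x div N"] by simp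
qed

text \<open>The rounded prices \<open>y\<close> are the certificate: under them each partner in
  \<open>\<sigma>\<close> is a best choice with no error left, which is complementary slackness for
  the unscaled weights \<open>c\<close>.\<close>

lemma exact_dual:
  fixes c :: "nat \<Rightarrow> nat \<Rightarrow> int"
  assumes opt: "near_optimal n 1 Q \<sigma>"
    and Q: "\<forall>m<n. \<forall>w<n. Q m w = (int n + 1) * c m w - p w"
  obtains y :: "nat \<Rightarrow> int" where "\<And>m w. m < n \<Longrightarrow> w < n \<Longrightarrow> c m w - y w \<le> c m (\<sigma> m) - y (\<sigma> m)"
proof -
  let ?N = "int n + 1"
  obtain r where r: "\<And>w. w < n \<Longrightarrow> (p w + 1 - r) mod ?N \<noteq> 0" using unused_residue[of n p] by blast
  define y where "y w = (p w - r) div ?N" for w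
  have "c m w - y w \<le> c m (\<sigma> m) - y (\<sigma> m)" if mw: "m < n" "w < n" for m w
  proof -
    have s: "\<sigma> m < n" using opt mw by (auto simp: near_optimal_def bij_betw_def)
    have "Q m w \<le> Q m (\<sigma> m) + 1" using opt mw by (simp add: near_optimal_def)
    then have "p (\<sigma> m) - r + ?N * (c m w - c m (\<sigma> m)) \<le> p w - r + 1"
      using Q mw s by (simp add: algebra_simps)
    \<comment> \<open>Division carries the multiple of \<open>?N\<close> out on the left, and on the
      right the error 1 disappears because \<open>p w + 1 - r\<close> is not divisible by
      \<open>?N\<close>.\<close>
    then have "(p (\<sigma> m) - r + ?N * (c m w - c m (\<sigma> m))) div ?N \<le> (p w - r + 1) div ?N"
      by (rule zdiv_mono1) simp
    also have "(p w - r + 1) div ?N = y w"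
      unfolding y_def using r[OF mw(2)] by (intro div_add_one) (auto simp: algebra_simps)
    finally show ?thesis by (simp add: y_def)
  qed
  then show ?thesis by (rule that)
qed

section \<open>The bidding loop\<close>

abbreviation SizeN :: aexp where
  "SizeN \<equiv> Read ''input'' (Num 0)"

abbreviation Entry :: "aexp \<Rightarrow> aexp \<Rightarrow> aexp" where
  "Entry a b \<equiv> Add (Mul a SizeN) b"

definition entry :: "nat \<Rightarrow> (int \<Rightarrow> int) \<Rightarrow> nat \<Rightarrow> nat \<Rightarrow> int" where
  "entry n f m w = f (int m * int n + int w)"

lemma index_inj:
  assumes "w < n" "w' < n"
  shows "int m * int n + int w = int m' * int n + int w' \<longleftrightarrow> m = m' \<and> w = w'"
proof
  assume "int m * int n + int w = int m' * int n + int w'"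
  then have "int (m * n + w) = int (m' * n + w')" by simp
  then have "m * n + w = m' * n + w'" by (simp only: of_nat_eq_iff)
  then have "(m * n + w) div n = (m' * n + w') div n" "(m * n + w) mod n = (m' * n + w') mod n" by simp_all
  then show "m = m' \<and> w = w'" using assms by simp
qed auto

lemma entry_upd:
  assumes "w < n" "w' < n"
  shows "entry n (f(int m * int n + int w := v)) m' w' = (if m' = m \<and> w' = w then v else entry n f m' w')"
  using index_inj[OF assms, of m m'] by (auto simp: entry_def)

definition best_response :: com where
  "best_response = Seq (Write ''j'' (Num 0) (Num 0))
     (For ''k'' SizeN
       (Cond (Less (Read ''Q'' (Entry (Var ''i'') (Var ''j''))) (Read ''Q'' (Entry (Var ''i'') (Var ''k''))))
         (Write ''j'' (Num 0) (Var ''k'')) Skip))"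

lemma mods_best_response [simp]: "mods best_response = {''j'', ''k''}"
  by (auto simp: best_response_def)

text \<open>\<open>i < n\<close> makes \<open>n\<close> positive, so that column 0 is a legitimate
  first candidate.\<close>

lemma wp_best_response:
  assumes "bounded_by B s" "int n \<le> B" "s ''input'' 0 = int n" "s ''i'' 0 = int i" "i < n"
  shows "wp B best_response (4 * n + 3)
    (\<lambda>s'. \<exists>j<n. s' ''j'' 0 = int j \<and> (\<forall>w<n. entry n (s ''Q'') i w \<le> entry n (s ''Q'') i j)) s"
proof -
  let ?Q = "entry n (s ''Q'') i"
  have "wp B best_response (Suc (n * (2 + 2) + 2))
    (\<lambda>s'. \<exists>j<n. s' ''j'' 0 = int j \<and> (\<forall>w<n. ?Q w \<le> ?Q j)) s"
    unfolding best_response_def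
  proof (rule wp_Seq_Write[OF assms(1)])
    let ?s = "s(''j'' := (s ''j'')(aval (Num 0) s := aval (Num 0) s))"
    assume bd: "bounded_by B ?s"
    show "wp B (For ''k'' SizeN
       (Cond (Less (Read ''Q'' (Entry (Var ''i'') (Var ''j''))) (Read ''Q'' (Entry (Var ''i'') (Var ''k''))))
         (Write ''j'' (Num 0) (Var ''k'')) Skip)) (n * (2 + 2) + 2)
       (\<lambda>s'. \<exists>j<n. s' ''j'' 0 = int j \<and> (\<forall>w<n. ?Q w \<le> ?Q j)) ?s"
    proof (rule wp_For[where Inv = "\<lambda>t s'. \<exists>j<n. s' ''j'' 0 = int j \<and> (\<forall>w<t. ?Q w \<le> ?Q j)"])
      fix t s'
      assume t: "t < n" and inv: "\<exists>j<n. s' ''j'' 0 = int j \<and> (\<forall>w<t. ?Q w \<le> ?Q j)"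
        and bd': "bounded_by B s'" and k: "s' ''k'' 0 = int t"
        and fr: "\<And>y. y \<notin> insert ''k'' (mods (Cond
          (Less (Read ''Q'' (Entry (Var ''i'') (Var ''j''))) (Read ''Q'' (Entry (Var ''i'') (Var ''k''))))
          (Write ''j'' (Num 0) (Var ''k'')) Skip)) \<Longrightarrow> s' y = ?s y"
      have eq: "s' ''Q'' = s ''Q''" "s' ''i'' 0 = int i" "s' ''input'' 0 = int n"
        using fr assms by auto
      obtain j where j: "j < n" "s' ''j'' 0 = int j" "\<forall>w<t. ?Q w \<le> ?Q j" using inv by blast
      show "wp B (Cond
          (Less (Read ''Q'' (Entry (Var ''i'') (Var ''j''))) (Read ''Q'' (Entry (Var ''i'') (Var ''k''))))
          (Write ''j'' (Num 0) (Var ''k'')) Skip) 2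
          (\<lambda>s'. \<exists>j<n. s' ''j'' 0 = int j \<and> (\<forall>w<Suc t. ?Q w \<le> ?Q j)) s'"
        unfolding numeral_2_eq_2
      proof (rule wp_Cond[OF bd'])
        assume "bval (Less (Read ''Q'' (Entry (Var ''i'') (Var ''j''))) (Read ''Q'' (Entry (Var ''i'') (Var ''k'')))) s'"
        then have "?Q j < ?Q t" using eq j k by (simp add: entry_def)
        then have "\<forall>w<Suc t. ?Q w \<le> ?Q t" using j(3) by (force simp: less_Suc_eq)
        then have "\<exists>j<n. int t = int j \<and> (\<forall>w<Suc t. ?Q w \<le> ?Q j)" using t by blast
        then show "wp B (Write ''j'' (Num 0) (Var ''k'')) (Suc 0)
            (\<lambda>s'. \<exists>j<n. s' ''j'' 0 = int j \<and> (\<forall>w<Suc t. ?Q w \<le> ?Q j)) s'"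
          unfolding One_nat_def[symmetric]
          by (intro wp_Write[OF bd']) (use t k assms(2) in simp_all)
      next
        assume "\<not> bval (Less (Read ''Q'' (Entry (Var ''i'') (Var ''j''))) (Read ''Q'' (Entry (Var ''i'') (Var ''k'')))) s'"
        then have "?Q t \<le> ?Q j" using eq j k by (simp add: entry_def)
        then show "wp B Skip (Suc 0) (\<lambda>s'. \<exists>j<n. s' ''j'' 0 = int j \<and> (\<forall>w<Suc t. ?Q w \<le> ?Q j)) s'"
          unfolding One_nat_def[symmetric]
          by (intro wp_Skip[OF bd']) (use j in \<open>auto simp: less_Suc_eq\<close>)
      qed
    qed (use assms bd in auto)
  qed (use assms in auto)
  then show ?thesis by (rule wp_conseq) auto
qed

text \<open>If woman \<open>j\<close> is free then \<open>H[j] = -1\<close>, and the first assignment writes to the unused cell \<open>S[-1]\<close>.\<close>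

definition bid :: "com \<Rightarrow> com" where
  "bid upd = Seq best_response
     (Seq (Write ''S'' (Read ''H'' (Var ''j'')) (Num (-1)))
     (Seq (Write ''S'' (Var ''i'') (Var ''j''))
     (Seq (Write ''H'' (Var ''j'') (Var ''i''))
     (For ''m'' SizeN upd))))"

lemma mods_bid [simp]: "mods (bid upd) = {''j'', ''k'', ''S'', ''H'', ''m''} \<union> mods upd"
  by (auto simp: bid_def)

text \<open>\<open>u i j m q\<close> is the new content of a cell of column \<open>j\<close> that
  contains \<open>q\<close>. Its bound is demanded only when \<open>j\<close> is a best response,
  because the caller derives it from the invariant after the bid, and only such bids preserve the
  invariant.\<close>

lemma wp_bid:
  assumes s: "bounded_by B s" "s ''input'' 0 = int n" "s ''i'' 0 = int i"
    and n: "int n \<le> B" "i < n"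
    and upd: "mods upd = {''Q''}"
      "\<And>s' j m. (\<And>x. x \<notin> {''j'', ''k'', ''S'', ''H'', ''m'', ''Q''} \<Longrightarrow> s' x = s x) \<Longrightarrow>
        bounded_by B s' \<Longrightarrow> j < n \<Longrightarrow> m < n \<Longrightarrow> s' ''j'' 0 = int j \<Longrightarrow> s' ''m'' 0 = int m \<Longrightarrow>
        \<bar>u i j m (entry n (s' ''Q'') m j)\<bar> \<le> B \<Longrightarrow>
        wp B upd T (\<lambda>s''. s'' ''Q'' =
          (s' ''Q'')(int m * int n + int j := u i j m (entry n (s' ''Q'') m j))) s'"
    and ub: "\<And>j m. j < n \<Longrightarrow> m < n \<Longrightarrow> (\<forall>w<n. entry n (s ''Q'') i w \<le> entry n (s ''Q'') i j) \<Longrightarrow>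
      \<bar>u i j m (entry n (s ''Q'') m j)\<bar> \<le> B"
  shows "wp B (bid upd) (4 * n + 3 + Suc (Suc (Suc (n * (T + 2) + 2))))
    (\<lambda>s'. \<exists>j<n. (\<forall>w<n. entry n (s ''Q'') i w \<le> entry n (s ''Q'') i j) \<and>
       s' ''S'' = (s ''S'')(s ''H'' (int j) := -1, int i := int j) \<and>
       s' ''H'' = (s ''H'')(int j := int i) \<and>
       (\<forall>m<n. \<forall>w<n. entry n (s' ''Q'') m w =
         (if w = j then u i j m (entry n (s ''Q'') m w) else entry n (s ''Q'') m w))) s"
    (is "wp B _ _ ?post s")
  unfolding bid_def
proof (rule wp_Seq_conseq[OF wp_best_response[OF s(1) n(1) s(2,3) n(2)]])
  fix s1
  assume "\<exists>j<n. s1 ''j'' 0 = int j \<and> (\<forall>w<n. entry n (s ''Q'') i w \<le> entry n (s ''Q'') i j)"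
    and bd: "bounded_by B s1" and fr: "\<And>x. x \<notin> mods best_response \<Longrightarrow> s1 x = s x"
  then obtain j where j: "j < n" "s1 ''j'' 0 = int j"
    "\<forall>w<n. entry n (s ''Q'') i w \<le> entry n (s ''Q'') i j" by blast
  have eq: "s1 ''Q'' = s ''Q''" "s1 ''i'' 0 = int i" "s1 ''input'' 0 = int n" "s1 ''S'' = s ''S''"
    "s1 ''H'' = s ''H''"
    using fr s by auto
  let ?Q = "entry n (s ''Q'')"
  let ?s = "s1(''S'' := (s ''S'')(s ''H'' (int j) := -1, int i := int j),
      ''H'' := (s ''H'')(int j := int i))"
  have loop: "wp B (For ''m'' SizeN upd) (n * (T + 2) + 2) ?post ?s" if bd2: "bounded_by B ?s"
  proof (rule wp_For[where Inv = "\<lambda>t s'. \<forall>m<n. \<forall>w<n. entry n (s' ''Q'') m w =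
        (if w = j \<and> m < t then u i j m (?Q m w) else ?Q m w)"])
    fix t s'
    assume t: "t < n" and inv: "\<forall>m<n. \<forall>w<n. entry n (s' ''Q'') m w =
        (if w = j \<and> m < t then u i j m (?Q m w) else ?Q m w)"
      and bd': "bounded_by B s'" and m: "s' ''m'' 0 = int t"
      and fr': "\<And>y. y \<notin> insert ''m'' (mods upd) \<Longrightarrow> s' y = ?s y"
    have cell: "entry n (s' ''Q'') t j = ?Q t j" using inv t j(1) by simp
    have "wp B upd T (\<lambda>s''. s'' ''Q'' =
          (s' ''Q'')(int t * int n + int j := u i j t (entry n (s' ''Q'') t j))) s'"
    proof (rule upd(2))
      fix x assume "x \<notin> {''j'', ''k'', ''S'', ''H'', ''m'', ''Q''}"
      then show "s' x = s x" using fr'[of x] fr[of x] upd(1) by auto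
    qed (use bd' j t m fr'[of "''j''"] upd(1) ub cell in auto)
    then show "wp B upd T (\<lambda>s'. \<forall>m<n. \<forall>w<n. entry n (s' ''Q'') m w =
        (if w = j \<and> m < Suc t then u i j m (?Q m w) else ?Q m w)) s'"
      by (rule wp_conseq) (use inv j(1) cell in \<open>auto simp: entry_upd less_Suc_eq\<close>)
  next
    fix s'
    assume inv: "\<forall>m<n. \<forall>w<n. entry n (s' ''Q'') m w =
        (if w = j \<and> m < n then u i j m (?Q m w) else ?Q m w)"
      and fr': "\<And>y. y \<notin> insert ''m'' (mods upd) \<Longrightarrow> s' y = ?s y"
    show "?post s'" using inv j fr'[of "''S''"] fr'[of "''H''"] upd(1) by auto
  next
    fix t s' assume "\<And>y. y \<notin> insert ''m'' (mods upd) \<Longrightarrow> s' y = ?s y"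
    from this[of "''input''"] show "aval SizeN s' = int n" using eq upd(1) by simp
  qed (use upd(1) bd2 n eq in auto)
  have B: "1 \<le> B" using n by linarith
  show "wp B (Seq (Write ''S'' (Read ''H'' (Var ''j'')) (Num (-1)))
     (Seq (Write ''S'' (Var ''i'') (Var ''j''))
     (Seq (Write ''H'' (Var ''j'') (Var ''i''))
     (For ''m'' SizeN upd)))) (Suc (Suc (Suc (n * (T + 2) + 2)))) ?post s1"
    by (intro wp_Seq_Write bd) (use j eq n B loop in \<open>simp_all add: fun_upd_twist\<close>)
qed

text \<open>The search restarts at man 0 after every bid, as the displaced man may have a smaller
  index. This costs a factor of about \<open>n\<close> but spares a list of the free men.\<close>

definition bidding :: "com \<Rightarrow> com" where
  "bidding upd = Seq (Write ''i'' (Num 0) (Num 0))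
     (Loop (Less (Var ''i'') SizeN)
       (Cond (Less (Read ''S'' (Var ''i'')) (Num 0))
         (Seq (bid upd) (Write ''i'' (Num 0) (Num 0)))
         (Write ''i'' (Num 0) (Add (Var ''i'') (Num 1)))))"

lemma mods_bidding [simp]: "mods (bidding upd) = {''i'', ''j'', ''k'', ''S'', ''H'', ''m''} \<union> mods upd"
  by (auto simp: bidding_def)

text \<open>The rule is abstract in the invariant \<open>J\<close>, whose first argument bounds the
  bids to come, so that it covers deferred acceptance as well as the auction.\<close>

lemma wp_bidding:
  fixes J :: "nat \<Rightarrow> (nat \<Rightarrow> nat \<Rightarrow> int) \<Rightarrow> (int \<Rightarrow> int) \<Rightarrow> (int \<Rightarrow> int) \<Rightarrow> bool"
  assumes s: "bounded_by B s" "s ''input'' 0 = int n" and n: "int n \<le> B"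
    and upd: "mods upd = {''Q''}"
      "\<And>s' i j m. (\<And>x. x \<notin> {''i'', ''j'', ''k'', ''S'', ''H'', ''m'', ''Q''} \<Longrightarrow> s' x = s x) \<Longrightarrow>
        bounded_by B s' \<Longrightarrow> i < n \<Longrightarrow> j < n \<Longrightarrow> m < n \<Longrightarrow>
        s' ''i'' 0 = int i \<Longrightarrow> s' ''j'' 0 = int j \<Longrightarrow> s' ''m'' 0 = int m \<Longrightarrow>
        \<bar>u i j m (entry n (s' ''Q'') m j)\<bar> \<le> B \<Longrightarrow>
        wp B upd T (\<lambda>s''. s'' ''Q'' =
          (s' ''Q'')(int m * int n + int j := u i j m (entry n (s' ''Q'') m j))) s'"
    and mut: "\<And>k Q S H. J k Q S H \<Longrightarrow> mutual n S H"
    and JB: "\<And>k Q S H m w. J k Q S H \<Longrightarrow> m < n \<Longrightarrow> w < n \<Longrightarrow> \<bar>Q m w\<bar> \<le> B"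
    and step: "\<And>k Q S H i j Q'. J k Q S H \<Longrightarrow> i < n \<Longrightarrow> S (int i) = -1 \<Longrightarrow> j < n \<Longrightarrow>
      \<forall>w<n. Q i w \<le> Q i j \<Longrightarrow>
      \<forall>m<n. \<forall>w<n. Q' m w = (if w = j then u i j m (Q m w) else Q m w) \<Longrightarrow>
      \<exists>k'<k. J k' Q' (S(H (int j) := -1, int i := int j)) (H(int j := int i))"
    and J: "J k0 (entry n (s ''Q'')) (s ''S'') (s ''H'')" "k0 \<le> K"
  shows "wp B (bidding upd) (Suc (Suc ((K * (n + 1) + n) * (4 * n + n * (T + 2) + 11))))
    (\<lambda>s'. (\<exists>k. J k (entry n (s' ''Q'')) (s' ''S'') (s' ''H'')) \<and>
      (\<forall>i<n. s' ''S'' (int i) \<noteq> -1)) s" (is "wp B _ _ ?post s")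
proof -
  \<comment> \<open>A lexicographic measure in one number: bids to come, then men still to be
    inspected. As \<open>n - i\<close> never exceeds \<open>n\<close>, one bid outweighs a complete
    restart of the search.\<close>
  define Inv where "Inv \<kappa> s' \<longleftrightarrow> (\<exists>k i. J k (entry n (s' ''Q'')) (s' ''S'') (s' ''H'') \<and>
    s' ''i'' 0 = int i \<and> i \<le> n \<and> (\<forall>a<i. s' ''S'' (int a) \<noteq> -1) \<and> \<kappa> = k * (n + 1) + (n - i))"
    for \<kappa> s'
  let ?Tb = "4 * n + 3 + Suc (Suc (Suc (n * (T + 2) + 2)))"
  let ?body = "Cond (Less (Read ''S'' (Var ''i'')) (Num 0))
         (Seq (bid upd) (Write ''i'' (Num 0) (Num 0)))
         (Write ''i'' (Num 0) (Add (Var ''i'') (Num 1)))"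
  have B: "0 \<le> B" using n by linarith
  have "wp B (bidding upd) (Suc (Suc ((k0 * (n + 1) + n) * Suc (Suc (?Tb + 1))))) ?post s"
    unfolding bidding_def
  proof (rule wp_Seq_Write[OF s(1)])
    let ?s = "s(''i'' := (s ''i'')(aval (Num 0) s := aval (Num 0) s))"
    assume bd: "bounded_by B ?s"
    show "wp B (Loop (Less (Var ''i'') SizeN) ?body)
       (Suc ((k0 * (n + 1) + n) * Suc (Suc (?Tb + 1)))) ?post ?s"
    proof (rule wp_Loop[where Inv = Inv])
      show "Inv (k0 * (n + 1) + n) ?s" using J(1) by (auto simp: Inv_def intro!: exI[of _ k0])
    next
      fix \<kappa> s'
      assume "Inv \<kappa> s'" and bd': "bounded_by B s'" and b: "bval (Less (Var ''i'') SizeN) s'"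
        and fr: "\<And>x. x \<notin> mods ?body \<Longrightarrow> s' x = ?s x"
      then obtain k i where J': "J k (entry n (s' ''Q'')) (s' ''S'') (s' ''H'')"
        and i: "s' ''i'' 0 = int i" "i \<le> n" "\<forall>a<i. s' ''S'' (int a) \<noteq> -1"
        and \<kappa>: "\<kappa> = k * (n + 1) + (n - i)" unfolding Inv_def by blast
      have inp: "s' ''input'' 0 = int n" using fr[of "''input''"] s(2) upd(1) by simp
      have i': "i < n" using b i(1) inp by simp
      show "wp B ?body (Suc (?Tb + 1)) (\<lambda>s''. \<exists>k'<\<kappa>. Inv k' s'') s'"
      proof (rule wp_Cond[OF bd'])
        assume "bval (Less (Read ''S'' (Var ''i'')) (Num 0)) s'"
        then have free: "s' ''S'' (int i) = -1"
          using mutualD(1)[OF mut[OF J'] i'] i(1) by auto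
        note step' = step[OF J' i' free]
        have "wp B (bid upd) ?Tb (\<lambda>s''. \<exists>j<n. (\<forall>w<n. entry n (s' ''Q'') i w \<le> entry n (s' ''Q'') i j) \<and>
           s'' ''S'' = (s' ''S'')(s' ''H'' (int j) := -1, int i := int j) \<and>
           s'' ''H'' = (s' ''H'')(int j := int i) \<and>
           (\<forall>m<n. \<forall>w<n. entry n (s'' ''Q'') m w =
             (if w = j then u i j m (entry n (s' ''Q'') m w) else entry n (s' ''Q'') m w))) s'"
        proof (rule wp_bid[OF bd' inp i(1) n i' upd(1)])
          fix s'' j m
          assume A: "\<And>x. x \<notin> {''j'', ''k'', ''S'', ''H'', ''m'', ''Q''} \<Longrightarrow> s'' x = s' x"
            "bounded_by B s''" "j < n" "m < n" "s'' ''j'' 0 = int j" "s'' ''m'' 0 = int m"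
            "\<bar>u i j m (entry n (s'' ''Q'') m j)\<bar> \<le> B"
          show "wp B upd T (\<lambda>sa. sa ''Q'' =
             (s'' ''Q'')(int m * int n + int j := u i j m (entry n (s'' ''Q'') m j))) s''"
          proof (rule upd(2)[OF _ A(2) i' A(3,4) _ A(5,6,7)])
            fix x assume "x \<notin> {''i'', ''j'', ''k'', ''S'', ''H'', ''m'', ''Q''}"
            then show "s'' x = s x" using A(1)[of x] fr[of x] upd(1) by auto
          qed (use A(1)[of "''i''"] i(1) in auto)
        next
          fix j m assume jm: "j < n" "m < n"
            "\<forall>w<n. entry n (s' ''Q'') i w \<le> entry n (s' ''Q'') i j"
          \<comment> \<open>The bound is due before the column has been rewritten. Hence
            \<open>step\<close> is applied to the matrix that the bid is going to produce, and
            \<open>JB\<close> bounds the entries of that matrix.\<close>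
          let ?Q' = "\<lambda>m w. if w = j then u i j m (entry n (s' ''Q'') m w) else entry n (s' ''Q'') m w"
          obtain k' where k': "J k' ?Q' ((s' ''S'')(s' ''H'' (int j) := -1, int i := int j))
              ((s' ''H'')(int j := int i))"
            using step'[OF jm(1,3), of ?Q'] by blast
          show "\<bar>u i j m (entry n (s' ''Q'') m j)\<bar> \<le> B" using JB[OF k' jm(2,1)] by simp
        qed
        then show "wp B (Seq (bid upd) (Write ''i'' (Num 0) (Num 0))) (?Tb + 1)
            (\<lambda>s''. \<exists>k'<\<kappa>. Inv k' s'') s'"
        proof (rule wp_Seq_conseq)
          fix s2
          assume "\<exists>j<n. (\<forall>w<n. entry n (s' ''Q'') i w \<le> entry n (s' ''Q'') i j) \<and>
           s2 ''S'' = (s' ''S'')(s' ''H'' (int j) := -1, int i := int j) \<and>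
           s2 ''H'' = (s' ''H'')(int j := int i) \<and>
           (\<forall>m<n. \<forall>w<n. entry n (s2 ''Q'') m w =
             (if w = j then u i j m (entry n (s' ''Q'') m w) else entry n (s' ''Q'') m w))"
            and bd2: "bounded_by B s2"
          then obtain k' where k': "k' < k" "J k' (entry n (s2 ''Q'')) (s2 ''S'') (s2 ''H'')"
            using step' by metis
          have "k' * (n + 1) + n < \<kappa>"
          proof -
            have "Suc k' * (n + 1) \<le> k * (n + 1)" using k'(1) by (intro mult_right_mono) auto
            then show ?thesis unfolding \<kappa> by simp
          qed
          then show "wp B (Write ''i'' (Num 0) (Num 0)) 1 (\<lambda>s''. \<exists>k'<\<kappa>. Inv k' s'') s2"
            by (intro wp_Write[OF bd2] exI[of _ "k' * (n + 1) + n"])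
              (use k' B in \<open>auto simp: Inv_def intro!: exI[of _ k']\<close>)
        qed
      next
        assume "\<not> bval (Less (Read ''S'' (Var ''i'')) (Num 0)) s'"
        then have "s' ''S'' (int i) \<noteq> -1" using i(1) by auto
        then have "Inv (\<kappa> - 1) (s'(''i'' := (s' ''i'')(0 := int i + 1)))"
          unfolding Inv_def
          by (intro exI[of _ k] exI[of _ "Suc i"]) (use J' i i' \<kappa> in \<open>auto simp: less_Suc_eq\<close>)
        moreover have "\<kappa> - 1 < \<kappa>" using \<kappa> i' by simp
        ultimately have "wp B (Write ''i'' (Num 0) (Add (Var ''i'') (Num 1))) 1
            (\<lambda>s''. \<exists>k'<\<kappa>. Inv k' s'') s'"
          by (intro wp_Write[OF bd'] exI[of _ "\<kappa> - 1"]) (use i i' n in auto)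
        then show "wp B (Write ''i'' (Num 0) (Add (Var ''i'') (Num 1))) (?Tb + 1)
            (\<lambda>s''. \<exists>k'<\<kappa>. Inv k' s'') s'" by (rule wp_conseq) auto
      qed
    next
      fix \<kappa> s'
      assume "Inv \<kappa> s'" and b: "\<not> bval (Less (Var ''i'') SizeN) s'"
        and fr: "\<And>x. x \<notin> mods ?body \<Longrightarrow> s' x = ?s x"
      then obtain k i where J': "J k (entry n (s' ''Q'')) (s' ''S'') (s' ''H'')"
        and i: "s' ''i'' 0 = int i" "i \<le> n" "\<forall>a<i. s' ''S'' (int a) \<noteq> -1"
        unfolding Inv_def by blast
      have "s' ''input'' 0 = int n" using fr[of "''input''"] s(2) upd(1) by simp
      then have "i = n" using b i(1,2) by simp
      then show "?post s'" using J' i(3) by blast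
    qed (use bd in simp)
  qed (use B in simp)
  then show ?thesis
  proof (rule wp_conseq)
    have "k0 * (n + 1) + n \<le> K * (n + 1) + n" using J(2) by (intro add_mono mult_mono) auto
    then show "Suc (Suc ((k0 * (n + 1) + n) * Suc (Suc (?Tb + 1)))) \<le>
      Suc (Suc ((K * (n + 1) + n) * (4 * n + n * (T + 2) + 11)))"
      by (simp only: Suc_le_mono) (intro mult_mono, auto)
  qed auto
qed

lemma entry_nat: "entry n f m w = f (int (m * n + w))"
  by (simp add: entry_def)

lemma index_less: "m < n \<Longrightarrow> w < n \<Longrightarrow> m * n + w < n * (n :: nat)"
proof -
  assume "m < n" "w < n"
  have "m * n + w < Suc m * n" using \<open>w < n\<close> by simp
  also have "Suc m * n \<le> n * n" using \<open>m < n\<close> by (intro mult_le_mono1) simp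
  finally show ?thesis .
qed

abbreviation Square :: aexp where
  "Square \<equiv> Mul SizeN SizeN"

section \<open>The stable matching\<close>

definition reset :: com where
  "reset = For ''i'' SizeN
     (Seq (Write ''S'' (Var ''i'') (Num (-1))) (Write ''H'' (Var ''i'') (Num (-1))))"

lemma mods_reset [simp]: "mods reset = {''i'', ''S'', ''H''}"
  by (auto simp: reset_def)

lemma wp_reset:
  assumes "bounded_by B s" "s ''input'' 0 = int n" "int n \<le> B" "1 \<le> B"
  shows "wp B reset (4 * n + 2)
    (\<lambda>s'. (\<forall>i<n. s' ''S'' (int i) = -1) \<and> (\<forall>i<n. s' ''H'' (int i) = -1)) s"
proof -
  have "wp B reset (n * (2 + 2) + 2)
    (\<lambda>s'. (\<forall>i<n. s' ''S'' (int i) = -1) \<and> (\<forall>i<n. s' ''H'' (int i) = -1)) s"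
    unfolding reset_def
  proof (rule wp_For[where Inv = "\<lambda>t s'. \<forall>i<t. s' ''S'' (int i) = -1 \<and> s' ''H'' (int i) = -1"])
    fix t s'
    assume "t < n" "\<forall>i<t. s' ''S'' (int i) = -1 \<and> s' ''H'' (int i) = -1" "bounded_by B s'"
      "s' ''i'' 0 = int t"
    then show "wp B (Seq (Write ''S'' (Var ''i'') (Num (-1))) (Write ''H'' (Var ''i'') (Num (-1)))) 2
       (\<lambda>s'. \<forall>i<Suc t. s' ''S'' (int i) = -1 \<and> s' ''H'' (int i) = -1) s'"
      unfolding numeral_2_eq_2 One_nat_def[symmetric]
      by (intro wp_Seq_Write wp_Write) (use assms(4) in \<open>auto simp: less_Suc_eq\<close>)
  qed (use assms in auto)
  then show ?thesis by (rule wp_conseq) auto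
qed

text \<open>In \<open>A\<close> the women's matrix follows the men's at offset \<open>n * n\<close>.
  The strict comparison sends ties, and with them the cell of \<open>i\<close> himself, to the
  branch that writes \<open>-1\<close>.\<close>

definition propose_upd :: com where
  "propose_upd = Cond
     (Less (Read ''A'' (Add Square (Entry (Var ''i'') (Var ''j''))))
           (Read ''A'' (Add Square (Entry (Var ''m'') (Var ''j'')))))
     Skip (Write ''Q'' (Entry (Var ''m'') (Var ''j'')) (Num (-1)))"

lemma mods_propose_upd [simp]: "mods propose_upd = {''Q''}"
  by (simp add: propose_upd_def)

abbreviation women_values :: "nat \<Rightarrow> (int \<Rightarrow> int) \<Rightarrow> nat \<Rightarrow> nat \<Rightarrow> int" where
  "women_values n f \<equiv> entry n (\<lambda>x. f (int n * int n + x))"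

lemma wp_propose_upd:
  assumes "bounded_by B s" "s ''input'' 0 = int n" "1 \<le> B"
    "s ''i'' 0 = int i" "s ''j'' 0 = int j" "s ''m'' 0 = int m"
  shows "wp B propose_upd 2 (\<lambda>s'. s' ''Q'' = (s ''Q'')(int m * int n + int j :=
     (if women_values n (s ''A'') i j < women_values n (s ''A'') m j
      then entry n (s ''Q'') m j else -1))) s"
  unfolding propose_upd_def numeral_2_eq_2
proof (rule wp_Cond)
  show "bounded_by B s" by fact
next
  assume "bval (Less (Read ''A'' (Add Square (Entry (Var ''i'') (Var ''j''))))
           (Read ''A'' (Add Square (Entry (Var ''m'') (Var ''j''))))) s"
  then show "wp B Skip (Suc 0) (\<lambda>s'. s' ''Q'' = (s ''Q'')(int m * int n + int j :=
     (if women_values n (s ''A'') i j < women_values n (s ''A'') m j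
      then entry n (s ''Q'') m j else -1))) s"
    unfolding One_nat_def[symmetric] using assms by (intro wp_Skip) (auto simp: entry_def)
next
  assume "\<not> bval (Less (Read ''A'' (Add Square (Entry (Var ''i'') (Var ''j''))))
           (Read ''A'' (Add Square (Entry (Var ''m'') (Var ''j''))))) s"
  then show "wp B (Write ''Q'' (Entry (Var ''m'') (Var ''j'')) (Num (-1))) (Suc 0)
    (\<lambda>s'. s' ''Q'' = (s ''Q'')(int m * int n + int j :=
     (if women_values n (s ''A'') i j < women_values n (s ''A'') m j
      then entry n (s ''Q'') m j else -1))) s"
    unfolding One_nat_def[symmetric] using assms by (intro wp_Write) (auto simp: entry_def)
qed

text \<open>The bidding strikes out entries of the copy \<open>Q\<close>; \<open>A\<close> stays
  intact for the comparisons of the women and, later, for the weights of the auction.\<close>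

definition deferred_acceptance :: com where
  "deferred_acceptance =
     Seq (For ''e'' Square (Write ''Q'' (Var ''e'') (Read ''A'' (Var ''e''))))
     (Seq reset (bidding propose_upd))"

lemma mods_deferred_acceptance [simp]:
  "mods deferred_acceptance = {''e'', ''Q'', ''i'', ''j'', ''k'', ''S'', ''H'', ''m''}"
  by (auto simp: deferred_acceptance_def)

text \<open>The partner of \<open>w\<close> appears as an \<open>h\<close> with
  \<open>\<sigma> h = w\<close>, which avoids the inverse of \<open>\<sigma>\<close>. The type is
  left open because stability is shown for scaled integers and then transferred to the rational
  values.\<close>

definition stable_for :: "nat \<Rightarrow> (nat \<Rightarrow> nat \<Rightarrow> 'a :: linorder) \<Rightarrow> (nat \<Rightarrow> nat \<Rightarrow> 'a) \<Rightarrow> (nat \<Rightarrow> nat) \<Rightarrow> bool" where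
  "stable_for n u v \<sigma> \<longleftrightarrow> bij_betw \<sigma> {..<n} {..<n} \<and>
     (\<forall>m<n. \<forall>w<n. u m w \<le> u m (\<sigma> m) \<or> (\<exists>h<n. \<sigma> h = w \<and> v m w \<le> v h w))"

text \<open>Kept in the shape in which the timing rules produce it; afterwards only its monotonicity
  and its being a polynomial enter.\<close>

definition time_da :: "nat \<Rightarrow> nat" where
  "time_da n = n * n * (1 + 2) + 2 + (4 * n + 2 +
     Suc (Suc ((n * n * (n + 1) + n) * (4 * n + n * (2 + 2) + 11))))"

lemma wp_deferred_acceptance:
  assumes s: "bounded_by B s" "s ''input'' 0 = int n" and B: "int (n * n) \<le> B" "1 \<le> B"
    and pos: "\<And>m w. m < n \<Longrightarrow> w < n \<Longrightarrow> 0 \<le> entry n (s ''A'') m w"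
  shows "wp B deferred_acceptance (time_da n)
    (\<lambda>s'. \<exists>\<sigma>. (\<forall>m<n. s' ''S'' (int m) = int (\<sigma> m)) \<and>
       stable_for n (entry n (s ''A'')) (women_values n (s ''A'')) \<sigma>) s" (is "wp B _ _ ?post s")
  unfolding deferred_acceptance_def time_da_def
proof (rule wp_Seq_conseq)
  have "n \<le> n * n" by simp
  then have nB: "int n \<le> B" using B(1) by linarith
  show "wp B (For ''e'' Square (Write ''Q'' (Var ''e'') (Read ''A'' (Var ''e''))))
     (n * n * (1 + 2) + 2) (\<lambda>s'. \<forall>e<n * n. s' ''Q'' (int e) = s ''A'' (int e)) s"
  proof (rule wp_For[where Inv = "\<lambda>t s'. \<forall>e<t. s' ''Q'' (int e) = s ''A'' (int e)"])
    fix t s'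
    assume "t < n * n" and inv: "\<forall>e<t. s' ''Q'' (int e) = s ''A'' (int e)"
      and bd: "bounded_by B s'" and e: "s' ''e'' 0 = int t"
      and fr: "\<And>y. y \<notin> insert ''e'' (mods (Write ''Q'' (Var ''e'') (Read ''A'' (Var ''e'')))) \<Longrightarrow> s' y = s y"
    have A: "s' ''A'' = s ''A''" using fr by simp
    show "wp B (Write ''Q'' (Var ''e'') (Read ''A'' (Var ''e''))) 1
        (\<lambda>s'. \<forall>e<Suc t. s' ''Q'' (int e) = s ''A'' (int e)) s'"
      by (rule wp_Write) (use bd inv e s(1) A in \<open>auto simp: less_Suc_eq bounded_by_def\<close>)
  qed (use s B in auto)
next
  fix s1
  assume Q: "\<forall>e<n * n. s1 ''Q'' (int e) = s ''A'' (int e)" and bd1: "bounded_by B s1"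
    and fr1: "\<And>x. x \<notin> mods (For ''e'' Square (Write ''Q'' (Var ''e'') (Read ''A'' (Var ''e'')))) \<Longrightarrow> s1 x = s x"
  have "n \<le> n * n" by simp
  then have nB: "int n \<le> B" using B(1) by linarith
  have inp1: "s1 ''input'' 0 = int n" using fr1 s(2) by simp
  show "wp B (Seq reset (bidding propose_upd)) (4 * n + 2 +
     Suc (Suc ((n * n * (n + 1) + n) * (4 * n + n * (2 + 2) + 11)))) ?post s1"
  proof (rule wp_Seq_conseq[OF wp_reset[OF bd1 inp1 nB B(2)]])
    fix s2
    assume SH: "(\<forall>i<n. s2 ''S'' (int i) = -1) \<and> (\<forall>i<n. s2 ''H'' (int i) = -1)"
      and bd2: "bounded_by B s2" and fr2: "\<And>x. x \<notin> mods reset \<Longrightarrow> s2 x = s1 x"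
    let ?u = "entry n (s ''A'')" and ?v = "women_values n (s ''A'')"
    have inp2: "s2 ''input'' 0 = int n" and A2: "s2 ''A'' = s ''A''" and Q2: "s2 ''Q'' = s1 ''Q''"
      using fr1 fr2 s(2) by simp_all
    have Qu: "\<forall>m<n. \<forall>w<n. entry n (s2 ''Q'') m w = ?u m w"
      using Q Q2 by (simp add: entry_nat index_less del: of_nat_add of_nat_mult)
    obtain k where k: "k \<le> n * n" "gs_inv n ?u ?v k (entry n (s2 ''Q'')) (s2 ''S'') (s2 ''H'')"
      using gs_init[of n "s2 ''S''" "s2 ''H''" "entry n (s2 ''Q'')" ?u ?v] SH Qu by blast
    let ?upd = "\<lambda>i j m q. if ?v i j < ?v m j then q else -1"
    have "wp B (bidding propose_upd) (Suc (Suc ((n * n * (n + 1) + n) * (4 * n + n * (2 + 2) + 11))))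
      (\<lambda>s'. (\<exists>k. gs_inv n ?u ?v k (entry n (s' ''Q'')) (s' ''S'') (s' ''H'')) \<and>
        (\<forall>i<n. s' ''S'' (int i) \<noteq> -1)) s2"
    proof (rule wp_bidding[OF bd2 inp2 nB mods_propose_upd, where u = ?upd])
      fix s' i j m
      assume fr: "\<And>x. x \<notin> {''i'', ''j'', ''k'', ''S'', ''H'', ''m'', ''Q''} \<Longrightarrow> s' x = s2 x"
        and "bounded_by B s'" "s' ''i'' 0 = int i" "s' ''j'' 0 = int j" "s' ''m'' 0 = int m"
      moreover have "s' ''A'' = s ''A''" "s' ''input'' 0 = int n" using fr A2 inp2 by simp_all
      ultimately show "wp B propose_upd 2 (\<lambda>s''. s'' ''Q'' = (s' ''Q'')(int m * int n + int j :=
          (if ?v i j < ?v m j then entry n (s' ''Q'') m j else -1))) s'"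
        using wp_propose_upd[of B s' n i j m] B(2) by simp
    next
      fix k Q S H m w
      assume "gs_inv n ?u ?v k Q S H" and mw: "m < n" "w < n"
      then have "Q m w = -1 \<or> Q m w = ?u m w" unfolding gs_inv_def by meson
      moreover have "\<bar>?u m w\<bar> \<le> B" using s(1) by (simp add: bounded_by_def entry_def)
      ultimately show "\<bar>Q m w\<bar> \<le> B" using B(2) by auto
    next
      fix k Q S H i j Q'
      assume a: "gs_inv n ?u ?v k Q S H" "i < n" "S (int i) = -1" "j < n" "\<forall>w<n. Q i w \<le> Q i j"
        "\<forall>m<n. \<forall>w<n. Q' m w = (if w = j then if ?v i j < ?v m j then Q m w else -1 else Q m w)"
      have "\<forall>m<n. \<forall>w<n. Q' m w = (if w = j then if ?v i j < ?v m j then Q m j else -1 else Q m w)"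
        using a(6) by simp
      then show "\<exists>k'<k. gs_inv n ?u ?v k' Q' (S(H (int j) := -1, int i := int j)) (H(int j := int i))"
        using gs_step[OF a(1) _ a(2-5)] pos by blast
    next
      show "gs_inv n ?u ?v k (entry n (s2 ''Q'')) (s2 ''S'') (s2 ''H'')" "k \<le> n * n" by (fact k)+
    qed (simp add: gs_inv_def)
    then show "wp B (bidding propose_upd)
        (Suc (Suc ((n * n * (n + 1) + n) * (4 * n + n * (2 + 2) + 11)))) ?post s2"
    proof (rule wp_conseq)
      fix s'
      assume "(\<exists>k. gs_inv n ?u ?v k (entry n (s' ''Q'')) (s' ''S'') (s' ''H'')) \<and>
        (\<forall>i<n. s' ''S'' (int i) \<noteq> -1)"
      then show "?post s'" unfolding stable_for_def using gs_final by blast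
    qed simp
  qed
qed

section \<open>The scaling phases of the auction\<close>

definition price_upd :: com where
  "price_upd = Write ''Q'' (Entry (Var ''m'') (Var ''j''))
     (Sub (Read ''Q'' (Entry (Var ''m'') (Var ''j''))) (Read ''p'' (Var ''l'')))"

lemma mods_price_upd [simp]: "mods price_upd = {''Q''}"
  by (simp add: price_upd_def)

definition time_phase :: "nat \<Rightarrow> nat" where
  "time_phase n = 4 * n + 2 +
     Suc (Suc ((n * (3 * n + 3) * (n + 1) + n) * (4 * n + n * (1 + 2) + 11)))"

text \<open>\<open>\<sigma>\<close> comes from the preceding phase and is a mere witness:
  \<open>reset\<close> erases the assignment itself. The bound on \<open>B\<close> leaves room for
  each column to fall by \<open>3 * n + 3\<close> increments.\<close>

lemma wp_phase:
  assumes s: "bounded_by B s" "s ''input'' 0 = int n" "s ''p'' (s ''l'' 0) = e"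
    and B: "int n \<le> B" "1 \<le> B" "\<And>m w. m < n \<Longrightarrow> w < n \<Longrightarrow> \<bar>entry n (s ''Q'') m w\<bar> + e * int (3 * n + 3) \<le> B"
    and e: "0 < e" and opt: "near_optimal n (2 * e) (entry n (s ''Q'')) \<sigma>"
  shows "wp B (Seq reset (bidding price_upd)) (time_phase n)
    (\<lambda>s'. (\<exists>d. \<forall>w<n. d w \<le> 3 * n + 3 \<and>
        (\<forall>m<n. entry n (s' ''Q'') m w = entry n (s ''Q'') m w - e * int (d w))) \<and>
      (\<exists>\<sigma>. near_optimal n e (entry n (s' ''Q'')) \<sigma> \<and> (\<forall>m<n. s' ''S'' (int m) = int (\<sigma> m)))) s"
    (is "wp B _ _ ?post s")
  unfolding time_phase_def
proof (rule wp_Seq_conseq[OF wp_reset[OF s(1,2) B(1,2)]])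
  fix s2
  assume SH: "(\<forall>i<n. s2 ''S'' (int i) = -1) \<and> (\<forall>i<n. s2 ''H'' (int i) = -1)"
    and bd2: "bounded_by B s2" and fr2: "\<And>x. x \<notin> mods reset \<Longrightarrow> s2 x = s x"
  have inp2: "s2 ''input'' 0 = int n" and Q2: "s2 ''Q'' = s ''Q''" and p2: "s2 ''p'' (s2 ''l'' 0) = e"
    using fr2 s by simp_all
  let ?Q0 = "entry n (s ''Q'')"
  have init: "auction_inv n e ?Q0 (n * (3 * n + 3)) (entry n (s2 ''Q'')) (s2 ''S'') (s2 ''H'')"
    unfolding Q2 by (rule auction_init) (use SH in auto)
  have "wp B (bidding price_upd)
    (Suc (Suc ((n * (3 * n + 3) * (n + 1) + n) * (4 * n + n * (1 + 2) + 11))))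
    (\<lambda>s'. (\<exists>k. auction_inv n e ?Q0 k (entry n (s' ''Q'')) (s' ''S'') (s' ''H'')) \<and>
      (\<forall>i<n. s' ''S'' (int i) \<noteq> -1)) s2"
  proof (rule wp_bidding[OF bd2 inp2 B(1) mods_price_upd, where u = "\<lambda>i j m q. q - e"])
    fix s' i j m
    assume fr: "\<And>x. x \<notin> {''i'', ''j'', ''k'', ''S'', ''H'', ''m'', ''Q''} \<Longrightarrow> s' x = s2 x"
      and a: "bounded_by B s'" "s' ''j'' 0 = int j" "s' ''m'' 0 = int m"
        "\<bar>entry n (s' ''Q'') m j - e\<bar> \<le> B"
    have "s' ''p'' = s2 ''p''" "s' ''l'' = s2 ''l''" "s' ''input'' 0 = int n" using fr inp2 by simp_all
    with a p2 show "wp B price_upd 1 (\<lambda>s''. s'' ''Q'' = (s' ''Q'')(int m * int n + int j :=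
          entry n (s' ''Q'') m j - e)) s'"
      unfolding price_upd_def by (intro wp_Write) (auto simp: entry_def)
  next
    fix k Q S H m w
    assume "auction_inv n e ?Q0 k Q S H" and mw: "m < n" "w < n"
    then obtain d where d: "d w \<le> 3 * n + 3" "Q m w = ?Q0 m w - e * int (d w)"
      unfolding auction_inv_def by blast
    have "e * int (d w) \<le> e * int (3 * n + 3)" using d(1) e by (intro mult_left_mono) auto
    moreover have "0 \<le> e * int (d w)" using e by simp
    ultimately show "\<bar>Q m w\<bar> \<le> B" using d(2) B(3)[OF mw] by linarith
  next
    fix k Q S H i j Q'
    assume a: "auction_inv n e ?Q0 k Q S H" "i < n" "S (int i) = -1" "j < n" "\<forall>w<n. Q i w \<le> Q i j"
      "\<forall>m<n. \<forall>w<n. Q' m w = (if w = j then Q m w - e else Q m w)"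
    have "\<forall>m<n. \<forall>w<n. Q' m w = (if w = j then Q m j - e else Q m w)" using a(6) by simp
    then show "\<exists>k'<k. auction_inv n e ?Q0 k' Q' (S(H (int j) := -1, int i := int j)) (H(int j := int i))"
      by (rule auction_step[OF a(1) opt e a(2-5)])
  next
    show "auction_inv n e ?Q0 (n * (3 * n + 3)) (entry n (s2 ''Q'')) (s2 ''S'') (s2 ''H'')"
      by (fact init)
  qed (simp_all add: auction_inv_def)
  then show "wp B (bidding price_upd)
    (Suc (Suc ((n * (3 * n + 3) * (n + 1) + n) * (4 * n + n * (1 + 2) + 11)))) ?post s2"
  proof (rule wp_conseq)
    fix s'
    assume "(\<exists>k. auction_inv n e ?Q0 k (entry n (s' ''Q'')) (s' ''S'') (s' ''H'')) \<and>
      (\<forall>i<n. s' ''S'' (int i) \<noteq> -1)"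
    then obtain k where k: "auction_inv n e ?Q0 k (entry n (s' ''Q'')) (s' ''S'') (s' ''H'')"
      and full: "\<forall>i<n. s' ''S'' (int i) \<noteq> -1" by blast
    have mut: "mutual n (s' ''S'') (s' ''H'')" using k by (simp add: auction_inv_def)
    have "s' ''S'' (int m) = int (nat (s' ''S'' (int m)))" if "m < n" for m
      using mutualD(1)[OF mut that] full that by auto
    then have "\<exists>\<sigma>. near_optimal n e (entry n (s' ''Q'')) \<sigma> \<and> (\<forall>m<n. s' ''S'' (int m) = int (\<sigma> m))"
      using auction_final[OF k full] by blast
    moreover obtain d :: "nat \<Rightarrow> nat" where
      "\<forall>m<n. \<forall>w<n. entry n (s' ''Q'') m w = ?Q0 m w - e * int (d w)" "\<forall>w<n. d w \<le> 3 * n + 3"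
      using k unfolding auction_inv_def by (elim conjE exE)
    then have "\<exists>d. \<forall>w<n. d w \<le> 3 * n + 3 \<and>
        (\<forall>m<n. entry n (s' ''Q'') m w = ?Q0 m w - e * int (d w))"
      by (intro exI[of _ d]) simp
    ultimately show "?post s'" by (rule conjI[rotated])
  qed simp
qed

definition phases :: com where
  "phases = Loop (Less (Num (-1)) (Var ''l''))
     (Seq (Seq reset (bidding price_upd)) (Write ''l'' (Num 0) (Sub (Var ''l'') (Num 1))))"

lemma mods_phases [simp]: "mods phases = {''Q'', ''i'', ''j'', ''k'', ''S'', ''H'', ''m'', ''l''}"
  by (auto simp: phases_def)

lemma wp_phases:
  assumes s: "bounded_by B s" "s ''input'' 0 = int n" "s ''l'' 0 = int L"
      "\<And>t. t \<le> L \<Longrightarrow> s ''p'' (int t) = 2 ^ t"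
    and c: "\<And>m w. m < n \<Longrightarrow> w < n \<Longrightarrow> 0 \<le> entry n (s ''Q'') m w \<and> entry n (s ''Q'') m w \<le> 2 ^ L"
    and B: "int (3 * n + 4) * 2 ^ Suc L \<le> B" "int L \<le> B"
  shows "wp B phases (Suc (Suc L * Suc (time_phase n + 1)))
    (\<lambda>s'. \<exists>\<sigma> Q q. (\<forall>m<n. s' ''S'' (int m) = int (\<sigma> m)) \<and> near_optimal n 1 Q \<sigma> \<and>
      (\<forall>m<n. \<forall>w<n. Q m w = entry n (s ''Q'') m w - q w)) s" (is "wp B _ _ ?post s")
proof -
  let ?c = "entry n (s ''Q'')"
  \<comment> \<open>Here \<open>k\<close> is one more than the exponent of the coming phase, so that
    \<open>2 ^ k\<close> is twice its increment, exactly the error that \<open>wp_phase\<close>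
    accepts. The bound on \<open>q\<close> telescopes the falls of the finished phases. Only from
    \<open>k \<le> L\<close> on has some phase written \<open>S\<close>.\<close>
  define Inv where "Inv k s' \<longleftrightarrow> k \<le> Suc L \<and> s' ''l'' 0 = int k - 1 \<and>
    (\<exists>\<sigma> q. near_optimal n (2 ^ k) (entry n (s' ''Q'')) \<sigma> \<and>
       (k \<le> L \<longrightarrow> (\<forall>m<n. s' ''S'' (int m) = int (\<sigma> m))) \<and>
       (\<forall>w<n. 0 \<le> q w \<and> q w \<le> int (3 * n + 3) * (2 ^ Suc L - 2 ^ k)) \<and>
       (\<forall>m<n. \<forall>w<n. entry n (s' ''Q'') m w = ?c m w - q w))" for k s'
  have "int (3 * n + 4) * 1 \<le> int (3 * n + 4) * 2 ^ Suc L"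
    by (intro mult_left_mono one_le_power) auto
  also have "\<dots> \<le> B" by (fact B(1))
  finally have nB: "int n \<le> B" "1 \<le> B" by simp_all
  show ?thesis
    unfolding phases_def
  proof (rule wp_Loop[where Inv = Inv])
    show "bounded_by B s" by fact
    \<comment> \<open>All weights lie between 0 and \<open>2 ^ L\<close>, so any bijection starts
      the first phase.\<close>
    have "near_optimal n (2 ^ Suc L) ?c id"
      unfolding near_optimal_def
    proof (intro conjI allI impI)
      fix m w assume "m < n" "w < n"
      then have "?c m w \<le> 2 ^ L" "0 \<le> ?c m m" using c by auto
      moreover have "(2::int) ^ L \<le> 2 ^ Suc L" by simp
      ultimately show "?c m w \<le> ?c m (id m) + 2 ^ Suc L" unfolding id_apply by linarith
    qed simp
    then show "Inv (Suc L) s" unfolding Inv_def using s(3)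
      by (intro conjI exI[of _ id] exI[of _ "\<lambda>_. 0"]) auto
  next
    fix k s'
    assume "Inv k s'" and bd: "bounded_by B s'" and b: "bval (Less (Num (-1)) (Var ''l'')) s'"
      and fr: "\<And>x. x \<notin> mods (Seq (Seq reset (bidding price_upd)) (Write ''l'' (Num 0) (Sub (Var ''l'') (Num 1)))) \<Longrightarrow> s' x = s x"
    then obtain \<sigma> q where k: "k \<le> Suc L" "s' ''l'' 0 = int k - 1"
      and opt: "near_optimal n (2 ^ k) (entry n (s' ''Q'')) \<sigma>"
      and q: "\<And>w. w < n \<Longrightarrow> 0 \<le> q w \<and> q w \<le> int (3 * n + 3) * (2 ^ Suc L - 2 ^ k)"
      and Q: "\<And>m w. m < n \<Longrightarrow> w < n \<Longrightarrow> entry n (s' ''Q'') m w = ?c m w - q w"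
      unfolding Inv_def by blast
    obtain l where l: "k = Suc l" using b k by (cases k) auto
    let ?e = "(2::int) ^ l"
    have p: "s' ''p'' (s' ''l'' 0) = ?e" using fr s(4)[of l] k l by simp
    have inp: "s' ''input'' 0 = int n" using fr s(2) by simp
    show "wp B (Seq (Seq reset (bidding price_upd)) (Write ''l'' (Num 0) (Sub (Var ''l'') (Num 1))))
        (time_phase n + 1) (\<lambda>s''. \<exists>k'<k. Inv k' s'') s'"
    proof (rule wp_Seq_conseq[OF wp_phase[OF bd inp p nB]])
      show "near_optimal n (2 * ?e) (entry n (s' ''Q'')) \<sigma>" using opt l by simp
      fix m w assume mw: "m < n" "w < n"
      \<comment> \<open>Weights account for at most \<open>2 ^ L\<close>, and past falls together
        with those of this phase for at most \<open>(3 * n + 3) * 2 ^ Suc L\<close>; this is where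
        \<open>3 * n + 4\<close> comes from.\<close>
      have "\<bar>entry n (s' ''Q'') m w\<bar> \<le> 2 ^ L + q w" using Q[OF mw] q[OF mw(2)] c[OF mw] by auto
      also have "\<dots> \<le> 2 ^ L + int (3 * n + 3) * (2 ^ Suc L - 2 ^ k)" using q[OF mw(2)] by simp
      finally have "\<bar>entry n (s' ''Q'') m w\<bar> + ?e * int (3 * n + 3)
          \<le> 2 ^ L + int (3 * n + 3) * (2 ^ Suc L - ?e)" by (simp add: l algebra_simps)
      also have "\<dots> \<le> 2 ^ Suc L + int (3 * n + 3) * 2 ^ Suc L"
        by (intro add_mono mult_left_mono) auto
      also have "\<dots> \<le> B" using B(1) by (simp add: algebra_simps)
      finally show "\<bar>entry n (s' ''Q'') m w\<bar> + ?e * int (3 * n + 3) \<le> B" .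
    next
      fix s2
      assume "(\<exists>d. \<forall>w<n. d w \<le> 3 * n + 3 \<and>
          (\<forall>m<n. entry n (s2 ''Q'') m w = entry n (s' ''Q'') m w - ?e * int (d w))) \<and>
        (\<exists>\<sigma>. near_optimal n ?e (entry n (s2 ''Q'')) \<sigma> \<and> (\<forall>m<n. s2 ''S'' (int m) = int (\<sigma> m)))"
        and bd2: "bounded_by B s2"
        and fr2: "\<And>x. x \<notin> mods (Seq reset (bidding price_upd)) \<Longrightarrow> s2 x = s' x"
      then obtain d \<sigma>' where d: "\<And>w. w < n \<Longrightarrow> d w \<le> 3 * n + 3"
          "\<And>m w. m < n \<Longrightarrow> w < n \<Longrightarrow> entry n (s2 ''Q'') m w = entry n (s' ''Q'') m w - ?e * int (d w)"
        and \<sigma>': "near_optimal n ?e (entry n (s2 ''Q'')) \<sigma>'" "\<forall>m<n. s2 ''S'' (int m) = int (\<sigma>' m)"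
        by blast
      let ?q = "\<lambda>w. q w + ?e * int (d w)"
      have q': "0 \<le> ?q w \<and> ?q w \<le> int (3 * n + 3) * (2 ^ Suc L - 2 ^ l)" if w: "w < n" for w
      proof -
        have "?e * int (d w) \<le> ?e * int (3 * n + 3)" using d(1)[OF w] by (intro mult_left_mono) auto
        then have "?q w \<le> int (3 * n + 3) * (2 ^ Suc L - 2 ^ k) + ?e * int (3 * n + 3)"
          using q[OF w] by linarith
        then show ?thesis using q[OF w] by (simp add: l algebra_simps)
      qed
      have l2: "s2 ''l'' 0 = int l" using fr2 k(2) l by simp
      have "Inv l (s2(''l'' := (s2 ''l'')(0 := int l - 1)))"
        unfolding Inv_def using \<sigma>' q' d(2) Q k l
        by (intro conjI exI[of _ \<sigma>'] exI[of _ ?q]) (auto simp: algebra_simps)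
      then show "wp B (Write ''l'' (Num 0) (Sub (Var ''l'') (Num 1))) 1 (\<lambda>s''. \<exists>k'<k. Inv k' s'') s2"
        by (intro wp_Write[OF bd2] exI[of _ l]) (use l2 l k nB B(2) in auto)
    qed simp
  next
    fix k s'
    assume inv: "Inv k s'" and b: "\<not> bval (Less (Num (-1)) (Var ''l'')) s'"
    then have "k = 0" by (auto simp: Inv_def)
    then show "?post s'" using inv unfolding Inv_def by auto
  qed
qed

text \<open>The language cannot halve a number. The increments are tabulated upwards by doubling,
  and the phases then walk down the table.\<close>

definition powers :: com where
  "powers = Seq (Write ''l'' (Num 0) (Num 0)) (Seq (Write ''p'' (Num 0) (Num 1))
     (Loop (Less (Read ''p'' (Var ''l'')) (Var ''t''))
       (Seq (Write ''p'' (Add (Var ''l'') (Num 1)) (Add (Read ''p'' (Var ''l'')) (Read ''p'' (Var ''l''))))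
         (Write ''l'' (Num 0) (Add (Var ''l'') (Num 1))))))"

lemma mods_powers [simp]: "mods powers = {''l'', ''p''}"
  by (auto simp: powers_def)

lemma wp_powers:
  assumes s: "bounded_by B s" "1 \<le> s ''t'' 0" "s ''t'' 0 \<le> 2 ^ K" and B: "2 * s ''t'' 0 \<le> B"
  shows "wp B powers (3 * K + 3) (\<lambda>s'. \<exists>L\<le>K. s' ''l'' 0 = int L \<and>
    (\<forall>t\<le>L. s' ''p'' (int t) = 2 ^ t) \<and> s ''t'' 0 \<le> 2 ^ L \<and> 2 ^ L \<le> 2 * s ''t'' 0) s"
    (is "wp B _ _ ?post s")
proof -
  define Inv where "Inv \<kappa> s' \<longleftrightarrow> (\<exists>i\<le>K. \<kappa> = K - i \<and> s' ''l'' 0 = int i \<and>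
    (\<forall>t\<le>i. s' ''p'' (int t) = 2 ^ t) \<and> 2 ^ i \<le> 2 * s ''t'' 0)" for \<kappa> :: nat and s' :: store
  let ?s = "s(''l'' := (s ''l'')(0 := 0), ''p'' := (s ''p'')(0 := 1))"
  let ?body = "Seq (Write ''p'' (Add (Var ''l'') (Num 1)) (Add (Read ''p'' (Var ''l'')) (Read ''p'' (Var ''l''))))
         (Write ''l'' (Num 0) (Add (Var ''l'') (Num 1)))"
  have loop: "wp B (Loop (Less (Read ''p'' (Var ''l'')) (Var ''t'')) ?body) (Suc (K * Suc 2)) ?post ?s"
    if bd: "bounded_by B ?s"
  proof (rule wp_Loop[where Inv = Inv, OF bd])
    show "Inv K ?s" using s(2) by (auto simp: Inv_def)
  next
    fix \<kappa> s'
    assume "Inv \<kappa> s'" and bd': "bounded_by B s'"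
      and b: "bval (Less (Read ''p'' (Var ''l'')) (Var ''t'')) s'"
      and fr: "\<And>x. x \<notin> mods ?body \<Longrightarrow> s' x = ?s x"
    then obtain i where i: "i \<le> K" "\<kappa> = K - i" "s' ''l'' 0 = int i" "\<forall>t\<le>i. s' ''p'' (int t) = 2 ^ t"
      unfolding Inv_def by blast
    have lt: "2 ^ i < s ''t'' 0" using b i fr[of "''t''"] by simp
    then have "(2::int) ^ i < 2 ^ K" using s(3) by linarith
    then have iK: "i < K" by simp
    have "int (Suc i) \<le> 2 ^ Suc i" by (metis less_exp less_imp_le of_nat_le_numeral_power_cancel_iff)
    also have "\<dots> \<le> B" using lt B by simp
    finally have iB: "1 + int i \<le> B" by simp
    have "Inv (K - Suc i) (s'(''p'' := (s' ''p'')(int i + 1 := 2 ^ i + 2 ^ i), ''l'' := (s' ''l'')(0 := int i + 1)))"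
      unfolding Inv_def using iK i lt by (intro exI[of _ "Suc i"]) (auto simp: le_Suc_eq)
    moreover have "K - Suc i < \<kappa>" using iK i by simp
    ultimately show "wp B ?body 2 (\<lambda>s''. \<exists>k'<\<kappa>. Inv k' s'') s'"
      unfolding numeral_2_eq_2 One_nat_def[symmetric]
      by (intro wp_Seq_Write wp_Write bd' exI[of _ "K - Suc i"]) (use i lt B iB in auto)
  next
    fix \<kappa> s'
    assume "Inv \<kappa> s'" and b: "\<not> bval (Less (Read ''p'' (Var ''l'')) (Var ''t'')) s'"
      and fr: "\<And>x. x \<notin> mods ?body \<Longrightarrow> s' x = ?s x"
    then obtain i where i: "i \<le> K" "s' ''l'' 0 = int i" "\<forall>t\<le>i. s' ''p'' (int t) = 2 ^ t"
        "2 ^ i \<le> 2 * s ''t'' 0"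
      unfolding Inv_def by blast
    have "s ''t'' 0 \<le> 2 ^ i" using b i fr[of "''t''"] by simp
    then show "?post s'" using i by blast
  qed
  have "wp B powers (Suc (Suc (Suc (K * Suc 2)))) ?post s"
    unfolding powers_def by (intro wp_Seq_Write s(1)) (use loop B s(2) in simp_all)
  then show ?thesis by (rule wp_conseq) auto
qed

section \<open>Common denominators and weights\<close>

abbreviation Entries :: aexp where
  "Entries \<equiv> Mul (Num 2) Square"

text \<open>
  The language has no division, so each numerator is multiplied by the denominators of all other
  entries instead of dividing the common denominator by its own.
\<close>

definition scale_inner :: com where
  "scale_inner = Cond (Conj (Neg (Less (Var ''e'') (Var ''f''))) (Neg (Less (Var ''f'') (Var ''e'')))) Skip
     (Write ''A'' (Var ''e'')
       (Mul (Read ''A'' (Var ''e'')) (Read ''input'' (Add (Num 4) (Mul (Num 2) (Var ''f''))))))"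

definition scale :: com where
  "scale = For ''e'' Entries
     (Seq (Write ''A'' (Var ''e'') (Read ''input'' (Add (Num 3) (Mul (Num 2) (Var ''e'')))))
     (For ''f'' Entries scale_inner))"

lemma mods_scale_inner [simp]: "mods scale_inner = {''A''}"
  by (simp add: scale_inner_def)

lemma mods_scale [simp]: "mods scale = {''e'', ''A'', ''f''}"
  by (auto simp: scale_def)

lemma lessThan_Suc_minus: "{..<Suc t} - {e} = (if t = e then {..<t} - {e} else insert t ({..<t} - {e}))"
  by auto

text \<open>Cell \<open>e\<close> occupies positions \<open>3 + 2 * e\<close> and
  \<open>4 + 2 * e\<close> of the input, behind \<open>n\<close> and the two integers that encode
  \<open>\<epsilon>\<close>.\<close>

lemma wp_scale:
  fixes num den :: "nat \<Rightarrow> int"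
  assumes s: "bounded_by B s" "s ''input'' 0 = int n" and N: "N = 2 * (n * n)" "int N \<le> B"
    and inp: "\<And>e. e < N \<Longrightarrow> s ''input'' (3 + 2 * int e) = num e \<and> s ''input'' (4 + 2 * int e) = den e"
    and den: "\<And>e. e < N \<Longrightarrow> 1 \<le> den e"
    and B: "\<And>e. e < N \<Longrightarrow> \<bar>num e\<bar> * (\<Prod>f<N. den f) \<le> B"
  shows "wp B scale (N * (N * (2 + 2) + 5) + 2)
    (\<lambda>s'. \<forall>e<N. s' ''A'' (int e) = num e * (\<Prod>f\<in>{..<N} - {e}. den f)) s"
proof -
  let ?P = "\<lambda>x e. num e * (\<Prod>f\<in>{..<x} - {e}. den f)"
  \<comment> \<open>Denominators are at least 1, so every partial product stays below the complete
    one.\<close>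
  have PB: "\<bar>?P x e\<bar> \<le> B" if "e < N" "x \<le> N" for x e
  proof -
    have sub: "{..<x} - {e} \<subseteq> {..<N}" using that(2) by auto
    have pos: "0 \<le> (\<Prod>f\<in>{..<x} - {e}. den f)" using den sub by (force intro: prod_nonneg)
    have "(\<Prod>f\<in>{..<x} - {e}. den f) \<le> (\<Prod>f<N. den f)"
      by (rule prod_mono2) (use sub den in \<open>force+\<close>)
    then have "\<bar>num e\<bar> * (\<Prod>f\<in>{..<x} - {e}. den f) \<le> \<bar>num e\<bar> * (\<Prod>f<N. den f)"
      by (rule mult_left_mono) simp
    then show ?thesis using B[OF that(1)] pos by (simp add: abs_mult)
  qed
  have "wp B scale (N * (Suc (N * (2 + 2) + 2) + 2) + 2) (\<lambda>s'. \<forall>e<N. s' ''A'' (int e) = ?P N e) s"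
    unfolding scale_def
  proof (rule wp_For[where Inv = "\<lambda>t s'. \<forall>e<t. s' ''A'' (int e) = ?P N e"])
    fix t s'
    assume t: "t < N" and inv: "\<forall>e<t. s' ''A'' (int e) = ?P N e" and bd: "bounded_by B s'"
      and e: "s' ''e'' 0 = int t"
      and fr: "\<And>y. y \<notin> insert ''e'' (mods (Seq (Write ''A'' (Var ''e'') (Read ''input'' (Add (Num 3) (Mul (Num 2) (Var ''e'')))))
        (For ''f'' Entries scale_inner))) \<Longrightarrow> s' y = s y"
    have inp': "s' ''input'' = s ''input''" using fr by simp
    have in3: "s ''input'' (3 + 2 * int t) = num t" using inp t by blast
    then have numB: "\<bar>num t\<bar> \<le> B" using s(1) unfolding bounded_by_def by metis
    let ?s = "s'(''A'' := (s' ''A'')(int t := num t))"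
    have loop: "wp B (For ''f'' Entries scale_inner) (N * (2 + 2) + 2)
        (\<lambda>s''. \<forall>e<Suc t. s'' ''A'' (int e) = ?P N e) ?s" if bd2: "bounded_by B ?s"
    proof (rule wp_For[where Inv = "\<lambda>x s''. (\<forall>e<t. s'' ''A'' (int e) = ?P N e) \<and> s'' ''A'' (int t) = ?P x t"])
      fix x s2
      assume x: "x < N" and inv2: "(\<forall>e<t. s2 ''A'' (int e) = ?P N e) \<and> s2 ''A'' (int t) = ?P x t"
        and bd3: "bounded_by B s2" and f: "s2 ''f'' 0 = int x"
        and fr2: "\<And>y. y \<notin> insert ''f'' (mods scale_inner) \<Longrightarrow> s2 y = ?s y"
      have e2: "s2 ''e'' 0 = int t" and in2: "s2 ''input'' = s ''input''" using fr2 e inp' by simp_all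
      have in4: "s ''input'' (4 + 2 * int x) = den x" using inp x by blast
      show "wp B scale_inner 2
        (\<lambda>s''. (\<forall>e<t. s'' ''A'' (int e) = ?P N e) \<and> s'' ''A'' (int t) = ?P (Suc x) t) s2"
        unfolding scale_inner_def numeral_2_eq_2
      proof (rule wp_Cond[OF bd3])
        assume "bval (Conj (Neg (Less (Var ''e'') (Var ''f''))) (Neg (Less (Var ''f'') (Var ''e'')))) s2"
        then have "x = t" using e2 f by simp
        then show "wp B Skip (Suc 0) (\<lambda>s''. (\<forall>e<t. s'' ''A'' (int e) = ?P N e) \<and> s'' ''A'' (int t) = ?P (Suc x) t) s2"
          unfolding One_nat_def[symmetric]
          by (intro wp_Skip[OF bd3]) (use inv2 in \<open>simp add: lessThan_Suc_minus\<close>)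
      next
        assume "\<not> bval (Conj (Neg (Less (Var ''e'') (Var ''f''))) (Neg (Less (Var ''f'') (Var ''e'')))) s2"
        then have "x \<noteq> t" using e2 f by auto
        then have P: "?P (Suc x) t = ?P x t * den x" by (simp add: lessThan_Suc_minus)
        have val: "aval (Mul (Read ''A'' (Var ''e'')) (Read ''input'' (Add (Num 4) (Mul (Num 2) (Var ''f''))))) s2
          = ?P (Suc x) t" unfolding P using inv2 e2 in2 in4 f by simp
        show "wp B (Write ''A'' (Var ''e'')
           (Mul (Read ''A'' (Var ''e'')) (Read ''input'' (Add (Num 4) (Mul (Num 2) (Var ''f'')))))) (Suc 0)
           (\<lambda>s''. (\<forall>e<t. s'' ''A'' (int e) = ?P N e) \<and> s'' ''A'' (int t) = ?P (Suc x) t) s2"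
          unfolding One_nat_def[symmetric]
        proof (rule wp_Write[OF bd3], unfold val)
          show "\<bar>?P (Suc x) t\<bar> \<le> B" by (rule PB) (use t x in auto)
        qed (use inv2 e2 in auto)
      qed
    next
      fix x s2 assume "\<And>y. y \<notin> insert ''f'' (mods scale_inner) \<Longrightarrow> s2 y = ?s y"
      from this[of "''input''"] show "aval Entries s2 = int N" using inp' s(2) N(1) by simp
    qed (use bd2 N inv in \<open>auto simp: less_Suc_eq\<close>)
    show "wp B (Seq (Write ''A'' (Var ''e'') (Read ''input'' (Add (Num 3) (Mul (Num 2) (Var ''e'')))))
        (For ''f'' Entries scale_inner)) (Suc (N * (2 + 2) + 2)) (\<lambda>s'. \<forall>e<Suc t. s' ''A'' (int e) = ?P N e) s'"
      by (rule wp_Seq_Write[OF bd]) (use loop e inp' in3 numB in simp_all)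
  qed (use s N in auto)
  then show ?thesis by (rule wp_conseq) (auto simp: algebra_simps)
qed

text \<open>The sum \<open>t\<close> of all weights replaces their maximum as an upper bound, at the
  price of a few bits. Starting it at 1 keeps it positive if all values vanish, as
  \<open>wp_powers\<close> assumes.\<close>

definition weights :: com where
  "weights = Seq (Write ''t'' (Num 0) (Num 1)) (For ''e'' Square
     (Seq (Write ''Q'' (Var ''e'') (Mul (Add SizeN (Num 1))
        (Add (Read ''A'' (Var ''e'')) (Read ''A'' (Add Square (Var ''e''))))))
     (Write ''t'' (Num 0) (Add (Var ''t'') (Read ''Q'' (Var ''e''))))))"

lemma mods_weights [simp]: "mods weights = {''e'', ''Q'', ''t''}"
  by (auto simp: weights_def)

lemma wp_weights:
  fixes c :: "nat \<Rightarrow> int"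
  assumes s: "bounded_by B s" "s ''input'' 0 = int n" and n: "int (n * n) \<le> B"
    and c: "\<And>e. e < n * n \<Longrightarrow> c e = (int n + 1) * (s ''A'' (int e) + s ''A'' (int (n * n + e)))"
      "\<And>e. e < n * n \<Longrightarrow> 0 \<le> c e"
    and B: "1 + (\<Sum>e<n * n. c e) \<le> B"
  shows "wp B weights (4 * (n * n) + 3)
    (\<lambda>s'. (\<forall>e<n * n. s' ''Q'' (int e) = c e) \<and> s' ''t'' 0 = 1 + (\<Sum>e<n * n. c e)) s"
    (is "wp B _ _ ?post s")
proof -
  have sumB: "0 \<le> (\<Sum>e<x. c e) \<and> 1 + (\<Sum>e<x. c e) \<le> B" if "x \<le> n * n" for x
  proof -
    have "(\<Sum>e<x. c e) \<le> (\<Sum>e<n * n. c e)" by (rule sum_mono2) (use that c(2) in auto)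
    moreover have "0 \<le> (\<Sum>e<x. c e)" using that c(2) by (intro sum_nonneg) auto
    ultimately show ?thesis using B by simp
  qed
  let ?s = "s(''t'' := (s ''t'')(0 := 1))"
  let ?body = "Seq (Write ''Q'' (Var ''e'') (Mul (Add SizeN (Num 1))
        (Add (Read ''A'' (Var ''e'')) (Read ''A'' (Add Square (Var ''e''))))))
     (Write ''t'' (Num 0) (Add (Var ''t'') (Read ''Q'' (Var ''e''))))"
  have loop: "wp B (For ''e'' Square ?body) (n * n * (2 + 2) + 2) ?post ?s" if bd: "bounded_by B ?s"
  proof (rule wp_For[where Inv = "\<lambda>x s'. (\<forall>e<x. s' ''Q'' (int e) = c e) \<and> s' ''t'' 0 = 1 + (\<Sum>e<x. c e)"])
    fix t s'
    assume t: "t < n * n" and inv: "(\<forall>e<t. s' ''Q'' (int e) = c e) \<and> s' ''t'' 0 = 1 + (\<Sum>e<t. c e)"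
      and bd': "bounded_by B s'" and e: "s' ''e'' 0 = int t"
      and fr: "\<And>y. y \<notin> insert ''e'' (mods ?body) \<Longrightarrow> s' y = ?s y"
    have eq: "s' ''A'' = s ''A''" "s' ''input'' 0 = int n" using fr s(2) by simp_all
    have val: "aval (Mul (Add SizeN (Num 1)) (Add (Read ''A'' (Var ''e'')) (Read ''A'' (Add Square (Var ''e''))))) s' = c t"
      using eq e c(1)[OF t] by (simp add: algebra_simps)
    have b: "0 \<le> c t" "0 \<le> (\<Sum>e<t. c e)" "1 + (\<Sum>e<t. c e) + c t \<le> B"
      using sumB[of t] sumB[of "Suc t"] c(2)[OF t] t by (auto simp: algebra_simps)
    show "wp B ?body 2 (\<lambda>s'. (\<forall>e<Suc t. s' ''Q'' (int e) = c e) \<and> s' ''t'' 0 = 1 + (\<Sum>e<Suc t. c e)) s'"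
      unfolding numeral_2_eq_2 One_nat_def[symmetric]
    proof (rule wp_Seq_Write[OF bd'], unfold val)
      show "\<bar>c t\<bar> \<le> B" using b by simp
      assume bd2: "bounded_by B (s'(''Q'' := (s' ''Q'')(aval (Var ''e'') s' := c t)))"
      show "wp B (Write ''t'' (Num 0) (Add (Var ''t'') (Read ''Q'' (Var ''e'')))) 1
        (\<lambda>s'. (\<forall>e<Suc t. s' ''Q'' (int e) = c e) \<and> s' ''t'' 0 = 1 + (\<Sum>e<Suc t. c e))
        (s'(''Q'' := (s' ''Q'')(aval (Var ''e'') s' := c t)))"
        by (rule wp_Write[OF bd2]) (use inv e b in \<open>auto simp: less_Suc_eq algebra_simps\<close>)
    qed
  next
    fix i s' assume "\<And>y. y \<notin> insert ''e'' (mods ?body) \<Longrightarrow> s' y = ?s y"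
    from this[of "''input''"] show "aval Square s' = int (n * n)" using s(2) by simp
  qed (use bd n in auto)
  have "wp B weights (Suc (n * n * (2 + 2) + 2)) ?post s"
    unfolding weights_def by (rule wp_Seq_Write[OF s(1)]) (use loop sumB[of 0] in simp_all)
  then show ?thesis by (rule wp_conseq) auto
qed

section \<open>Output\<close>

text \<open>Saves the stable matching before the auction reuses \<open>S\<close>.\<close>

definition copy :: com where
  "copy = For ''i'' SizeN (Write ''R'' (Var ''i'') (Read ''S'' (Var ''i'')))"

lemma mods_copy [simp]: "mods copy = {''i'', ''R''}"
  by (simp add: copy_def)

lemma wp_copy:
  assumes s: "bounded_by B s" "s ''input'' 0 = int n" and n: "int n \<le> B"
  shows "wp B copy (3 * n + 2) (\<lambda>s'. \<forall>i<n. s' ''R'' (int i) = s ''S'' (int i)) s"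
proof -
  have "wp B copy (n * (1 + 2) + 2) (\<lambda>s'. \<forall>i<n. s' ''R'' (int i) = s ''S'' (int i)) s"
    unfolding copy_def
  proof (rule wp_For[where Inv = "\<lambda>t s'. \<forall>i<t. s' ''R'' (int i) = s ''S'' (int i)"])
    fix t s'
    assume "t < n" and inv: "\<forall>i<t. s' ''R'' (int i) = s ''S'' (int i)" and bd: "bounded_by B s'"
      and i: "s' ''i'' 0 = int t"
      and fr: "\<And>y. y \<notin> insert ''i'' (mods (Write ''R'' (Var ''i'') (Read ''S'' (Var ''i'')))) \<Longrightarrow> s' y = s y"
    have "s' ''S'' = s ''S''" using fr by simp
    then show "wp B (Write ''R'' (Var ''i'') (Read ''S'' (Var ''i''))) 1
        (\<lambda>s'. \<forall>i<Suc t. s' ''R'' (int i) = s ''S'' (int i)) s'"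
      by (intro wp_Write bd) (use inv i s(1) in \<open>auto simp: less_Suc_eq bounded_by_def\<close>)
  qed (use s n in auto)
  then show ?thesis by (rule wp_conseq) auto
qed

definition clear_output :: com where
  "clear_output = For ''e'' Square
     (Seq (Write ''output'' (Mul (Num 2) (Var ''e'')) (Num 0))
       (Write ''output'' (Add (Mul (Num 2) (Var ''e'')) (Num 1)) (Read ''input'' (Num 2))))"

text \<open>With \<open>\<epsilon> = a / b\<close> all entries share the denominator
  \<open>b\<close>, and \<open>1 - \<epsilon>\<close> has numerator \<open>b - a\<close>. The second
  write adds to the cell instead of overwriting it, since both matchings may contain the same
  pair.\<close>

definition mix :: com where
  "mix = For ''i'' SizeN
     (Seq (Write ''output'' (Mul (Num 2) (Entry (Var ''i'') (Read ''R'' (Var ''i''))))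
        (Sub (Read ''input'' (Num 2)) (Read ''input'' (Num 1))))
       (Write ''output'' (Mul (Num 2) (Entry (Var ''i'') (Read ''S'' (Var ''i''))))
         (Add (Read ''output'' (Mul (Num 2) (Entry (Var ''i'') (Read ''S'' (Var ''i'')))))
           (Read ''input'' (Num 1)))))"

lemma mods_clear_output [simp]: "mods clear_output = {''e'', ''output''}"
  by (auto simp: clear_output_def)

lemma mods_mix [simp]: "mods mix = {''i'', ''output''}"
  by (auto simp: mix_def)

lemma wp_clear_output:
  assumes s: "bounded_by B s" "s ''input'' 0 = int n" "s ''input'' 2 = b" and n: "int (n * n) \<le> B" "1 \<le> B"
  shows "wp B clear_output (4 * (n * n) + 2)
    (\<lambda>s'. \<forall>e<n * n. s' ''output'' (2 * int e) = 0 \<and> s' ''output'' (2 * int e + 1) = b) s"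
proof -
  have odd: "2 * int e + 1 \<noteq> 2 * int t" "2 * int t \<noteq> 2 * int e + 1" for e t by presburger+
  let ?Inv = "\<lambda>t s'. \<forall>e<t. s' ''output'' (2 * int e) = 0 \<and> s' ''output'' (2 * int e + 1) = b"
  let ?body = "Seq (Write ''output'' (Mul (Num 2) (Var ''e'')) (Num 0))
       (Write ''output'' (Add (Mul (Num 2) (Var ''e'')) (Num 1)) (Read ''input'' (Num 2)))"
  have b: "\<bar>b\<bar> \<le> B" using s(1,3) by (auto simp: bounded_by_def)
  have "wp B clear_output (n * n * (2 + 2) + 2) (?Inv (n * n)) s"
    unfolding clear_output_def
  proof (rule wp_For[where Inv = ?Inv])
    fix t s'
    assume "t < n * n" and inv: "?Inv t s'" and bd: "bounded_by B s'" and e: "s' ''e'' 0 = int t"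
      and fr: "\<And>y. y \<notin> insert ''e'' (mods ?body) \<Longrightarrow> s' y = s y"
    have "s' ''input'' 2 = b" using fr s(3) by simp
    then show "wp B ?body 2 (?Inv (Suc t)) s'"
      unfolding numeral_2_eq_2 One_nat_def[symmetric]
      by (intro wp_Seq_Write wp_Write bd) (use inv e b n in \<open>auto simp: less_Suc_eq odd\<close>)
  qed (use s n in auto)
  then show ?thesis by (rule wp_conseq) auto
qed

lemma wp_mix:
  assumes s: "bounded_by B s" "s ''input'' 0 = int n" "s ''input'' 1 = a" "s ''input'' 2 = b"
    and R: "\<And>m. m < n \<Longrightarrow> s ''R'' (int m) = int (\<rho> m) \<and> \<rho> m < n"
    and S: "\<And>m. m < n \<Longrightarrow> s ''S'' (int m) = int (\<sigma> m) \<and> \<sigma> m < n"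
    and out: "\<And>m w. m < n \<Longrightarrow> w < n \<Longrightarrow> s ''output'' (2 * (int m * int n + int w)) = 0 \<and>
      s ''output'' (2 * (int m * int n + int w) + 1) = b"
    and B: "int n \<le> B" and ab: "0 \<le> a" "a \<le> b"
  shows "wp B mix (4 * n + 2) (\<lambda>s'. \<forall>m<n. \<forall>w<n.
      s' ''output'' (2 * (int m * int n + int w)) = (if \<rho> m = w then b - a else 0) + (if \<sigma> m = w then a else 0) \<and>
      s' ''output'' (2 * (int m * int n + int w) + 1) = b) s"
proof -
  let ?body = "Seq (Write ''output'' (Mul (Num 2) (Entry (Var ''i'') (Read ''R'' (Var ''i''))))
        (Sub (Read ''input'' (Num 2)) (Read ''input'' (Num 1))))
       (Write ''output'' (Mul (Num 2) (Entry (Var ''i'') (Read ''S'' (Var ''i''))))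
         (Add (Read ''output'' (Mul (Num 2) (Entry (Var ''i'') (Read ''S'' (Var ''i'')))))
           (Read ''input'' (Num 1))))"
  have odd: "2 * x + 1 \<noteq> 2 * y" for x y :: int by presburger
  have bB: "b \<le> B" using s(1,4) abs_le_D1 by (auto simp: bounded_by_def)
  define val where "val m w = (if \<rho> m = w then b - a else 0) + (if \<sigma> m = w then a else 0)" for m w
  let ?Inv = "\<lambda>t s'. \<forall>m<n. \<forall>w<n.
      s' ''output'' (2 * (int m * int n + int w)) = (if m < t then val m w else 0) \<and>
      s' ''output'' (2 * (int m * int n + int w) + 1) = b"
  have "wp B mix (n * (2 + 2) + 2) (\<lambda>s'. \<forall>m<n. \<forall>w<n.
      s' ''output'' (2 * (int m * int n + int w)) = val m w \<and>
      s' ''output'' (2 * (int m * int n + int w) + 1) = b) s"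
    unfolding mix_def
  proof (rule wp_For[where Inv = ?Inv])
    fix t s'
    assume t: "t < n" and inv: "?Inv t s'" and bd: "bounded_by B s'" and i: "s' ''i'' 0 = int t"
      and fr: "\<And>y. y \<notin> insert ''i'' (mods ?body) \<Longrightarrow> s' y = s y"
    have eq: "s' ''input'' = s ''input''" "s' ''R'' = s ''R''" "s' ''S'' = s ''S''" using fr by simp_all
    note RS = R[OF t] S[OF t]
    have inj: "2 * (int m * int n + int w) = 2 * (int t * int n + int w') \<longleftrightarrow> m = t \<and> w = w'"
      if "w < n" "w' < n" for m w w'
      unfolding mult_cancel_left using index_inj[OF that, of m t] by simp
    let ?s2 = "s'(''output'' := (s' ''output'')(2 * (int t * int n + int (\<rho> t)) := b - a))"
    \<comment> \<open>The value read back is the one just written exactly when man \<open>t\<close>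
      has the same partner in both matchings; otherwise it is the cleared 0.\<close>
    have cell: "?s2 ''output'' (2 * (int t * int n + int (\<sigma> t))) = (if \<rho> t = \<sigma> t then b - a else 0)"
      using inv t RS inj[of "\<sigma> t" "\<rho> t" t] by auto
    have last: "wp B (Write ''output'' (Mul (Num 2) (Entry (Var ''i'') (Read ''S'' (Var ''i''))))
         (Add (Read ''output'' (Mul (Num 2) (Entry (Var ''i'') (Read ''S'' (Var ''i'')))))
           (Read ''input'' (Num 1)))) 1 (?Inv (Suc t)) ?s2" if bd2: "bounded_by B ?s2"
    proof (rule wp_Write[OF bd2])
      have i2: "aval (Mul (Num 2) (Entry (Var ''i'') (Read ''S'' (Var ''i'')))) ?s2 = 2 * (int t * int n + int (\<sigma> t))"
        using i eq s(2) RS by simp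
      then have v2: "aval (Add (Read ''output'' (Mul (Num 2) (Entry (Var ''i'') (Read ''S'' (Var ''i'')))))
           (Read ''input'' (Num 1))) ?s2 = val t (\<sigma> t)"
        unfolding aval.simps(3) aval.simps(2)[of "''output''"] i2 cell using eq s(3) by (simp add: val_def)
      show "\<bar>aval (Add (Read ''output'' (Mul (Num 2) (Entry (Var ''i'') (Read ''S'' (Var ''i'')))))
           (Read ''input'' (Num 1))) ?s2\<bar> \<le> B"
        unfolding v2 using ab bB by (simp add: val_def)
      show "?Inv (Suc t) (?s2(''output'' := (?s2 ''output'')
          (aval (Mul (Num 2) (Entry (Var ''i'') (Read ''S'' (Var ''i'')))) ?s2 :=
           aval (Add (Read ''output'' (Mul (Num 2) (Entry (Var ''i'') (Read ''S'' (Var ''i'')))))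
           (Read ''input'' (Num 1))) ?s2)))"
        unfolding i2 v2
      proof (intro allI impI conjI)
        fix m w assume mw: "m < n" "w < n"
        have n: "\<sigma> t < n" "\<rho> t < n" using RS by blast+
        note in1 = inj[OF mw(2) n(1), of m] and in2 = inj[OF mw(2) n(2), of m]
        show "(?s2(''output'' := (?s2 ''output'')(2 * (int t * int n + int (\<sigma> t)) := val t (\<sigma> t)))) ''output''
            (2 * (int m * int n + int w)) = (if m < Suc t then val m w else 0)"
          unfolding fun_upd_same fun_upd_apply in1 in2 using inv mw by (auto simp: val_def less_Suc_eq)
        show "(?s2(''output'' := (?s2 ''output'')(2 * (int t * int n + int (\<sigma> t)) := val t (\<sigma> t)))) ''output''
            (2 * (int m * int n + int w) + 1) = b"
        proof -
          have "2 * (int m * int n + int w) + 1 \<noteq> 2 * (int t * int n + int (\<sigma> t))"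
            "2 * (int m * int n + int w) + 1 \<noteq> 2 * (int t * int n + int (\<rho> t))" by (rule odd)+
          then show ?thesis using inv mw by (simp del: distrib_left_numeral)
        qed
      qed
    qed
    show "wp B ?body 2 (?Inv (Suc t)) s'"
      unfolding numeral_2_eq_2 One_nat_def[symmetric]
    proof (rule wp_Seq_Write[OF bd])
      have i1: "aval (Mul (Num 2) (Entry (Var ''i'') (Read ''R'' (Var ''i'')))) s' = 2 * (int t * int n + int (\<rho> t))"
        "aval (Sub (Read ''input'' (Num 2)) (Read ''input'' (Num 1))) s' = b - a"
        using i eq s RS by simp_all
      show "\<bar>aval (Sub (Read ''input'' (Num 2)) (Read ''input'' (Num 1))) s'\<bar> \<le> B"
        unfolding i1 using ab bB by simp
      show "wp B (Write ''output'' (Mul (Num 2) (Entry (Var ''i'') (Read ''S'' (Var ''i''))))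
         (Add (Read ''output'' (Mul (Num 2) (Entry (Var ''i'') (Read ''S'' (Var ''i'')))))
           (Read ''input'' (Num 1)))) 1 (?Inv (Suc t))
         (s'(''output'' := (s' ''output'')(aval (Mul (Num 2) (Entry (Var ''i'') (Read ''R'' (Var ''i'')))) s' :=
            aval (Sub (Read ''input'' (Num 2)) (Read ''input'' (Num 1))) s')))"
        if "bounded_by B (s'(''output'' := (s' ''output'')(aval (Mul (Num 2) (Entry (Var ''i'') (Read ''R'' (Var ''i'')))) s' :=
            aval (Sub (Read ''input'' (Num 2)) (Read ''input'' (Num 1))) s')))"
        using that last unfolding i1 by blast
    qed
  qed (use s B out in auto)
  then show ?thesis unfolding val_def by (rule wp_conseq) auto
qed

section \<open>Mixing the two matchings\<close>

definition mixture :: "real \<Rightarrow> (nat \<Rightarrow> nat) \<Rightarrow> (nat \<Rightarrow> nat) \<Rightarrow> matching" where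
  "mixture \<epsilon> \<rho> \<sigma> m w = (1 - \<epsilon>) * of_bool (\<rho> m = w) + \<epsilon> * of_bool (\<sigma> m = w)"

lemma sum_row_of_bool:
  fixes f :: "nat \<Rightarrow> real"
  assumes "bij_betw \<rho> {..<n} {..<n}" "m < n"
  shows "(\<Sum>w<n. f w * of_bool (\<rho> m = w)) = f (\<rho> m)"
proof -
  have "\<rho> m < n" using assms by (auto simp: bij_betw_def)
  then show ?thesis by (simp add: of_bool_def sum.delta if_distrib[of "(*) _"] cong: if_cong)
qed

lemma sum_column_of_bool:
  fixes f :: "nat \<Rightarrow> real"
  assumes "bij_betw \<rho> {..<n} {..<n}" "h < n" "\<rho> h = w"
  shows "(\<Sum>m<n. f m * of_bool (\<rho> m = w)) = f h"
proof -
  have "(\<Sum>m<n. f m * of_bool (\<rho> m = w)) = (\<Sum>m<n. f m * of_bool (m = h))"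
    by (rule sum.cong) (use assms in \<open>auto simp: bij_betw_def inj_on_def\<close>)
  also have "\<dots> = f h"
    using assms(2) by (simp add: of_bool_def sum.delta' if_distrib[of "(*) _"] cong: if_cong)
  finally show ?thesis .
qed

text \<open>The arbitrary \<open>f\<close> covers both uses: values of a man give his utility, and
  the constant 1 gives the row sum.\<close>

lemma sum_row_mixture:
  fixes f :: "nat \<Rightarrow> real"
  assumes "bij_betw \<rho> {..<n} {..<n}" "bij_betw \<sigma> {..<n} {..<n}" "m < n"
  shows "(\<Sum>w<n. f w * mixture \<epsilon> \<rho> \<sigma> m w) = (1 - \<epsilon>) * f (\<rho> m) + \<epsilon> * f (\<sigma> m)"
proof -
  have "(\<Sum>w<n. f w * mixture \<epsilon> \<rho> \<sigma> m w) =
      (1 - \<epsilon>) * (\<Sum>w<n. f w * of_bool (\<rho> m = w)) + \<epsilon> * (\<Sum>w<n. f w * of_bool (\<sigma> m = w))"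
    unfolding sum_distrib_left sum.distrib[symmetric]
    by (rule sum.cong) (simp_all only: mixture_def distrib_left mult.left_commute)
  then show ?thesis
    by (simp only: sum_row_of_bool[OF assms(1,3)] sum_row_of_bool[OF assms(2,3)])
qed

lemma sum_column_mixture:
  fixes f :: "nat \<Rightarrow> real"
  assumes "bij_betw \<rho> {..<n} {..<n}" "bij_betw \<sigma> {..<n} {..<n}" "h < n" "\<rho> h = w" "k < n" "\<sigma> k = w"
  shows "(\<Sum>m<n. f m * mixture \<epsilon> \<rho> \<sigma> m w) = (1 - \<epsilon>) * f h + \<epsilon> * f k"
proof -
  have "(\<Sum>m<n. f m * mixture \<epsilon> \<rho> \<sigma> m w) =
      (1 - \<epsilon>) * (\<Sum>m<n. f m * of_bool (\<rho> m = w)) + \<epsilon> * (\<Sum>m<n. f m * of_bool (\<sigma> m = w))"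
    unfolding sum_distrib_left sum.distrib[symmetric]
    by (rule sum.cong) (simp_all only: mixture_def distrib_left mult.left_commute)
  then show ?thesis
    using sum_column_of_bool[OF assms(1,3,4), of f] sum_column_of_bool[OF assms(2,5,6), of f] by simp
qed

lemma bij_betw_preimage:
  assumes "bij_betw \<rho> {..<n} {..<n}" "w < (n :: nat)"
  obtains h where "h < n" "\<rho> h = w"
  using assms by (metis bij_betw_imp_surj_on imageE lessThan_iff)

lemma complete_mixture:
  assumes "bij_betw \<rho> {..<agents I} {..<agents I}" "bij_betw \<sigma> {..<agents I} {..<agents I}"
    and "0 \<le> \<epsilon>" "\<epsilon> \<le> 1"
  shows "complete_matching I (mixture \<epsilon> \<rho> \<sigma>)"
proof -
  let ?n = "agents I"
  have rows: "(\<Sum>w<?n. mixture \<epsilon> \<rho> \<sigma> m w) = 1" if "m < ?n" for m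
    using sum_row_mixture[OF assms(1,2) that, of "\<lambda>_. 1" \<epsilon>] by simp
  have columns: "(\<Sum>m<?n. mixture \<epsilon> \<rho> \<sigma> m w) = 1" if w: "w < ?n" for w
  proof -
    obtain h where "h < ?n" "\<rho> h = w" by (rule bij_betw_preimage[OF assms(1) w])
    moreover obtain k where "k < ?n" "\<sigma> k = w" by (rule bij_betw_preimage[OF assms(2) w])
    ultimately show ?thesis using sum_column_mixture[OF assms(1,2), of h w k "\<lambda>_. 1" \<epsilon>] by simp
  qed
  have "0 \<le> mixture \<epsilon> \<rho> \<sigma> m w" for m w using assms(3,4) by (simp add: mixture_def)
  then show ?thesis using rows columns by (simp add: complete_matching_def fractional_matching_def)
qed

section \<open>Welfare as an assignment problem and its dual\<close>

definition pair_value :: "smc \<Rightarrow> nat \<Rightarrow> nat \<Rightarrow> real" where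
  "pair_value I m w = of_rat (U I m w) + of_rat (V I m w)"

lemma welfare_eq: "welfare I \<mu> = (\<Sum>m<agents I. \<Sum>w<agents I. pair_value I m w * \<mu> m w)"
proof -
  have "(\<Sum>w<agents I. woman_utility I \<mu> w) = (\<Sum>m<agents I. \<Sum>w<agents I. of_rat (V I m w) * \<mu> m w)"
    unfolding woman_utility_def by (rule sum.swap)
  then show ?thesis
    by (simp add: welfare_def man_utility_def pair_value_def sum.distrib distrib_right)
qed

lemma welfare_mixture:
  assumes "bij_betw \<rho> {..<agents I} {..<agents I}" "bij_betw \<sigma> {..<agents I} {..<agents I}"
  shows "welfare I (mixture \<epsilon> \<rho> \<sigma>) =
    (1 - \<epsilon>) * (\<Sum>m<agents I. pair_value I m (\<rho> m)) + \<epsilon> * (\<Sum>m<agents I. pair_value I m (\<sigma> m))"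
  unfolding welfare_eq using sum_row_mixture[OF assms] by (simp add: sum.distrib sum_distrib_left)

text \<open>Weak duality, the dual of man \<open>m\<close> being
  \<open>pair_value I m (\<sigma> m) - y (\<sigma> m)\<close>. Rows and columns of
  \<open>\<nu>\<close> sum to exactly 1, so prices of either sign are admissible; as
  \<open>\<sigma>\<close> is a bijection, they cancel in total.\<close>

lemma welfare_le_dual:
  fixes y :: "nat \<Rightarrow> real"
  assumes \<sigma>: "bij_betw \<sigma> {..<agents I} {..<agents I}"
    and dual: "\<And>m w. m < agents I \<Longrightarrow> w < agents I \<Longrightarrow> pair_value I m w - y w \<le> pair_value I m (\<sigma> m) - y (\<sigma> m)"
    and \<nu>: "complete_matching I \<nu>"
  shows "welfare I \<nu> \<le> (\<Sum>m<agents I. pair_value I m (\<sigma> m))"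
proof -
  let ?n = "agents I"
  have "welfare I \<nu> \<le> (\<Sum>m<?n. \<Sum>w<?n. (pair_value I m (\<sigma> m) - y (\<sigma> m)) * \<nu> m w + y w * \<nu> m w)"
    unfolding welfare_eq
  proof (intro sum_mono)
    fix m w assume "m \<in> {..<?n}" "w \<in> {..<?n}"
    then have "pair_value I m w \<le> pair_value I m (\<sigma> m) - y (\<sigma> m) + y w" "0 \<le> \<nu> m w"
      using dual[of m w] \<nu> by (auto simp: complete_matching_def fractional_matching_def)
    then have "pair_value I m w * \<nu> m w \<le> (pair_value I m (\<sigma> m) - y (\<sigma> m) + y w) * \<nu> m w"
      by (rule mult_right_mono)
    then show "pair_value I m w * \<nu> m w \<le> (pair_value I m (\<sigma> m) - y (\<sigma> m)) * \<nu> m w + y w * \<nu> m w"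
      by (simp add: distrib_right)
  qed
  also have "\<dots> = (\<Sum>m<?n. (pair_value I m (\<sigma> m) - y (\<sigma> m)) * (\<Sum>w<?n. \<nu> m w)) +
      (\<Sum>m<?n. \<Sum>w<?n. y w * \<nu> m w)"
    by (simp add: sum.distrib sum_distrib_left)
  also have "(\<Sum>m<?n. \<Sum>w<?n. y w * \<nu> m w) = (\<Sum>w<?n. y w * (\<Sum>m<?n. \<nu> m w))"
    by (subst sum.swap) (simp add: sum_distrib_left)
  also have "\<dots> = (\<Sum>w<?n. y w)" using \<nu> by (simp add: complete_matching_def)
  also have "\<dots> = (\<Sum>m<?n. y (\<sigma> m))" by (rule sum.reindex_bij_betw[OF \<sigma>, symmetric])
  also have "(\<Sum>m<?n. (pair_value I m (\<sigma> m) - y (\<sigma> m)) * (\<Sum>w<?n. \<nu> m w)) + (\<Sum>m<?n. y (\<sigma> m)) =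
      (\<Sum>m<?n. pair_value I m (\<sigma> m))"
    using \<nu> by (simp add: complete_matching_def sum_subtractf)
  finally show ?thesis .
qed

lemma eps_stable_mixture:
  assumes inst: "smc_instance I" and \<epsilon>: "0 \<le> \<epsilon>" "\<epsilon> \<le> 1"
    and \<rho>: "stable_for (agents I) (U I) (V I) \<rho>"
    and \<sigma>: "bij_betw \<sigma> {..<agents I} {..<agents I}"
  shows "eps_stable I \<epsilon> (mixture \<epsilon> \<rho> \<sigma>)"
  unfolding eps_stable_def
proof (intro allI impI)
  let ?n = "agents I" and ?\<mu> = "mixture \<epsilon> \<rho> \<sigma>"
  fix m w assume mw: "m < ?n" "w < ?n"
  have bij: "bij_betw \<rho> {..<?n} {..<?n}" using \<rho> by (simp add: stable_for_def)
  have n: "\<sigma> m < ?n" using \<sigma> mw by (auto simp: bij_betw_def)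
  show "man_utility I ?\<mu> m \<ge> (1 - \<epsilon>) * of_rat (U I m w) \<or>
        woman_utility I ?\<mu> w \<ge> (1 - \<epsilon>) * of_rat (V I m w)"
  proof (cases "U I m w \<le> U I m (\<rho> m)")
    case True
    have "man_utility I ?\<mu> m = (1 - \<epsilon>) * of_rat (U I m (\<rho> m)) + \<epsilon> * of_rat (U I m (\<sigma> m))"
      unfolding man_utility_def by (rule sum_row_mixture[OF bij \<sigma> mw(1)])
    moreover have "0 \<le> \<epsilon> * of_rat (U I m (\<sigma> m))"
      using inst \<epsilon> mw n by (simp add: smc_instance_def)
    moreover have "(1 - \<epsilon>) * of_rat (U I m w) \<le> (1 - \<epsilon>) * of_rat (U I m (\<rho> m))"
      using True \<epsilon> by (intro mult_left_mono) (auto simp: of_rat_less_eq)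
    ultimately show ?thesis by linarith
  next
    case False
    then obtain h where h: "h < ?n" "\<rho> h = w" "V I m w \<le> V I h w"
      using \<rho> mw unfolding stable_for_def by blast
    obtain k where k: "k < ?n" "\<sigma> k = w" using bij_betw_preimage[OF \<sigma> mw(2)] .
    have "woman_utility I ?\<mu> w = (1 - \<epsilon>) * of_rat (V I h w) + \<epsilon> * of_rat (V I k w)"
      unfolding woman_utility_def by (rule sum_column_mixture[OF bij \<sigma> h(1,2) k])
    moreover have "0 \<le> \<epsilon> * of_rat (V I k w)"
      using inst \<epsilon> mw k by (simp add: smc_instance_def)
    moreover have "(1 - \<epsilon>) * of_rat (V I m w) \<le> (1 - \<epsilon>) * of_rat (V I h w)"
      using h \<epsilon> by (intro mult_left_mono) (auto simp: of_rat_less_eq)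
    ultimately show ?thesis by linarith
  qed
qed

lemma mixture_good:
  fixes y :: "nat \<Rightarrow> real"
  assumes inst: "smc_instance I" and \<epsilon>: "0 \<le> \<epsilon>" "\<epsilon> \<le> 1"
    and \<rho>: "stable_for (agents I) (U I) (V I) \<rho>"
    and \<sigma>: "bij_betw \<sigma> {..<agents I} {..<agents I}"
    and dual: "\<And>m w. m < agents I \<Longrightarrow> w < agents I \<Longrightarrow> pair_value I m w - y w \<le> pair_value I m (\<sigma> m) - y (\<sigma> m)"
  shows "complete_matching I (mixture \<epsilon> \<rho> \<sigma>)" "eps_stable I \<epsilon> (mixture \<epsilon> \<rho> \<sigma>)"
    "\<exists>\<mu>opt. optimal_matching I \<mu>opt \<and> welfare I (mixture \<epsilon> \<rho> \<sigma>) \<ge> \<epsilon> * welfare I \<mu>opt"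
proof -
  have bij: "bij_betw \<rho> {..<agents I} {..<agents I}" using \<rho> by (simp add: stable_for_def)
  show "complete_matching I (mixture \<epsilon> \<rho> \<sigma>)" by (rule complete_mixture[OF bij \<sigma> \<epsilon>])
  show "eps_stable I \<epsilon> (mixture \<epsilon> \<rho> \<sigma>)" by (rule eps_stable_mixture[OF inst \<epsilon> \<rho> \<sigma>])
  have opt: "welfare I (mixture 1 \<rho> \<sigma>) = (\<Sum>m<agents I. pair_value I m (\<sigma> m))"
    using welfare_mixture[OF bij \<sigma>, of 1] by simp
  \<comment> \<open>\<open>mixture 1 \<rho> \<sigma>\<close> is \<open>\<sigma>\<close> as a
    fractional matching. An optimal matching is thus exhibited, and no compactness argument is
    called for.\<close>
  have "optimal_matching I (mixture 1 \<rho> \<sigma>)"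
    unfolding optimal_matching_def opt
    using complete_mixture[OF bij \<sigma>, of 1] welfare_le_dual[OF \<sigma> dual] by simp
  moreover have "0 \<le> (1 - \<epsilon>) * (\<Sum>m<agents I. pair_value I m (\<rho> m))"
  proof (intro mult_nonneg_nonneg sum_nonneg)
    fix m assume "m \<in> {..<agents I}"
    moreover from this have "\<rho> m < agents I" using bij by (auto simp: bij_betw_def)
    ultimately show "0 \<le> pair_value I m (\<rho> m)"
      using inst by (simp add: pair_value_def smc_instance_def)
  qed (use \<epsilon> in simp)
  ultimately show "\<exists>\<mu>opt. optimal_matching I \<mu>opt \<and> welfare I (mixture \<epsilon> \<rho> \<sigma>) \<ge> \<epsilon> * welfare I \<mu>opt"
    using welfare_mixture[OF bij \<sigma>, of \<epsilon>] opt by (intro exI[of _ "mixture 1 \<rho> \<sigma>"]) simp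
qed

section \<open>A polynomial-time solver\<close>

definition smc_solver :: com where
  "smc_solver = Seq scale (Seq deferred_acceptance (Seq copy (Seq weights (Seq powers (Seq phases
     (Seq clear_output (Seq mix (Write ''outlen'' (Num 0) Entries))))))))"

definition solver_time :: "nat \<Rightarrow> nat \<Rightarrow> nat" where
  "solver_time n K = 2 * (n * n) * (2 * (n * n) * (2 + 2) + 5) + 2 + (time_da n + (3 * n + 2 +
     (4 * (n * n) + 3 + (3 * K + 3 + (Suc (Suc K * Suc (time_phase n + 1)) +
     (4 * (n * n) + 2 + (4 * n + 2 + 1)))))))"

text \<open>The value in cell \<open>e\<close> times the product of all denominators. Both matrices
  share this factor, so scaling respects comparisons as well as the sums of a man's and a woman's
  value.\<close>

definition scaled :: "nat \<Rightarrow> (nat \<Rightarrow> int) \<Rightarrow> (nat \<Rightarrow> int) \<Rightarrow> nat \<Rightarrow> int" where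
  "scaled N num den e = num e * (\<Prod>f\<in>{..<N} - {e}. den f)"

text \<open>Stability compares men's values only within a row and women's values only within a
  column, so order preservation there suffices to transfer it.\<close>

lemma stable_for_mono:
  assumes "stable_for n u v \<rho>"
    and "\<And>m w w'. m < n \<Longrightarrow> w < n \<Longrightarrow> w' < n \<Longrightarrow> u m w \<le> u m w' \<Longrightarrow> u' m w \<le> u' m w'"
    and "\<And>m h w. m < n \<Longrightarrow> h < n \<Longrightarrow> w < n \<Longrightarrow> v m w \<le> v h w \<Longrightarrow> v' m w \<le> v' h w"
  shows "stable_for n u' v' \<rho>"
  unfolding stable_for_def
proof (intro conjI allI impI)
  show bij: "bij_betw \<rho> {..<n} {..<n}" using assms(1) by (simp add: stable_for_def)
  fix m w assume mw: "m < n" "w < n"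
  then have "\<rho> m < n" using bij by (auto simp: bij_betw_def)
  have "u m w \<le> u m (\<rho> m) \<or> (\<exists>h<n. \<rho> h = w \<and> v m w \<le> v h w)"
    using assms(1) mw unfolding stable_for_def by blast
  then show "u' m w \<le> u' m (\<rho> m) \<or> (\<exists>h<n. \<rho> h = w \<and> v' m w \<le> v' h w)"
    using assms(2,3) mw \<open>\<rho> m < n\<close> by blast
qed

text \<open>The postcondition speaks of the scaled integers only. The dual prices \<open>y\<close>
  are never computed; their existence is extracted from the final state of the auction.\<close>

lemma wp_smc_solver:
  fixes n :: nat and num den :: "nat \<Rightarrow> int"
  defines "A \<equiv> scaled (2 * (n * n)) num den"
  defines "u \<equiv> \<lambda>m w. A (m * n + w)" and "v \<equiv> \<lambda>m w. A (n * n + (m * n + w))"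
  defines "tot \<equiv> 1 + (\<Sum>e<n * n. (int n + 1) * (A e + A (n * n + e)))"
  assumes s: "bounded_by B s" "s ''input'' 0 = int n" "s ''input'' 1 = a" "s ''input'' 2 = b"
    and inp: "\<And>e. e < 2 * (n * n) \<Longrightarrow> s ''input'' (3 + 2 * int e) = num e \<and> s ''input'' (4 + 2 * int e) = den e"
    and num: "\<And>e. e < 2 * (n * n) \<Longrightarrow> 0 \<le> num e" and den: "\<And>e. e < 2 * (n * n) \<Longrightarrow> 1 \<le> den e"
    and ab: "0 \<le> a" "a \<le> b"
    and B: "int (2 * (n * n)) \<le> B" "\<And>e. e < 2 * (n * n) \<Longrightarrow> num e * (\<Prod>f<2 * (n * n). den f) \<le> B"
      "int (3 * n + 4) * (4 * tot) \<le> B"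
    and K: "tot \<le> 2 ^ K"
  shows "wp B smc_solver (solver_time n K) (\<lambda>s'. \<exists>\<rho> \<sigma> y.
      stable_for n u v \<rho> \<and> bij_betw \<sigma> {..<n} {..<n} \<and>
      (\<forall>m<n. \<forall>w<n. u m w + v m w - y w \<le> u m (\<sigma> m) + v m (\<sigma> m) - y (\<sigma> m)) \<and>
      s' ''outlen'' 0 = int (2 * (n * n)) \<and>
      (\<forall>m<n. \<forall>w<n. s' ''output'' (2 * (int m * int n + int w)) =
          (if \<rho> m = w then b - a else 0) + (if \<sigma> m = w then a else 0) \<and>
        s' ''output'' (2 * (int m * int n + int w) + 1) = b)) s" (is "wp B _ _ ?post s")
proof -
  let ?N = "2 * (n * n)"
  define c where "c e = (int n + 1) * (A e + A (n * n + e))" for e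
  have A0: "0 \<le> A e" if "e < ?N" for e
    unfolding A_def scaled_def using num[OF that] den by (force intro!: mult_nonneg_nonneg prod_nonneg)
  have c0: "0 \<le> c e" if "e < n * n" for e
    unfolding c_def using A0[of e] A0[of "n * n + e"] that by (intro mult_nonneg_nonneg) auto
  have tot: "tot = 1 + (\<Sum>e<n * n. c e)" by (simp add: tot_def c_def)
  have tot1: "1 \<le> tot" unfolding tot using sum_nonneg[of "{..<n * n}" c] c0 by simp
  have "1 * (4 * tot) \<le> int (3 * n + 4) * (4 * tot)" using tot1 by (intro mult_right_mono) auto
  then have totB: "4 * tot \<le> B" using B(3) by linarith
  have "int (n * n) \<le> int (2 * (n * n))" by simp
  then have n2: "int (n * n) \<le> B" using B(1) by (rule order_trans)
  have "n \<le> n * n" by simp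
  then have n1: "int n \<le> B" using n2 by linarith
  have B1: "1 \<le> B" using totB tot1 by simp
  have c_le: "c e \<le> tot" if "e < n * n" for e
    using member_le_sum[of e "{..<n * n}" c] that c0 unfolding tot by simp
  show ?thesis
    unfolding smc_solver_def solver_time_def
  proof (rule wp_Seq_conseq)
    show "wp B scale (?N * (?N * (2 + 2) + 5) + 2) (\<lambda>s'. \<forall>e<?N. s' ''A'' (int e) = A e) s"
      unfolding A_def scaled_def
      by (rule wp_scale[OF s(1,2) refl B(1)]) (use inp num den B(2) in auto)
  next
    fix s1
    assume A1: "\<forall>e<?N. s1 ''A'' (int e) = A e" and bd1: "bounded_by B s1"
      and fr1: "\<And>x. x \<notin> mods scale \<Longrightarrow> s1 x = s x"
    have in1: "s1 ''input'' = s ''input''" using fr1 by simp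
    have A1': "s1 ''A'' (int e) = A e" if "e < ?N" for e using A1 that by blast
    have lt: "m * n + w < n * n" if "m < n" "w < n" for m w using index_less[OF that] .
    have u: "entry n (s1 ''A'') m w = u m w" if "m < n" "w < n" for m w
      using A1'[of "m * n + w"] lt[OF that] by (simp add: entry_def u_def)
    have v: "women_values n (s1 ''A'') m w = v m w" if "m < n" "w < n" for m w
      using A1'[of "n * n + (m * n + w)"] lt[OF that] by (simp add: entry_def v_def)
    have stable: "stable_for n u v \<rho>"
      if \<rho>: "stable_for n (entry n (s1 ''A'')) (women_values n (s1 ''A'')) \<rho>" for \<rho>
      by (rule stable_for_mono[OF \<rho>]) (simp_all add: u v)
    show "wp B (Seq deferred_acceptance (Seq copy (Seq weights (Seq powers (Seq phases
      (Seq clear_output (Seq mix (Write ''outlen'' (Num 0) Entries))))))))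
      (time_da n + (3 * n + 2 + (4 * (n * n) + 3 + (3 * K + 3 + (Suc (Suc K * Suc (time_phase n + 1)) +
       (4 * (n * n) + 2 + (4 * n + 2 + 1))))))) ?post s1"
    proof (rule wp_Seq_conseq[OF wp_deferred_acceptance[OF bd1 _ n2 B1]])
      show "s1 ''input'' 0 = int n" using in1 s(2) by simp
      show "0 \<le> entry n (s1 ''A'') m w" if "m < n" "w < n" for m w
        unfolding u[OF that] using A0[of "m * n + w"] lt[OF that] by (simp add: u_def)
    next
      fix s2
      assume "\<exists>\<rho>. (\<forall>m<n. s2 ''S'' (int m) = int (\<rho> m)) \<and>
          stable_for n (entry n (s1 ''A'')) (women_values n (s1 ''A'')) \<rho>"
        and bd2: "bounded_by B s2" and fr2: "\<And>x. x \<notin> mods deferred_acceptance \<Longrightarrow> s2 x = s1 x"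
      then obtain \<rho> where \<rho>: "\<And>m. m < n \<Longrightarrow> s2 ''S'' (int m) = int (\<rho> m)" "stable_for n u v \<rho>"
        using stable by blast
      have \<rho>n: "\<rho> m < n" if "m < n" for m using \<rho>(2) that by (auto simp: stable_for_def bij_betw_def)
      have in2: "s2 ''input'' = s ''input''" and A2: "s2 ''A'' = s1 ''A''" using fr2 in1 by simp_all
      show "wp B (Seq copy (Seq weights (Seq powers (Seq phases
          (Seq clear_output (Seq mix (Write ''outlen'' (Num 0) Entries)))))))
        (3 * n + 2 + (4 * (n * n) + 3 + (3 * K + 3 + (Suc (Suc K * Suc (time_phase n + 1)) +
          (4 * (n * n) + 2 + (4 * n + 2 + 1)))))) ?post s2"
      proof (rule wp_Seq_conseq[OF wp_copy[OF bd2 _ n1]])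
        show "s2 ''input'' 0 = int n" using in2 s(2) by simp
      next
        fix s3
        assume R: "\<forall>i<n. s3 ''R'' (int i) = s2 ''S'' (int i)"
          and bd3: "bounded_by B s3" and fr3: "\<And>x. x \<notin> mods copy \<Longrightarrow> s3 x = s2 x"
        have in3: "s3 ''input'' = s ''input''" and A3: "s3 ''A'' = s1 ''A''" using fr3 in2 A2 by simp_all
        have in30: "s3 ''input'' 0 = int n" using in3 s(2) by simp
        have c: "c e = (int n + 1) * (s3 ''A'' (int e) + s3 ''A'' (int (n * n + e)))" if "e < n * n" for e
          unfolding c_def A3 using that A1'[of e] A1'[of "n * n + e"] by simp
        show "wp B (Seq weights (Seq powers (Seq phases
            (Seq clear_output (Seq mix (Write ''outlen'' (Num 0) Entries))))))
          (4 * (n * n) + 3 + (3 * K + 3 + (Suc (Suc K * Suc (time_phase n + 1)) +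
            (4 * (n * n) + 2 + (4 * n + 2 + 1))))) ?post s3"
        proof (rule wp_Seq_conseq[OF wp_weights[OF bd3 in30 n2 c c0]])
          show "1 + (\<Sum>e<n * n. c e) \<le> B" using totB tot1 tot by simp
        next
          fix s4
          assume Qt: "(\<forall>e<n * n. s4 ''Q'' (int e) = c e) \<and> s4 ''t'' 0 = 1 + (\<Sum>e<n * n. c e)"
            and bd4: "bounded_by B s4" and fr4: "\<And>x. x \<notin> mods weights \<Longrightarrow> s4 x = s3 x"
          have t4: "s4 ''t'' 0 = tot" using Qt tot by simp
          have in4: "s4 ''input'' = s ''input''" using fr4 in3 by simp
          have Q4: "entry n (s4 ''Q'') m w = c (m * n + w)" if "m < n" "w < n" for m w
          proof -
            have "s4 ''Q'' (int (m * n + w)) = c (m * n + w)" using Qt lt[OF that] by blast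
            then show ?thesis by (simp add: entry_def)
          qed
          show "wp B (Seq powers (Seq phases
              (Seq clear_output (Seq mix (Write ''outlen'' (Num 0) Entries)))))
            (3 * K + 3 + (Suc (Suc K * Suc (time_phase n + 1)) +
              (4 * (n * n) + 2 + (4 * n + 2 + 1)))) ?post s4"
          proof (rule wp_Seq_conseq[OF wp_powers[OF bd4]])
            show "1 \<le> s4 ''t'' 0" "s4 ''t'' 0 \<le> 2 ^ K" "2 * s4 ''t'' 0 \<le> B"
              unfolding t4 using tot1 K totB by simp_all
          next
            fix s5
            assume "\<exists>L\<le>K. s5 ''l'' 0 = int L \<and> (\<forall>t\<le>L. s5 ''p'' (int t) = 2 ^ t) \<and>
                s4 ''t'' 0 \<le> 2 ^ L \<and> 2 ^ L \<le> 2 * s4 ''t'' 0"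
              and bd5: "bounded_by B s5" and fr5: "\<And>x. x \<notin> mods powers \<Longrightarrow> s5 x = s4 x"
            then obtain L where L: "L \<le> K" "s5 ''l'' 0 = int L" "\<And>t. t \<le> L \<Longrightarrow> s5 ''p'' (int t) = 2 ^ t"
              "tot \<le> 2 ^ L" "2 ^ L \<le> 2 * tot" unfolding t4 by blast
            have in5: "s5 ''input'' = s ''input''" and Q5: "s5 ''Q'' = s4 ''Q''" using fr5 in4 by simp_all
            have in50: "s5 ''input'' 0 = int n" using in5 s(2) by simp
            have ph: "wp B phases (Suc (Suc K * Suc (time_phase n + 1)))
              (\<lambda>s'. \<exists>\<sigma> Q q. (\<forall>m<n. s' ''S'' (int m) = int (\<sigma> m)) \<and> near_optimal n 1 Q \<sigma> \<and>
                (\<forall>m<n. \<forall>w<n. Q m w = entry n (s5 ''Q'') m w - q w)) s5"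
            proof (rule wp_conseq[OF wp_phases[OF bd5 in50 L(2,3)]])
              show "Suc (Suc L * Suc (time_phase n + 1)) \<le> Suc (Suc K * Suc (time_phase n + 1))"
                using L(1) by (intro Suc_leI le_imp_less_Suc mult_right_mono) auto
              show "0 \<le> entry n (s5 ''Q'') m w \<and> entry n (s5 ''Q'') m w \<le> 2 ^ L" if "m < n" "w < n" for m w
                unfolding Q5 Q4[OF that] using c0[OF lt[OF that]] c_le[OF lt[OF that]] L(4) by linarith
              \<comment> \<open>The table of powers overshoots \<open>tot\<close> by a factor of at
                most 2 and the first phase needs room for \<open>2 ^ Suc L\<close>; together they
                give the 4.\<close>
              have "int (3 * n + 4) * 2 ^ Suc L \<le> int (3 * n + 4) * (4 * tot)"
                using L(5) by (intro mult_left_mono) auto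
              then show "int (3 * n + 4) * 2 ^ Suc L \<le> B" using B(3) by linarith
              have "int L \<le> 2 ^ L" by (metis less_exp less_imp_le of_nat_le_numeral_power_cancel_iff)
              then show "int L \<le> B" using L(5) totB tot1 by linarith
            qed
            show "wp B (Seq phases (Seq clear_output (Seq mix (Write ''outlen'' (Num 0) Entries))))
              (Suc (Suc K * Suc (time_phase n + 1)) + (4 * (n * n) + 2 + (4 * n + 2 + 1))) ?post s5"
            proof (rule wp_Seq_conseq[OF ph])
              fix s6
              assume "\<exists>\<sigma> Q q. (\<forall>m<n. s6 ''S'' (int m) = int (\<sigma> m)) \<and> near_optimal n 1 Q \<sigma> \<and>
                  (\<forall>m<n. \<forall>w<n. Q m w = entry n (s5 ''Q'') m w - q w)"
                and bd6: "bounded_by B s6" and fr6: "\<And>x. x \<notin> mods phases \<Longrightarrow> s6 x = s5 x"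
              then obtain \<sigma> Q q where \<sigma>: "\<And>m. m < n \<Longrightarrow> s6 ''S'' (int m) = int (\<sigma> m)" "near_optimal n 1 Q \<sigma>"
                and Q: "\<forall>m<n. \<forall>w<n. Q m w = entry n (s5 ''Q'') m w - q w" by blast
              have bij: "bij_betw \<sigma> {..<n} {..<n}" using \<sigma>(2) by (simp add: near_optimal_def)
              have \<sigma>n: "\<sigma> m < n" if "m < n" for m using bij that by (auto simp: bij_betw_def)
              have "\<forall>m<n. \<forall>w<n. Q m w = (int n + 1) * (u m w + v m w) - q w"
                using Q Q4 unfolding Q5 by (simp add: c_def u_def v_def)
              then obtain y where y: "\<And>m w. m < n \<Longrightarrow> w < n \<Longrightarrow>
                  u m w + v m w - y w \<le> u m (\<sigma> m) + v m (\<sigma> m) - y (\<sigma> m)"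
                using exact_dual[OF \<sigma>(2), of "\<lambda>m w. u m w + v m w" q] by blast
              have in6: "s6 ''input'' = s ''input''" and R6: "s6 ''R'' = s3 ''R''"
                using fr6 fr5 fr4 in5 by simp_all
              have in60: "s6 ''input'' 0 = int n" "s6 ''input'' 2 = b" using in6 s by simp_all
              show "wp B (Seq clear_output (Seq mix (Write ''outlen'' (Num 0) Entries)))
                (4 * (n * n) + 2 + (4 * n + 2 + 1)) ?post s6"
              proof (rule wp_Seq_conseq[OF wp_clear_output[OF bd6 in60 n2 B1]])
                fix s7
                assume out: "\<forall>e<n * n. s7 ''output'' (2 * int e) = 0 \<and> s7 ''output'' (2 * int e + 1) = b"
                  and bd7: "bounded_by B s7" and fr7: "\<And>x. x \<notin> mods clear_output \<Longrightarrow> s7 x = s6 x"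
                have in7: "s7 ''input'' 0 = int n" "s7 ''input'' 1 = a" "s7 ''input'' 2 = b"
                  using fr7 in6 s by simp_all
                have R7: "s7 ''R'' (int m) = int (\<rho> m) \<and> \<rho> m < n"
                  and S7: "s7 ''S'' (int m) = int (\<sigma> m) \<and> \<sigma> m < n" if "m < n" for m
                  using fr7 R6 R \<rho>(1) \<rho>n \<sigma>(1) \<sigma>n that by simp_all
                have out7: "s7 ''output'' (2 * (int m * int n + int w)) = 0 \<and>
                    s7 ''output'' (2 * (int m * int n + int w) + 1) = b" if "m < n" "w < n" for m w
                proof -
                  have "s7 ''output'' (2 * int (m * n + w)) = 0 \<and> s7 ''output'' (2 * int (m * n + w) + 1) = b"
                    using out lt[OF that] by blast
                  then show ?thesis by (simp only: of_nat_add of_nat_mult)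
                qed
                show "wp B (Seq mix (Write ''outlen'' (Num 0) Entries)) (4 * n + 2 + 1) ?post s7"
                proof (rule wp_Seq_conseq[OF wp_mix[OF bd7 in7 R7 S7 out7 n1 ab]])
                  fix s8
                  assume out: "\<forall>m<n. \<forall>w<n. s8 ''output'' (2 * (int m * int n + int w)) =
                      (if \<rho> m = w then b - a else 0) + (if \<sigma> m = w then a else 0) \<and>
                      s8 ''output'' (2 * (int m * int n + int w) + 1) = b"
                    and bd8: "bounded_by B s8" and fr8: "\<And>x. x \<notin> mods mix \<Longrightarrow> s8 x = s7 x"
                  have N8: "aval Entries s8 = int ?N" using fr8 in7(1) by simp
                  show "wp B (Write ''outlen'' (Num 0) Entries) 1 ?post s8"
                  proof (rule wp_Write[OF bd8], unfold N8)
                    show "\<bar>int ?N\<bar> \<le> B" using B(1) by simp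
                    show "?post (s8(''outlen'' := (s8 ''outlen'')(aval (Num 0) s8 := int ?N)))"
                      using \<rho>(2) bij y out
                      by (intro exI[of _ \<rho>] exI[of _ \<sigma>] exI[of _ y] conjI) simp_all
                  qed
                qed
              qed
            qed
          qed
        qed
      qed
    qed
  qed
qed

section \<open>Input and output encodings\<close>

lemma length_concat_map_upt:
  assumes "\<And>i. i < n \<Longrightarrow> length (f i) = k"
  shows "length (concat (map f [0..<n])) = n * k"
  using assms by (induction n) auto

lemma nth_concat_map_upt:
  assumes "\<And>i. i < n \<Longrightarrow> length (f i) = k" "i < n" "r < k"
  shows "concat (map f [0..<n]) ! (i * k + r) = f i ! r"
  using assms
proof (induction n)
  case (Suc n)
  have len: "length (concat (map f [0..<n])) = n * k"
    using Suc.prems(1) by (intro length_concat_map_upt) auto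
  show ?case
  proof (cases "i = n")
    case False
    then have "i < n" using Suc.prems by simp
    then have "i * k + r < Suc i * k" "Suc i * k \<le> n * k"
      using Suc.prems(3) by (simp, intro mult_le_mono1, simp)
    then have "i * k + r < n * k" by linarith
    then show ?thesis using Suc \<open>i < n\<close> len by (simp add: nth_append)
  qed (use len in \<open>simp add: nth_append\<close>)
qed simp

lemma length_encode_matrix: "length (encode_matrix n A) = 2 * (n * n)"
proof -
  have "length (encode_matrix n A) = n * (n * 2)"
    unfolding encode_matrix_def by (intro length_concat_map_upt) (simp add: encode_rat_def)
  then show ?thesis by simp
qed

lemma nth_encode_matrix:
  assumes "i < n" "j < n" "r < 2"
  shows "encode_matrix n A ! (2 * (i * n + j) + r) = encode_rat (A i j) ! r"
proof -
  let ?row = "\<lambda>i. concat (map (\<lambda>j. encode_rat (A i j)) [0..<n])"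
  have len: "length (encode_rat q) = 2" for q by (simp add: encode_rat_def)
  have row: "length (?row i) = n * 2" for i
    by (rule length_concat_map_upt) (rule len)
  have "j * 2 + r < Suc j * 2" "Suc j * 2 \<le> n * 2"
    using assms by simp_all
  then have "j * 2 + r < n * 2" by linarith
  then have "encode_matrix n A ! (i * (n * 2) + (j * 2 + r)) = ?row i ! (j * 2 + r)"
    unfolding encode_matrix_def using assms(1) by (intro nth_concat_map_upt row)
  also have "\<dots> = encode_rat (A i j) ! r" using assms by (intro nth_concat_map_upt len)
  also have "i * (n * 2) + (j * 2 + r) = 2 * (i * n + j) + r" by simp
  finally show ?thesis .
qed

text \<open>Both matrices as one list in the order of the encoding, so that the common denominator
  is a product over a single range.\<close>

definition cell_value :: "smc \<Rightarrow> nat \<Rightarrow> rat" where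
  "cell_value I e = (let n = agents I in
     if e < n * n then U I (e div n) (e mod n) else V I ((e - n * n) div n) ((e - n * n) mod n))"

lemma cell_value_men: "m < agents I \<Longrightarrow> w < agents I \<Longrightarrow> cell_value I (m * agents I + w) = U I m w"
  using index_less[of m "agents I" w] by (simp add: cell_value_def Let_def)

lemma cell_value_women: "m < agents I \<Longrightarrow> w < agents I \<Longrightarrow>
  cell_value I (agents I * agents I + (m * agents I + w)) = V I m w"
  by (simp add: cell_value_def Let_def)

lemma cell_cases:
  fixes n :: nat
  assumes "e < 2 * (n * n)"
  obtains m w where "m < n" "w < n" "e = m * n + w" | m w where "m < n" "w < n" "e = n * n + (m * n + w)"
proof (cases "e < n * n")
  case True
  then have "0 < n" by (cases n) auto
  with True have "e div n < n" "e mod n < n" "e = (e div n) * n + e mod n"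
    by (auto simp: less_mult_imp_div_less)
  then show ?thesis using that(1) by blast
next
  case False
  let ?e = "e - n * n"
  have "0 < n" using assms by (cases n) auto
  moreover have "?e < n * n" using False assms by simp
  ultimately have "?e div n < n" "?e mod n < n" "e = n * n + ((?e div n) * n + ?e mod n)"
    using False by (auto simp: less_mult_imp_div_less)
  then show ?thesis using that(2) by blast
qed

lemma length_encode_input: "length (encode_input I \<epsilon>) = 4 * (agents I * agents I) + 3"
  by (simp add: encode_input_def length_encode_matrix encode_rat_def)

lemma nth_encode_input:
  "encode_input I \<epsilon> ! 0 = int (agents I)"
  "encode_input I \<epsilon> ! 1 = fst (quotient_of \<epsilon>)" "encode_input I \<epsilon> ! 2 = snd (quotient_of \<epsilon>)"
  by (simp_all add: encode_input_def encode_rat_def numeral_2_eq_2)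

lemma nth_encode_input_cell:
  assumes "e < 2 * (agents I * agents I)" "r < 2"
  shows "encode_input I \<epsilon> ! (3 + 2 * e + r) = encode_rat (cell_value I e) ! r"
proof -
  let ?n = "agents I"
  have split: "encode_input I \<epsilon> ! (3 + k) = (encode_matrix ?n (U I) @ encode_matrix ?n (V I)) ! k" for k
    by (simp add: encode_input_def encode_rat_def numeral_3_eq_3)
  from assms(1) show ?thesis
  proof (cases rule: cell_cases)
    case (1 m w)
    have "2 * e + r < 2 * (?n * ?n)" using index_less[OF 1(1,2)] 1(3) assms(2) by simp
    then show ?thesis
      using nth_encode_matrix[OF 1(1,2) assms(2), of "U I"] cell_value_men[OF 1(1,2)] 1(3)
        split[of "2 * e + r"]
      by (simp add: nth_append length_encode_matrix add.assoc)
  next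
    case (2 m w)
    have "2 * e + r = 2 * (?n * ?n) + (2 * (m * ?n + w) + r)" using 2 by simp
    then show ?thesis
      using nth_encode_matrix[OF 2(1,2) assms(2), of "V I"] cell_value_women[OF 2(1,2)] 2(3)
        split[of "2 * e + r"]
      by (simp add: nth_append length_encode_matrix add.assoc)
  qed
qed

section \<open>Size of the input numbers in terms of its length\<close>

lemma sum_len_le_bits:
  assumes "J \<subseteq> {..<length xs}"
  shows "(\<Sum>i\<in>J. len (xs ! i)) \<le> bits xs"
proof -
  have "(\<Sum>i\<in>J. len (xs ! i)) \<le> (\<Sum>i<length xs. len (xs ! i))"
    using assms by (intro sum_mono2) auto
  also have "\<dots> = bits xs" by (simp add: bits_def sum_list_sum_nth atLeast0LessThan)
  finally show ?thesis .
qed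

lemma length_le_bits: "length xs \<le> bits xs"
proof -
  have "(\<Sum>i<length xs. 1) \<le> (\<Sum>i<length xs. len (xs ! i))" by (intro sum_mono len_pos)
  then show ?thesis using sum_len_le_bits[of "{..<length xs}" xs] by simp
qed

lemma abs_le_power_len: "\<bar>z\<bar> \<le> 2 ^ len z"
proof -
  have "\<bar>z\<bar> \<le> 2 ^ (len z - 1)" using abs_less_len[of z] by simp
  also have "\<dots> \<le> 2 ^ len z" by (intro power_increasing) auto
  finally show ?thesis .
qed

lemma abs_le_power_bits:
  assumes "x \<in> set xs"
  shows "\<bar>x\<bar> \<le> 2 ^ bits xs"
proof -
  obtain i where i: "i < length xs" "x = xs ! i" using assms by (auto simp: in_set_conv_nth)
  have "\<bar>x\<bar> \<le> 2 ^ len x" by (rule abs_le_power_len)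
  also have "\<dots> \<le> 2 ^ bits xs"
    using sum_len_le_bits[of "{i}" xs] i by (intro power_increasing) auto
  finally show ?thesis .
qed

section \<open>Polynomials in the input size\<close>

definition is_poly :: "(nat \<Rightarrow> nat) \<Rightarrow> bool" where
  "is_poly f \<longleftrightarrow> (\<exists>p. \<forall>x. poly p x = f x)"

lemma is_poly_intros:
  "is_poly (\<lambda>x. c)" "is_poly (\<lambda>x. x)"
  "is_poly f \<Longrightarrow> is_poly g \<Longrightarrow> is_poly (\<lambda>x. f x + g x)"
  "is_poly f \<Longrightarrow> is_poly g \<Longrightarrow> is_poly (\<lambda>x. f x * g x)"
  "is_poly f \<Longrightarrow> is_poly (\<lambda>x. Suc (f x))"
  "is_poly f \<Longrightarrow> is_poly (\<lambda>x. f x ^ k)"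
proof -
  show "is_poly (\<lambda>x. c)" unfolding is_poly_def by (rule exI[of _ "[:c:]"]) simp
  show "is_poly (\<lambda>x. x)" unfolding is_poly_def by (rule exI[of _ "[:0, 1:]"]) simp
  show "is_poly f \<Longrightarrow> is_poly g \<Longrightarrow> is_poly (\<lambda>x. f x + g x)"
    unfolding is_poly_def by (metis poly_add)
  show "is_poly f \<Longrightarrow> is_poly g \<Longrightarrow> is_poly (\<lambda>x. f x * g x)"
    unfolding is_poly_def by (metis poly_mult)
  show "is_poly f \<Longrightarrow> is_poly (\<lambda>x. f x ^ k)"
    unfolding is_poly_def by (metis poly_power)
  assume "is_poly f"
  then obtain p where "\<forall>x. poly p x = f x" unfolding is_poly_def by blast
  then have "\<forall>x. poly (p + 1) x = Suc (f x)" by simp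
  then show "is_poly (\<lambda>x. Suc (f x))" unfolding is_poly_def by blast
qed

lemma solver_time_mono: "n \<le> n' \<Longrightarrow> solver_time n K \<le> solver_time n' K"
  unfolding solver_time_def time_da_def time_phase_def
  by (intro add_mono mult_le_mono iffD2[OF Suc_le_mono] le_refl) assumption+

text \<open>The exponent \<open>4 * x + 2\<close> bounds the total weight, and
  \<open>5 * x + 8\<close> is the length of the store bound \<open>2 ^ (5 * x + 6)\<close>. The last
  summand pays for an output of at most \<open>x\<close> numbers of that length.\<close>

definition total_time :: "nat \<Rightarrow> nat" where
  "total_time x = solver_time x (4 * x + 2) * (weight smc_solver * (5 * x + 8) ^ 2) + x * (5 * x + 8)"

lemma is_poly_total_time: "is_poly total_time"
  unfolding total_time_def[abs_def] solver_time_def time_da_def time_phase_def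
  by (intro is_poly_intros)

section \<open>Size bounds\<close>

lemma quotient_of_eq: "q = of_int (fst (quotient_of q)) / of_int (snd (quotient_of q))"
  by (rule quotient_of_div) simp

lemma quotient_of_nonneg:
  assumes "0 \<le> q"
  shows "0 \<le> fst (quotient_of q)"
proof -
  have "0 \<le> rat_of_int (fst (quotient_of q)) / of_int (snd (quotient_of q))"
    using assms by (simp only: quotient_of_eq[symmetric])
  then show ?thesis using quotient_of_denom_pos'[of q] by (simp add: zero_le_divide_iff)
qed

lemma scaled_quotient:
  fixes q :: "nat \<Rightarrow> rat"
  assumes "e < N"
  shows "rat_of_int (scaled N (\<lambda>e. fst (quotient_of (q e))) (\<lambda>e. snd (quotient_of (q e))) e) =
    q e * of_int (\<Prod>f<N. snd (quotient_of (q f)))"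
proof -
  let ?den = "\<lambda>e. snd (quotient_of (q e))"
  have "(\<Prod>f<N. ?den f) = ?den e * (\<Prod>f\<in>{..<N} - {e}. ?den f)"
    using assms by (simp add: prod.remove)
  moreover have "rat_of_int (?den e) \<noteq> 0" using quotient_of_denom_pos'[of "q e"] by simp
  moreover have "rat_of_int (fst (quotient_of (q e))) = q e * of_int (?den e)"
    using quotient_of_eq[of "q e"] calculation(2) by (metis nonzero_eq_divide_eq)
  ultimately show ?thesis by (simp add: scaled_def)
qed

lemma scaled_le:
  assumes "e < N" "0 \<le> num e" "\<And>f. f < N \<Longrightarrow> 1 \<le> den f"
  shows "scaled N num den e \<le> num e * (\<Prod>f<N. den f)"
  unfolding scaled_def
  by (intro mult_left_mono prod_mono2) (use assms in \<open>force+\<close>)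

text \<open>The lengths of the factors add up, and \<open>g\<close> places the factors at distinct
  positions of the input. Hence the common denominator is no longer than the input itself.\<close>

lemma prod_le_power_bits:
  fixes den :: "nat \<Rightarrow> int"
  assumes "\<And>f. f < N \<Longrightarrow> 1 \<le> den f" "\<And>f. f < N \<Longrightarrow> g f < length xs \<and> xs ! g f = den f"
    and "inj_on g {..<N}"
  shows "(\<Prod>f<N. den f) \<le> 2 ^ bits xs"
proof -
  have "(\<Prod>f<N. den f) \<le> (\<Prod>f<N. 2 ^ len (den f))"
  proof (intro prod_mono conjI)
    fix f assume "f \<in> {..<N}"
    then show "0 \<le> den f" using assms(1)[of f] by simp
    show "den f \<le> 2 ^ len (den f)" using abs_le_power_len[of "den f"] by simp
  qed
  also have "\<dots> = 2 ^ (\<Sum>f<N. len (den f))" by (simp add: power_sum)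
  also have "(\<Sum>f<N. len (den f)) = (\<Sum>i\<in>g ` {..<N}. len (xs ! i))"
    using assms(2,3) by (simp add: sum.reindex)
  also have "(2::int) ^ \<dots> \<le> 2 ^ bits xs"
    using assms(2) by (intro power_increasing sum_len_le_bits) auto
  finally show ?thesis .
qed

text \<open>Each of \<open>n * n\<close> and \<open>n + 1\<close> is at most \<open>2 ^ x\<close>,
  and two cells contribute twice \<open>2 ^ (2 * x)\<close>. With the leading 1 this makes at most
  three times \<open>2 ^ (4 * x)\<close>.\<close>

lemma total_weight_le:
  fixes A :: "nat \<Rightarrow> int" and n x :: nat
  assumes A: "\<And>e. e < 2 * (n * n) \<Longrightarrow> A e \<le> 2 ^ (2 * x)" and x: "n * n \<le> x" "n + 1 \<le> x"
  shows "1 + (\<Sum>e<n * n. (int n + 1) * (A e + A (n * n + e))) \<le> 2 ^ (4 * x + 2)"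
proof -
  let ?M = "2 ^ (2 * x) :: int"
  have x2: "int x \<le> 2 ^ x" by (metis less_exp less_imp_le of_nat_le_numeral_power_cancel_iff)
  have "(\<Sum>e<n * n. (int n + 1) * (A e + A (n * n + e))) \<le> (\<Sum>e<n * n. (int n + 1) * (?M + ?M))"
    by (intro sum_mono mult_left_mono add_mono A) auto
  also have "\<dots> = int (n * n) * (int (n + 1) * (2 * ?M))" by simp
  also have "\<dots> \<le> 2 ^ x * (2 ^ x * (2 * ?M))"
    by (intro mult_mono order_trans[OF _ x2]) (use x in \<open>simp_all only: of_nat_le_iff\<close>, simp_all)
  also have "\<dots> = 2 * 2 ^ (4 * x)" by (simp add: power_add[symmetric] mult.assoc[symmetric])
  finally have "1 + (\<Sum>e<n * n. (int n + 1) * (A e + A (n * n + e))) \<le> 2 ^ (4 * x) + 2 * 2 ^ (4 * x)"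
    using one_le_power[of "2 :: int" "4 * x"] by linarith
  also have "\<dots> \<le> 2 ^ (4 * x + 2)" by (simp add: power_add)
  finally show ?thesis .
qed

lemma bits_result_le:
  assumes "bounded_by B s"
  shows "bits (result s) \<le> nat (s ''outlen'' 0) * len B"
proof -
  have "bits (result s) = (\<Sum>k<nat (s ''outlen'' 0). len (s ''output'' (int k)))"
    by (simp add: bits_def result_def sum_list_sum_nth atLeast0LessThan)
  also have "\<dots> \<le> (\<Sum>k<nat (s ''outlen'' 0). len B)"
    using assms abs_ge_self[of B] by (intro sum_mono len_mono) (auto simp: bounded_by_def intro: order_trans)
  finally show ?thesis by simp
qed

lemma bounded_load:
  assumes "\<And>x. x \<in> set xs \<Longrightarrow> \<bar>x\<bar> \<le> B" "int (length xs) \<le> B"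
  shows "bounded_by B (load xs)"
  using assms nth_mem by (auto simp: bounded_by_def load_def)

lemma load_input: "k < length xs \<Longrightarrow> load xs ''input'' (int k) = xs ! k"
  by (simp add: load_def)

lemma solver_correct:
  assumes inst: "smc_instance I" and \<epsilon>: "0 \<le> \<epsilon>" "\<epsilon> \<le> 1"
  shows "\<exists>ys \<mu>. computes_within smc_solver (encode_input I \<epsilon>) (total_time (bits (encode_input I \<epsilon>))) ys \<and>
    represents_matching (agents I) ys \<mu> \<and> complete_matching I \<mu> \<and> eps_stable I (of_rat \<epsilon>) \<mu> \<and>
    (\<exists>\<mu>opt. optimal_matching I \<mu>opt \<and> welfare I \<mu> \<ge> of_rat \<epsilon> * welfare I \<mu>opt)"
proof -
  define n where "n = agents I"
  define N where "N = 2 * (n * n)"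
  define xs where "xs = encode_input I \<epsilon>"
  define X where "X = bits xs"
  \<comment> \<open>The prices decide: \<open>3 * n + 4\<close> is at most \<open>4 * 2 ^ X\<close>,
    a further 4 stems from the powers of two, and the total weight is at most
    \<open>2 ^ (4 * X + 2)\<close>. The exponents sum to \<open>5 * X + 6\<close>.\<close>
  define B where "B = (2 :: int) ^ (5 * X + 6)"
  define num where "num e = fst (quotient_of (cell_value I e))" for e
  define den where "den e = snd (quotient_of (cell_value I e))" for e
  define a where "a = fst (quotient_of \<epsilon>)"
  define b where "b = snd (quotient_of \<epsilon>)"
  define D where "D = (\<Prod>f<N. den f)"
  define A where "A = scaled N num den"
  have len: "length xs = 2 * N + 3" by (simp add: xs_def N_def n_def length_encode_input)
  then have X: "2 * N + 3 \<le> X" using length_le_bits[of xs] by (simp add: X_def)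
  moreover have "n \<le> n * n" by simp
  ultimately have nX: "n * n \<le> X" "n + 1 \<le> X" "N \<le> X" unfolding N_def by linarith+
  have cell: "xs ! (3 + 2 * e) = num e" "xs ! (4 + 2 * e) = den e" if "e < N" for e
    using nth_encode_input_cell[of e I 0 \<epsilon>] nth_encode_input_cell[of e I 1 \<epsilon>] that
    by (simp_all add: xs_def N_def n_def num_def den_def encode_rat_def add.commute numeral_eq_Suc)
  have cell0: "0 \<le> cell_value I e" if "e < N" for e
    using that unfolding N_def
  proof (cases rule: cell_cases)
    case (1 m w)
    then show ?thesis using inst cell_value_men[of m I w] by (simp add: n_def smc_instance_def)
  next
    case (2 m w)
    then show ?thesis using inst cell_value_women[of m I w] by (simp add: n_def smc_instance_def)
  qed
  have num0: "0 \<le> num e" if "e < N" for e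
    unfolding num_def by (rule quotient_of_nonneg[OF cell0[OF that]])
  have den1: "1 \<le> den e" for e using quotient_of_denom_pos'[of "cell_value I e"] by (simp add: den_def)
  have D: "D \<le> 2 ^ X" unfolding D_def X_def
    by (rule prod_le_power_bits[where g = "\<lambda>e. 4 + 2 * e"])
      (use den1 cell len in \<open>auto simp: inj_on_def\<close>)
  have D1: "1 \<le> D" unfolding D_def using den1 by (intro prod_ge_1) auto
  have numX: "num e \<le> 2 ^ X" if "e < N" for e
  proof -
    have "num e \<in> set xs" using cell(1)[OF that] nth_mem[of "3 + 2 * e" xs] len that by simp
    then show ?thesis using abs_le_power_bits[of "num e" xs] by (simp add: X_def)
  qed
  have numD: "num e * D \<le> 2 ^ (2 * X)" if "e < N" for e
  proof -
    have "num e * D \<le> 2 ^ X * 2 ^ X" using numX[OF that] D D1 by (intro mult_mono) auto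
    then show ?thesis by (simp add: power_add[symmetric] mult_2)
  qed
  have A_le: "A e \<le> 2 ^ (2 * X)" if "e < N" for e
    using scaled_le[of e N num den] num0[OF that] den1 numD[OF that] that unfolding A_def D_def by fastforce
  let ?tot = "1 + (\<Sum>e<n * n. (int n + 1) * (A e + A (n * n + e)))"
  have tot: "?tot \<le> 2 ^ (4 * X + 2)"
    by (rule total_weight_le) (use A_le nX in \<open>auto simp: N_def\<close>)
  have X2: "int X \<le> 2 ^ X" by (metis less_exp less_imp_le of_nat_le_numeral_power_cancel_iff)
  have pow: "(2 :: int) ^ k \<le> B" if "k \<le> 5 * X + 6" for k
    unfolding B_def using that by (intro power_increasing) auto
  have small: "z \<le> B" if "z \<le> 2 ^ X" for z using that pow[of X] by linarith
  have totB: "int (3 * n + 4) * (4 * ?tot) \<le> B"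
  proof -
    have "int (3 * n + 4) * (4 * ?tot) \<le> int (3 * n + 4) * (4 * 2 ^ (4 * X + 2))"
      using tot by (intro mult_left_mono) auto
    also have "\<dots> \<le> (4 * 2 ^ X) * (4 * 2 ^ (4 * X + 2))"
    proof (rule mult_right_mono)
      have "int (3 * n + 4) \<le> 4 * int X" using nX(2) by linarith
      then show "int (3 * n + 4) \<le> 4 * 2 ^ X" using X2 by linarith
    qed simp
    also have "\<dots> = 2 ^ X * 2 ^ (4 * X + 2) * 2 ^ 4" by simp
    also have "\<dots> = 2 ^ (X + (4 * X + 2) + 4)" by (simp only: power_add)
    also have "X + (4 * X + 2) + 4 = 5 * X + 6" by simp
    finally show ?thesis by (simp only: B_def)
  qed
  have ab: "0 \<le> a" "a \<le> b" "0 < b"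
  proof -
    show "0 \<le> a" unfolding a_def by (rule quotient_of_nonneg[OF \<epsilon>(1)])
    show b: "0 < b" unfolding b_def by (rule quotient_of_denom_pos')
    have "rat_of_int a / rat_of_int b \<le> 1" using quotient_of_eq[of \<epsilon>] \<epsilon>(2) by (simp add: a_def b_def)
    then show "a \<le> b" using b by (simp add: divide_le_eq_1)
  qed
  have bd: "bounded_by B (load xs)"
  proof (rule bounded_load)
    show "\<bar>x\<bar> \<le> B" if "x \<in> set xs" for x
      using abs_le_power_bits[OF that] small unfolding X_def by blast
    have "int (length xs) \<le> int X" using length_le_bits[of xs] by (simp add: X_def)
    then show "int (length xs) \<le> B" using X2 small[of "int (length xs)"] by linarith
  qed
  let ?u = "\<lambda>m w. A (m * n + w)" and ?v = "\<lambda>m w. A (n * n + (m * n + w))"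
  have "wp B smc_solver (solver_time n (4 * X + 2)) (\<lambda>s'. \<exists>\<rho> \<sigma> y.
      stable_for n ?u ?v \<rho> \<and> bij_betw \<sigma> {..<n} {..<n} \<and>
      (\<forall>m<n. \<forall>w<n. ?u m w + ?v m w - y w \<le> ?u m (\<sigma> m) + ?v m (\<sigma> m) - y (\<sigma> m)) \<and>
      s' ''outlen'' 0 = int N \<and>
      (\<forall>m<n. \<forall>w<n. s' ''output'' (2 * (int m * int n + int w)) =
          (if \<rho> m = w then b - a else 0) + (if \<sigma> m = w then a else 0) \<and>
        s' ''output'' (2 * (int m * int n + int w) + 1) = b)) (load xs)"
    unfolding A_def N_def
  proof (rule wp_smc_solver[OF bd])
    have "0 < length xs" using len by simp
    then show "load xs ''input'' 0 = int n" "load xs ''input'' 1 = a" "load xs ''input'' 2 = b"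
      using load_input[of 0 xs] load_input[of 1 xs] load_input[of 2 xs] len nth_encode_input[of I \<epsilon>]
      by (simp_all add: xs_def n_def a_def b_def)
    show "load xs ''input'' (3 + 2 * int e) = num e \<and> load xs ''input'' (4 + 2 * int e) = den e"
      if "e < 2 * (n * n)" for e
      using load_input[of "3 + 2 * e" xs] load_input[of "4 + 2 * e" xs] len cell[of e] that
      by (simp add: N_def)
    have "int N \<le> int X" using nX(3) by simp
    then show "int (2 * (n * n)) \<le> B" using X2 small[of "int N"] unfolding N_def by linarith
    show "num e * (\<Prod>f<2 * (n * n). den f) \<le> B" if "e < 2 * (n * n)" for e
      using numD[of e] pow[of "2 * X"] that unfolding N_def D_def by linarith
  qed (use ab num0 den1 totB tot in \<open>simp_all add: N_def A_def del: of_nat_add of_nat_mult\<close>)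
  then obtain t s \<rho> \<sigma> y where ex: "exec smc_solver (load xs) t s"
      "t \<le> solver_time n (4 * X + 2) * (weight smc_solver * (len B)\<^sup>2)" and bds: "bounded_by B s"
    and \<rho>: "stable_for n ?u ?v \<rho>" and \<sigma>: "bij_betw \<sigma> {..<n} {..<n}"
    and dual: "\<And>m w. m < n \<Longrightarrow> w < n \<Longrightarrow> ?u m w + ?v m w - y w \<le> ?u m (\<sigma> m) + ?v m (\<sigma> m) - y (\<sigma> m)"
    and outlen: "s ''outlen'' 0 = int N"
    and out: "\<And>m w. m < n \<Longrightarrow> w < n \<Longrightarrow> s ''output'' (2 * (int m * int n + int w)) =
          (if \<rho> m = w then b - a else 0) + (if \<sigma> m = w then a else 0) \<and>
        s ''output'' (2 * (int m * int n + int w) + 1) = b"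
    unfolding wp_def by blast
  define \<mu> where "\<mu> = mixture (of_rat \<epsilon>) \<rho> \<sigma>"
  have lenB: "len B \<le> 5 * X + 8" using len_le[of B "5 * X + 7"] by (simp add: B_def)
  have "computes_within smc_solver xs (total_time X) (result s)"
    unfolding computes_within_def total_time_def
  proof (intro exI[of _ t] exI[of _ s] conjI add_mono)
    show "t \<le> solver_time X (4 * X + 2) * (weight smc_solver * (5 * X + 8)\<^sup>2)"
      using nX by (intro order_trans[OF ex(2)] mult_le_mono solver_time_mono power_mono lenB) auto
    show "bits (result s) \<le> X * (5 * X + 8)"
      using nX outlen by (intro order_trans[OF bits_result_le[OF bds]] mult_le_mono lenB) auto
  qed (use ex in auto)
  moreover have "represents_matching n (result s) \<mu>"
    unfolding represents_matching_def
  proof (intro conjI allI impI)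
    show "length (result s) = 2 * n * n" using outlen by (simp add: result_def) (simp add: N_def)
    fix m w assume mw: "m < n" "w < n"
    let ?k = "2 * (m * n + w)"
    have k: "?k + 1 < N" using index_less[OF mw] by (simp add: N_def)
    then have nth: "result s ! ?k = s ''output'' (int ?k)" "result s ! (?k + 1) = s ''output'' (int (?k + 1))"
      using outlen by (simp_all add: result_def del: of_nat_add of_nat_mult of_nat_Suc)
    have val: "result s ! ?k = (if \<rho> m = w then b - a else 0) + (if \<sigma> m = w then a else 0)"
      "result s ! (?k + 1) = b"
      unfolding nth using out[OF mw] by (simp_all add: add.commute)
    show "result s ! (?k + 1) > 0" using val ab by simp
    have "real_of_rat \<epsilon> = of_int a / of_int b"
      using quotient_of_eq[of \<epsilon>] by (metis a_def b_def of_rat_divide of_rat_of_int_eq)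
    then show "\<mu> m w = of_int (result s ! ?k) / of_int (result s ! (?k + 1))"
      unfolding val \<mu>_def mixture_def using ab(3) by (simp add: field_simps)
  qed
  moreover have "complete_matching I \<mu> \<and> eps_stable I (of_rat \<epsilon>) \<mu> \<and>
    (\<exists>\<mu>opt. optimal_matching I \<mu>opt \<and> welfare I \<mu> \<ge> of_rat \<epsilon> * welfare I \<mu>opt)"
  proof -
    have scale: "rat_of_int (A e) = cell_value I e * of_int D" if "e < N" for e
      using scaled_quotient[OF that, of "cell_value I"] by (simp add: A_def D_def num_def[abs_def] den_def[abs_def])
    have u: "rat_of_int (?u m w) = U I m w * of_int D" if "m < n" "w < n" for m w
      using scale[of "m * n + w"] cell_value_men[of m I w] index_less[OF that] that by (simp add: N_def n_def)
    have v: "rat_of_int (?v m w) = V I m w * of_int D" if "m < n" "w < n" for m w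
      using scale[of "n * n + (m * n + w)"] cell_value_women[of m I w] index_less[OF that] that
      by (simp add: N_def n_def)
    have Dpos: "0 < rat_of_int D" using D1 by simp
    have \<rho>': "stable_for n (U I) (V I) \<rho>"
    proof (rule stable_for_mono[OF \<rho>])
      fix m w w' assume "m < n" "w < n" "w' < n" "?u m w \<le> ?u m w'"
      then have "U I m w * of_int D \<le> U I m w' * of_int D" by (metis u of_int_le_iff)
      then show "U I m w \<le> U I m w'" using Dpos by simp
    next
      fix m h w assume "m < n" "h < n" "w < n" "?v m w \<le> ?v h w"
      then have "V I m w * of_int D \<le> V I h w * of_int D" by (metis v of_int_le_iff)
      then show "V I m w \<le> V I h w" using Dpos by simp
    qed
    have Dr: "0 < real_of_int D" using D1 by simp
    have uv: "real_of_int (?u m w + ?v m w) = pair_value I m w * of_int D" if "m < n" "w < n" for m w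
    proof -
      have "real_of_rat (rat_of_int (?u m w + ?v m w)) = real_of_rat ((U I m w + V I m w) * of_int D)"
        using u[OF that] v[OF that] by (simp add: distrib_right)
      then show ?thesis by (simp add: pair_value_def of_rat_add of_rat_mult)
    qed
    \<comment> \<open>Dividing by the common denominator turns the integer prices into real prices
      for the original values.\<close>
    have dual': "pair_value I m w - of_int (y w) / of_int D \<le> pair_value I m (\<sigma> m) - of_int (y (\<sigma> m)) / of_int D"
      if mw: "m < n" "w < n" for m w
    proof -
      have "\<sigma> m < n" using \<sigma> mw by (auto simp: bij_betw_def)
      have "real_of_int (?u m w + ?v m w) - of_int (y w) \<le> of_int (?u m (\<sigma> m) + ?v m (\<sigma> m)) - of_int (y (\<sigma> m))"
        using dual[OF mw] by linarith
      then have "(pair_value I m w * of_int D - of_int (y w)) / of_int D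
          \<le> (pair_value I m (\<sigma> m) * of_int D - of_int (y (\<sigma> m))) / of_int D"
        unfolding uv[OF mw] uv[OF mw(1) \<open>\<sigma> m < n\<close>] using Dr by (intro divide_right_mono) auto
      then show ?thesis using Dr by (simp add: diff_divide_distrib)
    qed
    have \<epsilon>': "0 \<le> real_of_rat \<epsilon>" "real_of_rat \<epsilon> \<le> 1" using \<epsilon> by simp_all
    note good = mixture_good[OF inst \<epsilon>', of \<rho> \<sigma> "\<lambda>w. of_int (y w) / of_int D"]
    show ?thesis unfolding \<mu>_def using good \<rho>' \<sigma> dual' unfolding n_def by blast
  qed
  ultimately show ?thesis unfolding X_def xs_def n_def by blast
qed

theorem theorem6:
  "\<exists>(c :: com) (p :: nat poly). \<forall>(I :: smc) (\<epsilon> :: rat).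
     smc_instance I \<and> 0 \<le> \<epsilon> \<and> \<epsilon> \<le> 1 \<longrightarrow>
     (\<exists>(ys :: int list) (\<mu> :: matching).
        computes_within c (encode_input I \<epsilon>) (poly p (bits (encode_input I \<epsilon>))) ys \<and>
        represents_matching (agents I) ys \<mu> \<and>
        complete_matching I \<mu> \<and>
        eps_stable I (of_rat \<epsilon>) \<mu> \<and>
        (\<exists>\<mu>opt. optimal_matching I \<mu>opt \<and> welfare I \<mu> \<ge> of_rat \<epsilon> * welfare I \<mu>opt))"
proof -
  obtain p where p: "poly p x = total_time x" for x
    using is_poly_total_time unfolding is_poly_def by blast
  show ?thesis
    by (intro exI[of _ smc_solver] exI[of _ p] allI impI, unfold p, intro solver_correct) auto
qed

end
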